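(* Let $(\mathcal L,\mathcal P,\mathcal J)$ be an extremal partial configuration. Then there is a refinement $(\mathcal L,\mathcal P',\mathcal J')$ such that for each point $p\in\mathcal P'$ there are lines $l_1,\dots,l_M$ of $\mathcal L$ incident to $p$ with $(l_j,p)\in\mathcal J'$, in order of their direction, with $M\gtrsim N^{1/3-}$, such that each sector bounded by consecutive lines $l_j,l_{j+1}$ contains a structured set $\mathcal P_j\subset\mathcal P$ of $\gtrsim N^{2/3-}$ points.
   Context: Conventions: $N$ is a large parameter and $\epsilon_0>0$ a fixed small exponent. $A\lesssim B$ means $A\le CB$ with $C$ independent of $N$; $A\sim B$ means $A\lesssim B\lesssim A$. $N^{a+}$ (resp. $N^{a-}$) denotes $N^{a+\epsilon}$ (resp. $N^{a-\epsilon}$) for some $0\le\epsilon\lesssim\epsilon_0$, possibly different at each occurrence. An extremal partial configuration $(\mathcal L,\mathcal P,\mathcal J)$ consists of a set $\mathcal L$ of lines and a set $\mathcal P$ of points in $\mathbb R^2$ with $N^{1-}\lesssim|\mathcal L|,|\mathcal P|\le N$, and a set $\mathcal J$ of incident pairs $(L,P)\in\mathcal L\times\mathcal P$ with $|\mathcal J|\gtrsim N^{4/3-}$. A refinement $(\mathcal L,\mathcal P',\mathcal J')$ has $\mathcal P'\subset\mathcal P$, $\mathcal J'\subset\mathcal J\cap(\mathcal L\times\mathcal P')$, $|\mathcal P'|\sim|\mathcal P|$, $|\mathcal J'|\sim|\mathcal J|$. The sector bounded by consecutive lines $l_j,l_{j+1}$ through $p$ is the double wedge at $p$ between $l_j$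 and $l_{j+1}$ containing no other $l_i$. A set of at least $N^{2/3-}$ points is structured if there is a set of at most $N^{1/3+}$ lines such that each of the points lies on at least two of them.
   Formalization: In the refinement, |P'| ∼ |P| (false in general: add about N/2 points on no line to a grid example) is replaced by |P'| ≳ N^{0-}|P| and |P'| ≳ the number of points of P having ≳ N^{1/3-} incidences in J; |J'| ∼ |J| is kept. *)

theory Defs
  imports "HOL-Analysis.Analysis"
begin

text \<open>
  Asymptotic notation. Every predicate below has an explicit implied constant \<open>C\<close> and an
  explicit exponent loss \<open>\<kappa>\<close>. In use \<open>\<kappa> = K * \<epsilon>0\<close>, where \<open>K\<close> is the constant implied by
  \<open>0 \<le> \<epsilon> \<lesssim> \<epsilon>0\<close>. Since \<open>N \<ge> 1\<close>, a bound by \<open>N\<close> to the power \<open>a - \<epsilon>\<close> for some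
  \<open>\<epsilon> \<in> {0..\<kappa>}\<close> is the same as the bound with \<open>\<epsilon> = \<kappa>\<close>; likewise for \<open>a + \<epsilon>\<close>.
\<close>

definition is_line :: "(real^2) set \<Rightarrow> bool" where
  "is_line l \<longleftrightarrow> affine l \<and> aff_dim l = 1"

definition extremal_partial_configuration ::
  "real \<Rightarrow> real \<Rightarrow> real \<Rightarrow> (real^2) set set \<Rightarrow> (real^2) set \<Rightarrow> ((real^2) set \<times> (real^2)) set \<Rightarrow> bool" where
  "extremal_partial_configuration C \<kappa> N L P J \<longleftrightarrow>
     finite L \<and> (\<forall>l\<in>L. is_line l) \<and> finite P \<and>
     N powr (1 - \<kappa>) \<le> C * real (card L) \<and> real (card L) \<le> N \<and>
     N powr (1 - \<kappa>) \<le> C * real (card P) \<and> real (card P) \<le> N \<and>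
     J \<subseteq> {(l, p). l \<in> L \<and> p \<in> P \<and> p \<in> l} \<and>
     N powr (4/3 - \<kappa>) \<le> C * real (card J)"

definition rich_points ::
  "real \<Rightarrow> real \<Rightarrow> real \<Rightarrow> (real^2) set \<Rightarrow> ((real^2) set \<times> (real^2)) set \<Rightarrow> (real^2) set" where
  "rich_points C \<kappa> N P J = {p \<in> P. N powr (1/3 - \<kappa>) \<le> C * real (card {l. (l, p) \<in> J})}"

text \<open>
  Refinements. The relation \<open>|J'| \<sim> |J|\<close> is literal (the upper bounds on \<open>|P'|\<close> and \<open>|J'|\<close>
  follow from inclusion). In contrast, \<open>|P'| \<sim> |P|\<close> with a constant independent of \<open>N\<close> cannot
  be demanded in general: for \<open>\<epsilon> > 0\<close>, \<open>P\<close> may consist of about \<open>N\<close> to the power \<open>1 - \<epsilon>\<close>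
  points that carry all of \<open>J\<close> (a grid, say) together with \<open>N / 2\<close> points that carry none
  of \<open>J\<close>, and a set \<open>P'\<close> all of whose points lie on many lines of \<open>J'\<close> misses the latter.
  So \<open>|P'|\<close> is comparable to \<open>|P|\<close> up to a factor \<open>N\<close> to the power \<open>0+\<close>, and comparable up to
  a constant to the number of points of \<open>P\<close> with at least about \<open>N\<close> to the power \<open>1/3-\<close>
  incidences in \<open>J\<close>. If all points of \<open>P\<close> are of this kind, this is \<open>|P'| \<sim> |P|\<close>.
  The parameters \<open>C, \<kappa>\<close> are those of the configuration, \<open>C', \<kappa>'\<close> those of the refinement.
\<close>

definition refinement ::
  "real \<Rightarrow> real \<Rightarrow> real \<Rightarrow> real \<Rightarrow> real \<Rightarrow> (real^2) set set \<Rightarrow>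
   (real^2) set \<Rightarrow> ((real^2) set \<times> (real^2)) set \<Rightarrow>
   (real^2) set \<Rightarrow> ((real^2) set \<times> (real^2)) set \<Rightarrow> bool" where
  "refinement C \<kappa> C' \<kappa>' N L P J P' J' \<longleftrightarrow>
     P' \<subseteq> P \<and> J' \<subseteq> J \<inter> (L \<times> P') \<and>
     real (card J) \<le> C' * real (card J') \<and>
     real (card P) \<le> C' * N powr \<kappa>' * real (card P') \<and>
     real (card (rich_points C \<kappa> N P J)) \<le> C' * real (card P')"

definition structured :: "real \<Rightarrow> real \<Rightarrow> (real^2) set \<Rightarrow> bool" where
  "structured \<kappa> N S \<longleftrightarrow>
     finite S \<and> N powr (2/3 - \<kappa>) \<le> real (card S) \<and>
     (\<exists>R. finite R \<and> (\<forall>r\<in>R. is_line r) \<and> real (card R) \<le> N powr (1/3 + \<kappa>) \<and>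
          (\<forall>q\<in>S. \<exists>r\<in>R. \<exists>r'\<in>R. r \<noteq> r' \<and> q \<in> r \<and> q \<in> r'))"

definition line_at :: "real^2 \<Rightarrow> real \<Rightarrow> (real^2) set" where
  "line_at p \<theta> = {p + t *\<^sub>R vector [cos \<theta>, sin \<theta>] | t. True}"

text \<open>
  The open double wedge at \<open>p\<close> swept by the lines with angles strictly between \<open>\<theta>\<close> and \<open>\<theta>'\<close>.
  If \<open>0 \<le> \<theta> 1 < \<dots> < \<theta> M < \<pi>\<close>, then of the two double wedges cut out by the lines with angles
  \<open>\<theta> j\<close> and \<open>\<theta> (j + 1)\<close> this is the one that contains none of the other lines.
\<close>

definition sector :: "real^2 \<Rightarrow> real \<Rightarrow> real \<Rightarrow> (real^2) set" where
  "sector p \<theta> \<theta>' = (\<Union>\<phi>\<in>{\<theta><..<\<theta>'}. line_at p \<phi> - {p})"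

end

theory Submission
  imports Defs
begin

text \<open>
  Dualise: a non-vertical line is the pair of its slope and intercept, and a point \<open>(u, w)\<close> is the
  function \<open>m \<mapsto> w - m u\<close>, whose graph passes through a pair iff the point lies on the line. A double
  wedge at \<open>p\<close> between two lines is a segment of the dual line of \<open>p\<close>, and it contains exactly the
  points whose dual lines cross this segment.

  The lines are partitioned into \<open>N\<^bsup>2/3-\<^esup>\<close> pieces of at most \<open>N\<^bsup>1/3+\<^esup>\<close> lines such that almost all
  pairs of consecutive lines through a point lie in a common piece. Within a piece, draw the segments
  between consecutive lines through a common point. By the crossing lemma, few of these segments are
  crossed by fewer than \<open>N\<^bsup>2/3-\<^esup>\<close> others. Every segment crossing a given one is carried by a point
  in the corresponding sector that lies on two lines of the piece, so a segment with many crossings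
  yields a structured set.

  The pieces come from a cutting without any geometry of cells. Sweep the slope \<open>m\<close>, order the points by
  their dual values at \<open>m\<close>, and divide the order into bands of \<open>K\<close> consecutive points. Two points
  change their order at most once, so with a suitable offset of the bands there are at most \<open>N\<^sup>2 / K\<close>
  changes of band. Each band starts a new piece after every \<open>v\<close> lines that visit it.
\<close>

section \<open>Plane straight-line graphs\<close>

text \<open>The exponents dictate the parameters. A piece is meant to be itself the line family of a
  structured set, so it may have only about N^(1/3) lines. If the pieces have O(N) lines in total,
  the segments with at most \<open>t\<close> crossings number O(N * sqrt t) over all pieces. This
  stays below the N^(4/3) incidences as long as \<open>t\<close> is at most about N^(2/3), which is
  the number of points wanted in a sector.

  The obstacle is that a segment exists only if both of its lines lie in one piece, and that a line
  may belong to many pieces. Large bands make a point change its band rarely and make a line visit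
  few bands, but each new piece of a band interrupts all points in that band. The size of a band is
  therefore a compromise, near N^(2/3).

  Vertical lines have no dual point. There is at most one through each point, so they carry at most
  N incidences, which is negligible.\<close>

definition height :: "(real \<times> real) \<times> (real \<times> real) \<Rightarrow> real \<Rightarrow> real" where
  "height e a = snd (fst e) + (a - fst (fst e)) * ((snd (snd e) - snd (fst e)) / (fst (snd e) - fst (fst e)))"

text \<open>Both ranges of abscissas are open, so a shared endpoint alone is no crossing, whereas
  collinear edges that overlap do cross. Hence edges of a plane graph with a common left end, or a
  common right end, differ in slope.\<close>

definition crossing :: "(real \<times> real) \<times> (real \<times> real) \<Rightarrow> (real \<times> real) \<times> (real \<times> real) \<Rightarrow> bool" where
  "crossing e f \<longleftrightarrow> e \<noteq> f \<and> (\<exists>a. fst (fst e) < a \<and> a < fst (snd e) \<and> fst (fst f) < a \<and> a < fst (snd f)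
      \<and> height e a = height f a)"

text \<open>An edge runs from left to right; vertical edges are excluded, as a dual segment joins
  lines of different slopes. The last condition is what makes two crossing edges have four distinct
  ends.\<close>

definition geometric_graph :: "(real \<times> real) set \<Rightarrow> ((real \<times> real) \<times> (real \<times> real)) set \<Rightarrow> bool" where
  "geometric_graph V E \<longleftrightarrow> finite V \<and> E \<subseteq> V \<times> V \<and> (\<forall>e\<in>E. fst (fst e) < fst (snd e)) \<and>
     (\<forall>e\<in>E. \<forall>z\<in>V. fst (fst e) < fst z \<longrightarrow> fst z < fst (snd e) \<longrightarrow> snd z \<noteq> height e (fst z))"

lemma height_left [simp]: "height e (fst (fst e)) = snd (fst e)"
  by (simp add: height_def)

lemma height_start: "fst f = fst e \<Longrightarrow> height f (fst (fst e)) = snd (fst e)"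
  by (metis height_left)

lemma height_right: "fst (fst e) < fst (snd e) \<Longrightarrow> height e (fst (snd e)) = snd (snd e)"
  by (simp add: height_def)

text \<open>Intermediate value theorem for the difference of the heights. The inequalities at
  \<open>a\<close> and \<open>b\<close> are strict, so the zero is interior even if \<open>a\<close>
  or \<open>b\<close> is the abscissa of an endpoint.\<close>

lemma crossing_if_swap:
  assumes "a < b" "fst (fst e) \<le> a" "fst (fst f) \<le> a" "b \<le> fst (snd e)" "b \<le> fst (snd f)"
    and "height f a < height e a" "height e b < height f b"
  shows "crossing e f"
proof -
  have "\<exists>x. a \<le> x \<and> x \<le> b \<and> height f x - height e x = 0"
    by (rule IVT') (use assms in \<open>auto simp: height_def intro!: continuous_intros\<close>)
  then obtain x where x: "a \<le> x" "x \<le> b" "height f x = height e x" by auto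
  moreover from x assms have "a \<noteq> x" "x \<noteq> b" by auto
  ultimately show ?thesis unfolding crossing_def using assms by (intro conjI exI[of _ x]) auto
qed

section \<open>Charging the edges of a plane graph to its vertices\<close>

context
  fixes V :: "(real \<times> real) set" and E :: "((real \<times> real) \<times> (real \<times> real)) set"
  assumes graph: "geometric_graph V E" and plane: "\<And>e f. e \<in> E \<Longrightarrow> f \<in> E \<Longrightarrow> \<not> crossing e f"
begin

definition higher :: "(real \<times> real) \<times> (real \<times> real) \<Rightarrow> (real \<times> real) \<times> (real \<times> real) \<Rightarrow> bool" where
  "higher e f \<longleftrightarrow> f \<in> E \<and> fst f = fst e \<and> (\<forall>a > fst (fst e). height e a < height f a)"

definition wedge :: "(real \<times> real) \<times> (real \<times> real) \<Rightarrow> (real \<times> real) \<times> (real \<times> real) \<Rightarrow> (real \<times> real) set" where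
  "wedge e f = {z \<in> V. fst (fst e) < fst z \<and> fst z \<le> fst (snd e) \<and> fst z \<le> fst (snd f) \<and>
      height e (fst z) \<le> snd z \<and> snd z \<le> height f (fst z)}"

definition next_edge :: "(real \<times> real) \<times> (real \<times> real) \<Rightarrow> (real \<times> real) \<times> (real \<times> real) \<Rightarrow> bool" where
  "next_edge e f \<longleftrightarrow> higher e f \<and> (\<forall>g. higher e g \<longrightarrow> g = f \<or> higher f g)"

text \<open>This takes the place of Euler's formula. An edge that is not the highest at its left end
  is charged to a leftmost vertex of the wedge between it and the next edge. A vertex is then
  charged at most once from each of three positions: on the lower side, on the upper side, strictly
  inside.\<close>

definition apex :: "(real \<times> real) \<times> (real \<times> real) \<Rightarrow> (real \<times> real) \<times> (real \<times> real) \<Rightarrow> (real \<times> real) \<Rightarrow> bool" where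
  "apex e f y \<longleftrightarrow> e \<in> E \<and> next_edge e f \<and> y \<in> wedge e f \<and> (\<forall>z\<in>wedge e f. fst y \<le> fst z)"

lemma finite_V: "finite V" and E_sub: "E \<subseteq> V \<times> V" and edge_lr: "e \<in> E \<Longrightarrow> fst (fst e) < fst (snd e)"
  and interior_free: "e \<in> E \<Longrightarrow> z \<in> V \<Longrightarrow> fst (fst e) < fst z \<Longrightarrow> fst z < fst (snd e) \<Longrightarrow> snd z \<noteq> height e (fst z)"
  using graph unfolding geometric_graph_def by auto

lemma finite_E: "finite E"
  using finite_V E_sub finite_subset by blast

lemma height_same_left:
  assumes "fst f = fst e"
  shows "height f a - height e a = (a - fst (fst e)) *
    ((snd (snd f) - snd (fst f)) / (fst (snd f) - fst (fst f)) - (snd (snd e) - snd (fst e)) / (fst (snd e) - fst (fst e)))"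
  using assms by (simp add: height_def algebra_simps)

text \<open>Equal slopes would make the edges overlap next to their common left end, which counts as
  a crossing. Otherwise the sign of the slope difference \<open>d\<close> decides at all abscissas
  to the right at once.\<close>

lemma higher_total:
  assumes "e \<in> E" "f \<in> E" "fst f = fst e" "e \<noteq> f"
  shows "higher e f \<or> higher f e"
proof -
  define d where "d = (snd (snd f) - snd (fst f)) / (fst (snd f) - fst (fst f)) - (snd (snd e) - snd (fst e)) / (fst (snd e) - fst (fst e))"
  have h: "height f a - height e a = (a - fst (fst e)) * d" for a
    using height_same_left[OF assms(3)] d_def by simp
  have "d \<noteq> 0"
  proof
    assume "d = 0"
    then have eq: "height f a = height e a" for a using h[of a] by simp
    define a where "a = (fst (fst e) + min (fst (snd e)) (fst (snd f))) / 2"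
    have "fst (fst e) < a" "a < fst (snd e)" "a < fst (snd f)"
      using edge_lr[OF assms(1)] edge_lr[OF assms(2)] assms(3) by (auto simp: a_def min_def field_simps)
    then have "crossing e f" unfolding crossing_def using assms eq by auto
    then show False using plane assms by blast
  qed
  then consider "d > 0" | "d < 0" by linarith
  then show ?thesis
  proof cases
    case 1
    then have "\<And>a. a > fst (fst e) \<Longrightarrow> height f a - height e a > 0" unfolding h by simp
    then show ?thesis using assms by (auto simp: higher_def)
  next
    case 2
    then have "\<And>a. a > fst (fst e) \<Longrightarrow> height f a - height e a < 0" unfolding h
      by (simp add: mult_pos_neg)
    then show ?thesis using assms by (auto simp: higher_def)
  qed
qed

lemma higher_asym: "higher e f \<Longrightarrow> \<not> higher f e"
proof -
  assume *: "higher e f"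
  then have "height e (fst (fst e) + 1) < height f (fst (fst e) + 1)" and "fst f = fst e" by (auto simp: higher_def)
  then show ?thesis unfolding higher_def by (metis less_add_one less_asym)
qed

lemma higher_trans: "higher e f \<Longrightarrow> higher f g \<Longrightarrow> higher e g"
  unfolding higher_def by force

lemma next_edge_exists:
  assumes "e \<in> E" "higher e f0"
  shows "\<exists>f. next_edge e f"
proof -
  define H where "H = {f. higher e f}"
  have "finite H" using finite_E by (auto simp: H_def higher_def intro: finite_subset)
  \<comment> \<open>\<open>m f\<close> counts the edges strictly between \<open>e\<close> and
    \<open>f\<close>; an edge minimising it is next to \<open>e\<close>.\<close>
  define m where "m f = card {g \<in> H. higher g f}" for f
  obtain f where f: "f \<in> H" "\<And>g. g \<in> H \<Longrightarrow> m f \<le> m g"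
    using ex_has_least_nat[of "\<lambda>f. f \<in> H" f0 m] assms by (auto simp: H_def)
  have "g = f \<or> higher f g" if "higher e g" for g
  proof (rule ccontr)
    assume n: "\<not> (g = f \<or> higher f g)"
    have "g \<in> H" using that H_def by simp
    then have gf: "higher g f" using n higher_total[of f g] f(1) by (auto simp: H_def higher_def)
    have "{k \<in> H. higher k g} \<subset> {k \<in> H. higher k f}"
      using gf higher_trans higher_asym \<open>g \<in> H\<close> by blast
    then have "m g < m f" unfolding m_def using \<open>finite H\<close> by (intro psubset_card_mono) auto
    then show False using f(2)[OF \<open>g \<in> H\<close>] by simp
  qed
  moreover have "higher e f" using f(1) by (simp add: H_def)
  ultimately show ?thesis unfolding next_edge_def by blast
qed

text \<open>The wedge is never empty: it contains the right end of whichever edge stops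
  first.\<close>

lemma apex_exists:
  assumes "e \<in> E" "next_edge e f"
  shows "\<exists>y. apex e f y"
proof -
  have f: "f \<in> E" "fst f = fst e" "\<And>a. a > fst (fst e) \<Longrightarrow> height e a < height f a"
    using assms by (auto simp: next_edge_def higher_def)
  have "wedge e f \<noteq> {}"
  proof (cases "fst (snd e) \<le> fst (snd f)")
    case True
    then have "snd e \<in> wedge e f" using E_sub assms edge_lr[OF assms(1)] f height_right[of e]
      by (auto simp: wedge_def less_imp_le) (metis less_imp_le)
    then show ?thesis by auto
  next
    case False
    then have "snd f \<in> wedge e f" using E_sub assms edge_lr[OF f(1)] f height_right[of f]
      by (auto simp: wedge_def less_imp_le) (metis less_imp_le)
    then show ?thesis by auto
  qed
  moreover have "finite (wedge e f)" using finite_V by (auto simp: wedge_def)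
  ultimately have "Min (fst ` wedge e f) \<in> fst ` wedge e f" "\<And>z. z \<in> wedge e f \<Longrightarrow> Min (fst ` wedge e f) \<le> fst z"
    by auto
  then obtain y where "y \<in> wedge e f" "\<And>z. z \<in> wedge e f \<Longrightarrow> fst y \<le> fst z" by (metis imageE)
  then show ?thesis using assms unfolding apex_def by blast
qed

lemma apex_D:
  assumes "apex e f y"
  shows "e \<in> E" "f \<in> E" "fst f = fst e" "\<And>a. a > fst (fst e) \<Longrightarrow> height e a < height f a"
    "fst (fst e) < fst y" "fst y \<le> fst (snd e)" "fst y \<le> fst (snd f)" "height e (fst y) \<le> snd y"
    "snd y \<le> height f (fst y)" "y \<in> V"
    "\<And>z. z \<in> V \<Longrightarrow> fst (fst e) < fst z \<Longrightarrow> fst z < fst y \<Longrightarrow> height e (fst z) \<le> snd z \<Longrightarrow> snd z \<le> height f (fst z) \<Longrightarrow> False"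
proof -
  have *: "e \<in> E" "higher e f" "y \<in> wedge e f" "\<And>z. z \<in> wedge e f \<Longrightarrow> fst y \<le> fst z"
    using assms unfolding apex_def next_edge_def by blast+
  from *(1-3) show "e \<in> E" "f \<in> E" "fst f = fst e" "\<And>a. a > fst (fst e) \<Longrightarrow> height e a < height f a"
    "fst (fst e) < fst y" "fst y \<le> fst (snd e)" "fst y \<le> fst (snd f)" "height e (fst y) \<le> snd y"
    "snd y \<le> height f (fst y)" "y \<in> V"
    by (simp_all add: higher_def wedge_def)
  show False if "z \<in> V" "fst (fst e) < fst z" "fst z < fst y" "height e (fst z) \<le> snd z" "snd z \<le> height f (fst z)" for z
    using *(4)[of z] *(3) that by (auto simp: wedge_def)
qed

text \<open>An edge that starts outside the wedge cannot enter it, and none starts inside before the apex;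
  so the wedge is the one directly to the left of its apex.\<close>

lemma inner_apex_inj:
  assumes A: "apex e f y" "apex e' f' y"
    and i: "height e (fst y) < snd y" "snd y < height f (fst y)" "height e' (fst y) < snd y" "snd y < height f' (fst y)"
  shows "e = e'"
proof -
  have *: "fst e = fst e'" if A: "apex e f y" "apex e' f' y" and le: "fst (fst e) \<le> fst (fst e')"
    and i: "height e (fst y) < snd y" "snd y < height f (fst y)" "height e' (fst y) < snd y" "snd y < height f' (fst y)"
    for e f e' f'
  proof -
    note a = apex_D[OF A(1)] and b = apex_D[OF A(2)]
    let ?x = "fst (fst e')"
    have 1: "\<not> snd (fst e') > height f ?x"
    proof
      assume "snd (fst e') > height f ?x"
      then have "crossing e' f" using a(3,7) b(5,6) le i
        by (intro crossing_if_swap[of "?x" "fst y"]) simp_all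
      then show False using plane a(2) b(1) by blast
    qed
    have 2: "\<not> snd (fst e') < height e ?x"
    proof
      assume "snd (fst e') < height e ?x"
      then have "crossing e f'" using a(6) b(3,5,7) le i height_start[OF b(3)]
        by (intro crossing_if_swap[of "?x" "fst y"]) simp_all
      then show False using plane a(1) b(2) by blast
    qed
    have "fst e' \<in> V" using E_sub b(1) by auto
    then have "\<not> fst (fst e) < ?x" using a(11)[of "fst e'"] b(5) 1 2 not_less by blast
    then have eq: "fst (fst e) = ?x" using le by simp
    then have "height f ?x = snd (fst e)" "height e ?x = snd (fst e)" using height_start[OF a(3)] height_left[of e] by simp_all
    then have "snd (fst e) = snd (fst e')" using 1 2 by linarith
    then show ?thesis using eq by (simp add: prod_eq_iff)
  qed
  have fe: "fst e = fst e'"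
  proof (cases "fst (fst e) \<le> fst (fst e')")
    case True
    show ?thesis by (rule *[OF A True i])
  next
    case False
    then have "fst e' = fst e" using A i by (intro *[of e' f' e f]) auto
    then show ?thesis by simp
  qed
  note a = apex_D[OF A(1)] and b = apex_D[OF A(2)]
  show ?thesis
  proof (rule ccontr)
    assume "e \<noteq> e'"
    then have "higher e e' \<or> higher e' e" using higher_total[of e e'] a(1) b(1) fe by simp
    then show False
    proof
      assume "higher e e'"
      then have "e' = f \<or> higher f e'" using A(1) unfolding apex_def next_edge_def by blast
      then have "height f (fst y) \<le> height e' (fst y)" using a(3,5) unfolding higher_def by (metis less_imp_le order_refl)
      then show False using i by simp
    next
      assume "higher e' e"
      then have "e = f' \<or> higher f' e" using A(2) unfolding apex_def next_edge_def by blast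
      then have "height f' (fst y) \<le> height e (fst y)" using b(3,5) unfolding higher_def by (metis less_imp_le order_refl)
      then show False using i by simp
    qed
  qed
qed

text \<open>The counterpart of \<open>higher_total\<close> at a common right end.\<close>

lemma same_end_height:
  assumes "e \<in> E" "e' \<in> E" "snd e = snd e'" "e \<noteq> e'"
  shows "(\<forall>a < fst (snd e). height e a < height e' a) \<or> (\<forall>a < fst (snd e). height e' a < height e a)"
proof -
  define s where "s e = (snd (snd e) - snd (fst e)) / (fst (snd e) - fst (fst e))" for e :: "(real \<times> real) \<times> (real \<times> real)"
  have h: "height e a = snd (snd e) - (fst (snd e) - a) * s e" if "e \<in> E" for e a
    using edge_lr[OF that] by (simp add: height_def s_def field_simps)
  have "s e \<noteq> s e'"
  proof
    assume "s e = s e'"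
    then have eq: "height e a = height e' a" for a using h assms by simp
    define a where "a = (fst (snd e) + max (fst (fst e)) (fst (fst e'))) / 2"
    have "a < fst (snd e)" "a > fst (fst e)" "a > fst (fst e')"
      using edge_lr[OF assms(1)] edge_lr[OF assms(2)] assms(3) by (auto simp: a_def max_def field_simps)
    then have "crossing e e'" unfolding crossing_def using assms eq by auto
    then show False using plane assms by blast
  qed
  then consider "s e < s e'" | "s e' < s e" by linarith
  then show ?thesis
  proof cases
    case 1
    then have "height e' a < height e a" if "a < fst (snd e)" for a
      using h[OF assms(1), of a] h[OF assms(2), of a] that assms(3) by simp
    then show ?thesis by blast
  next
    case 2
    then have "height e a < height e' a" if "a < fst (snd e)" for a
      using h[OF assms(1), of a] h[OF assms(2), of a] that assms(3) by simp
    then show ?thesis by blast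
  qed
qed

text \<open>No vertex is interior to an edge, so an apex on the lower side is the right end of
  \<open>e\<close>. If two such edges end at \<open>y\<close>, the upper one reaches
  \<open>y\<close> from inside the wedge of the lower one: either it starts in that wedge, to the
  left of the apex, or it has crossed the upper side on its way in.\<close>

lemma lower_apex_inj:
  assumes A: "apex e f y" "apex e' f' y" and i: "height e (fst y) = snd y" "height e' (fst y) = snd y"
  shows "e = e'"
proof -
  have end_eq: "snd e = y" if "apex e f y" "height e (fst y) = snd y" for e f
  proof -
    note a = apex_D[OF that(1)]
    have "\<not> fst y < fst (snd e)" using interior_free[of e y] a(1,5,10) that by auto
    then have "fst y = fst (snd e)" using a(6) by simp
    then show ?thesis using that height_right[of e] edge_lr[OF a(1)] by (auto simp: prod_eq_iff)
  qed
  have *: False if A: "apex e f y" and E: "e' \<in> E" "snd e' = y" "snd e = y" and h: "\<forall>a < fst y. height e a < height e' a" for e f e'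
  proof -
    note a = apex_D[OF A]
    have hy: "height e' (fst y) = snd y" "height e (fst y) = snd y" using height_right[of e] height_right[of e'] edge_lr[OF E(1)] edge_lr[OF a(1)] E by simp_all
    have fy: "snd y < height f (fst y)" using a(4,5) hy by metis
    have x'y: "fst (fst e') < fst y" using edge_lr[OF E(1)] E by auto
    have nc: "\<not> (height f x < height e' x)" if "fst (fst e) \<le> x" "fst (fst e') \<le> x" "x < fst y" for x
    proof
      assume "height f x < height e' x"
      then have "crossing e' f" using a(3,7) E(2) that hy fy by (intro crossing_if_swap[of x "fst y"]) simp_all
      then show False using plane a(2) E(1) by blast
    qed
    show False
    proof (cases "fst (fst e) < fst (fst e')")
      case True
      have "height e (fst (fst e')) < snd (fst e')" using h x'y height_left[of e'] by metis
      moreover have "snd (fst e') \<le> height f (fst (fst e'))" using nc[of "fst (fst e')"] True x'y by auto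
      moreover have "fst e' \<in> V" using E E_sub by auto
      ultimately show False using a(11)[of "fst e'"] True x'y less_imp_le by blast
    next
      case False
      have "height f (fst (fst e)) = snd (fst e)" by (rule height_start[OF a(3)])
      moreover have "snd (fst e) < height e' (fst (fst e))" using h a(5) height_left[of e] by (metis height_left)
      ultimately show False using nc[of "fst (fst e)"] False a(5) by simp
    qed
  qed
  show ?thesis
  proof (rule ccontr)
    assume "e \<noteq> e'"
    moreover note E = end_eq[OF A(1) i(1)] end_eq[OF A(2) i(2)] apex_D(1)[OF A(1)] apex_D(1)[OF A(2)]
    ultimately show False using same_end_height[of e e'] *[OF A(1), of e'] *[OF A(2), of e] by simp blast
  qed
qed

text \<open>The mirrored argument for the upper sides yields \<open>f = f'\<close>. Two edges with
  the same next edge then coincide, since the lower one would have the other as an obstacle in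
  between.\<close>

lemma upper_apex_inj:
  assumes A: "apex e f y" "apex e' f' y" and i: "height f (fst y) = snd y" "height f' (fst y) = snd y"
  shows "e = e'"
proof -
  have end_eq: "snd f = y" if "apex e f y" "height f (fst y) = snd y" for e f
  proof -
    note a = apex_D[OF that(1)]
    have "\<not> fst y < fst (snd f)" using interior_free[of f y] a(2,3,5,10) that by auto
    then have "fst y = fst (snd f)" using a(7) by simp
    then show ?thesis using that height_right[of f] edge_lr[OF a(2)] by (auto simp: prod_eq_iff)
  qed
  have *: False if A: "apex e f y" and E: "f' \<in> E" "snd f' = y" "snd f = y" and h: "\<forall>a < fst y. height f' a < height f a" for e f f'
  proof -
    note a = apex_D[OF A]
    have hy: "height f' (fst y) = snd y" "height f (fst y) = snd y" using height_right[of f] height_right[of f'] edge_lr[OF E(1)] edge_lr[OF a(2)] E by simp_all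
    have ey: "height e (fst y) < snd y" using a(4,5) hy by metis
    have x'y: "fst (fst f') < fst y" using edge_lr[OF E(1)] E by auto
    have nc: "\<not> (height f' x < height e x)" if "fst (fst e) \<le> x" "fst (fst f') \<le> x" "x < fst y" for x
    proof
      assume "height f' x < height e x"
      then have "crossing e f'" using a(6) E(2) that hy ey by (intro crossing_if_swap[of x "fst y"]) simp_all
      then show False using plane a(1) E(1) by blast
    qed
    show False
    proof (cases "fst (fst e) < fst (fst f')")
      case True
      have "snd (fst f') < height f (fst (fst f'))" using h x'y height_left[of f'] by metis
      moreover have "height e (fst (fst f')) \<le> snd (fst f')" using nc[of "fst (fst f')"] True x'y by auto
      moreover have "fst f' \<in> V" using E E_sub by auto
      ultimately show False using a(11)[of "fst f'"] True x'y less_imp_le by blast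
    next
      case False
      have "height f (fst (fst e)) = snd (fst e)" by (rule height_start[OF a(3)])
      then have "height f' (fst (fst e)) < snd (fst e)" using h a(5) by metis
      then show False using nc[of "fst (fst e)"] False a(5) by simp
    qed
  qed
  have ff: "f = f'"
  proof (rule ccontr)
    assume "f \<noteq> f'"
    moreover note E = end_eq[OF A(1) i(1)] end_eq[OF A(2) i(2)] apex_D(2)[OF A(1)] apex_D(2)[OF A(2)]
    ultimately show False using same_end_height[of f f'] *[OF A(1), of f'] *[OF A(2), of f] by simp blast
  qed
  show ?thesis
  proof (rule ccontr)
    assume "e \<noteq> e'"
    then have "higher e e' \<or> higher e' e" using higher_total[of e e'] apex_D(1,3)[OF A(1)] apex_D(1,3)[OF A(2)] ff by simp
    moreover have n: "next_edge e f" "next_edge e' f" using A ff unfolding apex_def by simp_all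
    ultimately have "e' = f \<or> higher f e' \<or> e = f \<or> higher f e" unfolding next_edge_def by blast
    moreover have "higher e f" "higher e' f" using n unfolding next_edge_def by simp_all
    ultimately show False using higher_asym by blast
  qed
qed

text \<open>A relation is used instead of a function because several leftmost vertices of a wedge
  may share their abscissa, so an edge can have more than one apex.\<close>

lemma card_le_if_inj_rel:
  assumes "finite V" "\<And>x. x \<in> A \<Longrightarrow> \<exists>y\<in>V. r x y" "\<And>x x' y. r x y \<Longrightarrow> r x' y \<Longrightarrow> x = x'"
  shows "card A \<le> card V"
proof -
  obtain g where g: "\<And>x. x \<in> A \<Longrightarrow> g x \<in> V \<and> r x (g x)" using assms(2) by metis
  have "inj_on g A" using g assms(3) by (metis inj_onI)
  then show ?thesis using g assms(1) by (intro card_inj_on_le[of g]) auto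
qed

text \<open>The factor 4 counts the classes: the highest edges, charged to their left ends, and the
  edges with an apex in each of the three positions. The classes may overlap; only that they cover
  \<open>E\<close> matters.\<close>

lemma card_plane_graph: "card E \<le> 4 * card V"
proof -
  define top where "top = {e \<in> E. \<nexists>f. higher e f}"
  define low where "low e y \<longleftrightarrow> (\<exists>f. apex e f y \<and> height e (fst y) = snd y)" for e y
  define up where "up e y \<longleftrightarrow> (\<exists>f. apex e f y \<and> height f (fst y) = snd y)" for e y
  define mid where "mid e y \<longleftrightarrow> (\<exists>f. apex e f y \<and> height e (fst y) < snd y \<and> snd y < height f (fst y))" for e y
  have c1: "card top \<le> card V"
  proof (rule card_inj_on_le)
    show "inj_on fst top"
    proof (rule inj_onI)
      fix e f assume "e \<in> top" "f \<in> top" "fst e = fst f"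
      then show "e = f" using higher_total[of e f] unfolding top_def mem_Collect_eq by metis
    qed
    show "fst ` top \<subseteq> V" using E_sub by (auto simp: top_def)
  qed (rule finite_V)
  have c2: "card {e. \<exists>y\<in>V. low e y} \<le> card V"
    by (rule card_le_if_inj_rel[OF finite_V, of _ low]) (blast, metis low_def lower_apex_inj)
  have c3: "card {e. \<exists>y\<in>V. up e y} \<le> card V"
    by (rule card_le_if_inj_rel[OF finite_V, of _ up]) (blast, metis up_def upper_apex_inj)
  have c4: "card {e. \<exists>y\<in>V. mid e y} \<le> card V"
    by (rule card_le_if_inj_rel[OF finite_V, of _ mid]) (blast, metis mid_def inner_apex_inj)
  note c = c1 c2 c3 c4
  have cover: "E \<subseteq> top \<union> {e. \<exists>y\<in>V. low e y} \<union> {e. \<exists>y\<in>V. up e y} \<union> {e. \<exists>y\<in>V. mid e y}"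
  proof
    fix e assume e: "e \<in> E"
    show "e \<in> top \<union> {e. \<exists>y\<in>V. low e y} \<union> {e. \<exists>y\<in>V. up e y} \<union> {e. \<exists>y\<in>V. mid e y}"
    proof (cases "e \<in> top")
      case False
      then obtain f where "next_edge e f" using next_edge_exists e unfolding top_def by blast
      then obtain y where y: "apex e f y" using apex_exists e by blast
      note a = apex_D(8-10)[OF y]
      then consider "height e (fst y) = snd y" | "height f (fst y) = snd y" | "height e (fst y) < snd y \<and> snd y < height f (fst y)"
        by linarith
      then have "low e y \<or> up e y \<or> mid e y"
        by cases (use y in \<open>unfold low_def up_def mid_def, blast+\<close>)
      then show ?thesis using a(3) by blast
    qed blast
  qed
  have "finite (top \<union> {e. \<exists>y\<in>V. low e y} \<union> {e. \<exists>y\<in>V. up e y} \<union> {e. \<exists>y\<in>V. mid e y})"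
    using finite_E by (rule rev_finite_subset) (auto simp: top_def low_def up_def mid_def dest: apex_D(1))
  then have "card E \<le> card (top \<union> {e. \<exists>y\<in>V. low e y} \<union> {e. \<exists>y\<in>V. up e y} \<union> {e. \<exists>y\<in>V. mid e y})"
    using cover by (rule card_mono)
  also have "\<dots> \<le> card top + card {e. \<exists>y\<in>V. low e y} + card {e. \<exists>y\<in>V. up e y} + card {e. \<exists>y\<in>V. mid e y}"
    by (meson card_Un_le order_trans add_le_mono order_refl)
  finally show ?thesis using c by linarith
qed

end

section \<open>The crossing lemma\<close>

definition crossing_pairs where
  "crossing_pairs E = {(e, f). e \<in> E \<and> f \<in> E \<and> crossing e f}"

lemma geometric_graph_subset:
  "geometric_graph V E \<Longrightarrow> U \<subseteq> V \<Longrightarrow> F \<subseteq> E \<Longrightarrow> F \<subseteq> U \<times> U \<Longrightarrow> geometric_graph U F"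
  unfolding geometric_graph_def by (meson finite_subset subsetD)

lemma geometric_graph_finite: "geometric_graph V E \<Longrightarrow> finite E"
  unfolding geometric_graph_def by (meson finite_SigmaI finite_subset)

text \<open>Deleting every edge that takes part in a crossing leaves a plane graph, and each deleted
  edge is the first component of some crossing pair.\<close>

lemma card_edges_le_crossings:
  assumes g: "geometric_graph V E"
  shows "card E \<le> 4 * card V + card (crossing_pairs E)"
proof -
  let ?X = "crossing_pairs E"
  have fE: "finite E" using g by (rule geometric_graph_finite)
  then have fX: "finite ?X" by (rule_tac finite_subset[of _ "E \<times> E"]) (auto simp: crossing_pairs_def)
  have E_V: "E \<subseteq> V \<times> V" using g by (simp add: geometric_graph_def)
  have "card (E - fst ` ?X) \<le> 4 * card V"
  proof (rule card_plane_graph)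
    show "geometric_graph V (E - fst ` ?X)" using E_V by (intro geometric_graph_subset[OF g]) auto
    show "\<not> crossing e f" if "e \<in> E - fst ` ?X" "f \<in> E - fst ` ?X" for e f
    proof
      assume "crossing e f"
      then have "(e, f) \<in> ?X" using that by (simp add: crossing_pairs_def)
      then have "e \<in> fst ` ?X" by force
      then show False using that by simp
    qed
  qed
  moreover have "card E \<le> card (E - fst ` ?X) + card (fst ` ?X)"
    using diff_card_le_card_Diff[of "fst ` ?X" E] fX by simp
  moreover have "card (fst ` ?X) \<le> card ?X" using fX by (rule card_image_le)
  ultimately show ?thesis by linarith
qed

lemma height_segment_cong:
  assumes "fst (fst e) < fst (snd e)" "fst (fst f) < fst (snd f)" "a \<noteq> b" 
    "height e a = height f a" "height e b = height f b"
  shows "height e c = height f c"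
proof -
  define s where "s e = (snd (snd e) - snd (fst e)) / (fst (snd e) - fst (fst e))" for e :: "(real \<times> real) \<times> (real \<times> real)"
  have h: "height e x = height e a + (x - a) * s e" for e x
    unfolding height_def s_def[symmetric] by (simp add: algebra_simps)
  have "(b - a) * s e = (b - a) * s f" using h[of e b] h[of f b] assms by simp
  then have "s e = s f" using assms by simp
  then show ?thesis using h[of e c] h[of f c] assms by simp
qed

text \<open>A common end together with an interior crossing makes the edges collinear, and then the
  shorter one would end inside the longer one. The point of this is that a crossing involves four
  vertices and so survives random sampling with probability \<open>p ^ 4\<close>.\<close>

lemma crossing_disjoint_ends:
  assumes g: "geometric_graph V E" and e: "e \<in> E" "f \<in> E" "crossing e f"
  shows "fst e \<noteq> fst f" "snd e \<noteq> snd f" "fst e \<noteq> snd f" "snd e \<noteq> fst f"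
proof -
  have lr: "fst (fst e) < fst (snd e)" "fst (fst f) < fst (snd f)"
    and fr: "\<And>g z. g \<in> E \<Longrightarrow> z \<in> V \<Longrightarrow> fst (fst g) < fst z \<Longrightarrow> fst z < fst (snd g) \<Longrightarrow> snd z \<noteq> height g (fst z)"
    and V: "snd e \<in> V" "snd f \<in> V" "fst e \<in> V" "fst f \<in> V"
    using g e by (auto simp: geometric_graph_def)
  obtain a where a: "fst (fst e) < a" "a < fst (snd e)" "fst (fst f) < a" "a < fst (snd f)" "height e a = height f a"
    using e unfolding crossing_def by blast
  show 1: "fst e \<noteq> fst f"
  proof
    assume eq: "fst e = fst f"
    have h: "height e x = height f x" for x
      using height_segment_cong[OF lr, of a "fst (fst e)"] a eq height_start[of f e] height_left[of e] by simp
    have "snd e = snd f"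
    proof -
      have "\<not> fst (snd e) < fst (snd f)" using fr[OF e(2) V(1)] h[of "fst (snd e)"] height_right[OF lr(1)] lr(1) eq by metis
      moreover have "\<not> fst (snd f) < fst (snd e)" using fr[OF e(1) V(2)] h[of "fst (snd f)"] height_right[OF lr(2)] lr(2) eq by metis
      ultimately have "fst (snd e) = fst (snd f)" by simp
      then show ?thesis using height_right[OF lr(1)] height_right[OF lr(2)] h by (metis prod_eqI)
    qed
    then have "e = f" using eq by (rule prod_eqI[rotated])
    then show False using e(3) by (simp add: crossing_def)
  qed
  show "snd e \<noteq> snd f"
  proof
    assume eq: "snd e = snd f"
    have h: "height e x = height f x" for x
      using height_segment_cong[OF lr, of a "fst (snd e)"] a eq height_right[OF lr(1)] height_right[OF lr(2)] by simp
    have "\<not> fst (fst e) < fst (fst f)" using fr[OF e(1) V(4)] h[of "fst (fst f)"] lr(2) eq height_left[of f] by metis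
    moreover have "\<not> fst (fst f) < fst (fst e)" using fr[OF e(2) V(3)] h[of "fst (fst e)"] lr(1) eq height_left[of e] by metis
    ultimately have "fst (fst e) = fst (fst f)" by simp
    then have "fst e = fst f" using h by (metis height_left prod_eqI)
    then show False using 1 by simp
  qed
  show "fst e \<noteq> snd f" "snd e \<noteq> fst f" using a by auto
qed

text \<open>The probability that a random subset, taking each element of \<open>V\<close>
  independently with probability \<open>p\<close>, contains \<open>A\<close>. In the expanded
  product, omitting an element of \<open>A\<close> gets weight 0, which removes all other
  subsets.\<close>

lemma sum_subset_weights:
  fixes p :: real
  assumes "finite V" "A \<subseteq> V"
  shows "(\<Sum>U | U \<subseteq> V \<and> A \<subseteq> U. p ^ card U * (1 - p) ^ card (V - U)) = p ^ card A"
proof -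
  let ?g = "\<lambda>x. if x \<in> A then 0 else 1 - p"
  have "p ^ card A = (\<Prod>x\<in>V. if x \<in> A then p else 1)"
    using assms by (simp add: prod.If_cases Int_absorb1)
  also have "\<dots> = (\<Prod>x\<in>V. p + ?g x)" by (rule prod.cong) auto
  also have "\<dots> = (\<Sum>U\<in>Pow V. (\<Prod>x\<in>U. p) * (\<Prod>x\<in>V - U. ?g x))" using assms by (simp add: prod_add)
  also have "\<dots> = (\<Sum>U | U \<subseteq> V \<and> A \<subseteq> U. (\<Prod>x\<in>U. p) * (\<Prod>x\<in>V - U. ?g x))"
  proof (rule sum.mono_neutral_right)
    show "\<forall>U\<in>Pow V - {U. U \<subseteq> V \<and> A \<subseteq> U}. (\<Prod>x\<in>U. p) * (\<Prod>x\<in>V - U. ?g x) = 0"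
    proof
      fix U assume "U \<in> Pow V - {U. U \<subseteq> V \<and> A \<subseteq> U}"
      then obtain x where "x \<in> A" "x \<in> V - U" using assms by blast
      then have "(\<Prod>x\<in>V - U. ?g x) = 0" using assms by (intro prod_zero) auto
      then show "(\<Prod>x\<in>U. p) * (\<Prod>x\<in>V - U. ?g x) = 0" by simp
    qed
  qed (use assms in auto)
  also have "\<dots> = (\<Sum>U | U \<subseteq> V \<and> A \<subseteq> U. p ^ card U * (1 - p) ^ card (V - U))"
  proof (rule sum.cong)
    fix U assume U: "U \<in> {U. U \<subseteq> V \<and> A \<subseteq> U}"
    then have "(\<Prod>x\<in>V - U. ?g x) = (\<Prod>x\<in>V - U. 1 - p)" by (intro prod.cong) auto
    then show "(\<Prod>x\<in>U. p) * (\<Prod>x\<in>V - U. ?g x) = p ^ card U * (1 - p) ^ card (V - U)" by simp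
  qed simp
  finally show ?thesis by simp
qed

text \<open>Linearity of expectation. The relevant \<open>k\<close> are 1 for vertices, 2 for edges
  and 4 for crossings.\<close>

lemma sum_weights_card:
  fixes p :: real
  assumes "finite V" "finite S" "\<And>x. x \<in> S \<Longrightarrow> A x \<subseteq> V \<and> card (A x) = k"
  shows "(\<Sum>U\<in>Pow V. p ^ card U * (1 - p) ^ card (V - U) * card {x \<in> S. A x \<subseteq> U}) = p ^ k * card S"
proof -
  let ?w = "\<lambda>U. p ^ card U * (1 - p) ^ card (V - U)"
  have "(\<Sum>U\<in>Pow V. ?w U * card {x \<in> S. A x \<subseteq> U}) = (\<Sum>U\<in>Pow V. \<Sum>x\<in>{x \<in> S. A x \<subseteq> U}. ?w U)"
    by (simp add: mult.commute)
  also have "\<dots> = (\<Sum>x\<in>S. \<Sum>U | U \<in> Pow V \<and> A x \<subseteq> U. ?w U)"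
    using assms by (intro sum.swap_restrict) auto
  also have "\<dots> = (\<Sum>x\<in>S. p ^ k)"
  proof (rule sum.cong)
    fix x assume x: "x \<in> S"
    then show "(\<Sum>U | U \<in> Pow V \<and> A x \<subseteq> U. ?w U) = p ^ k"
      using sum_subset_weights[OF assms(1), of "A x" p] assms(3)[OF x] by simp
  qed simp
  also have "\<dots> = p ^ k * card S" by simp
  finally show ?thesis .
qed

text \<open>The bound \<open>card_edges_le_crossings\<close> holds for the subgraph induced by every
  vertex set; here it is averaged over random vertex sets.\<close>

lemma crossing_inequality:
  fixes p :: real
  assumes g: "geometric_graph V E" and p: "0 \<le> p" "p \<le> 1"
  shows "p\<^sup>2 * card E \<le> 4 * p * card V + p ^ 4 * card (crossing_pairs E)"
proof -
  have fV: "finite V" and EV: "E \<subseteq> V \<times> V" and lr: "\<forall>e\<in>E. fst (fst e) < fst (snd e)"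
    using g by (auto simp: geometric_graph_def)
  have fE: "finite E" using g by (rule geometric_graph_finite)
  let ?X = "crossing_pairs E"
  have fX: "finite ?X" using fE by (rule_tac finite_subset[of _ "E \<times> E"]) (auto simp: crossing_pairs_def)
  let ?w = "\<lambda>U. p ^ card U * (1 - p) ^ card (V - U)"
  let ?A = "\<lambda>e. {fst e, snd e}" and ?B = "\<lambda>(e, f). {fst e, snd e, fst f, snd f}"
  have sub: "real (card {e \<in> E. ?A e \<subseteq> U}) \<le> 4 * real (card {x \<in> V. {x} \<subseteq> U}) + real (card {x \<in> ?X. ?B x \<subseteq> U})" if "U \<subseteq> V" for U
  proof -
    have "geometric_graph U {e \<in> E. ?A e \<subseteq> U}"
      using that by (intro geometric_graph_subset[OF g]) (auto simp: mem_Times_iff)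
    from card_edges_le_crossings[OF this]
    have "card {e \<in> E. ?A e \<subseteq> U} \<le> 4 * card U + card (crossing_pairs {e \<in> E. ?A e \<subseteq> U})" .
    moreover have "crossing_pairs {e \<in> E. ?A e \<subseteq> U} = {x \<in> ?X. ?B x \<subseteq> U}" by (auto simp: crossing_pairs_def)
    moreover have "{x \<in> V. {x} \<subseteq> U} = U" using that by auto
    ultimately show ?thesis by simp
  qed
  have "p\<^sup>2 * card E = (\<Sum>U\<in>Pow V. ?w U * card {e \<in> E. ?A e \<subseteq> U})"
  proof (rule sum_weights_card[symmetric, OF fV fE])
    fix e assume e: "e \<in> E"
    then have "fst e \<noteq> snd e" using lr by (metis less_irrefl)
    moreover have "fst e \<in> V" "snd e \<in> V" using e EV by auto
    ultimately show "?A e \<subseteq> V \<and> card (?A e) = 2" by simp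
  qed
  also have "\<dots> \<le> (\<Sum>U\<in>Pow V. ?w U * (4 * real (card {x \<in> V. {x} \<subseteq> U}) + real (card {x \<in> ?X. ?B x \<subseteq> U})))"
    using sub p by (intro sum_mono mult_left_mono) auto
  also have "\<dots> = 4 * (\<Sum>U\<in>Pow V. ?w U * card {x \<in> V. {x} \<subseteq> U}) + (\<Sum>U\<in>Pow V. ?w U * card {x \<in> ?X. ?B x \<subseteq> U})"
    by (simp add: distrib_left sum.distrib sum_distrib_left mult.assoc mult.left_commute)
  also have "(\<Sum>U\<in>Pow V. ?w U * card {x \<in> V. {x} \<subseteq> U}) = p ^ 1 * card V"
    by (rule sum_weights_card[OF fV fV]) auto
  also have "(\<Sum>U\<in>Pow V. ?w U * card {x \<in> ?X. ?B x \<subseteq> U}) = p ^ 4 * card ?X"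
  proof (rule sum_weights_card[OF fV fX])
    fix x assume x: "x \<in> ?X"
    obtain e f where ef: "x = (e, f)" by (cases x)
    have m: "e \<in> E" "f \<in> E" "crossing e f" using x ef by (auto simp: crossing_pairs_def)
    have "fst e \<noteq> snd e" "fst f \<noteq> snd f" using m lr by (metis less_irrefl)+
    moreover have "fst e \<in> V" "snd e \<in> V" "fst f \<in> V" "snd f \<in> V" using m(1,2) EV by auto
    ultimately show "?B x \<subseteq> V \<and> card (?B x) = 4"
      using crossing_disjoint_ends[OF g m] by (simp add: ef card_insert_if)
  qed
  finally show ?thesis by simp
qed

lemma crossing_lemma:
  assumes g: "geometric_graph V E" and big: "8 * card V < card E"
  shows "real (card E) ^ 3 \<le> 128 * real (card V) ^ 2 * card (crossing_pairs E)"
proof -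
  \<comment> \<open>This density makes the vertex term exactly half of the edge term, and
    \<open>big\<close> makes it at most 1. The constant 128 is 2 times the square of 8.\<close>
  define p where "p = 8 * real (card V) / card E"
  have E0: "real (card E) > 0" using big by simp
  have "0 < card V"
  proof (rule ccontr)
    assume "\<not> 0 < card V"
    then have "V = {}" using g by (auto simp: geometric_graph_def card_gt_0_iff)
    then show False using g big by (auto simp: geometric_graph_def)
  qed
  then have p: "0 < p" "p \<le> 1" using big by (auto simp: p_def)
  have pE: "p * card E = 8 * card V" using E0 by (simp add: p_def)
  have "p\<^sup>2 * card E \<le> 4 * p * card V + p ^ 4 * card (crossing_pairs E)"
    by (rule crossing_inequality[OF g]) (use p in auto)
  moreover have "4 * p * card V = p\<^sup>2 * card E / 2" using pE by (simp add: power2_eq_square)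
  moreover have "p ^ 4 * card (crossing_pairs E) = p\<^sup>2 * (p\<^sup>2 * card (crossing_pairs E))"
    by (simp add: power2_eq_square power4_eq_xxxx)
  ultimately have "p\<^sup>2 * (card E / 2) \<le> p\<^sup>2 * (p\<^sup>2 * card (crossing_pairs E))" by linarith
  then have "card E / 2 \<le> p\<^sup>2 * card (crossing_pairs E)" by (rule mult_left_le_imp_le) (use p in simp)
  then have "card E ^ 2 * (card E / 2) \<le> card E ^ 2 * (p\<^sup>2 * card (crossing_pairs E))" by (rule mult_left_mono) simp
  also have "\<dots> = (p * card E)\<^sup>2 * card (crossing_pairs E)" by (simp add: power_mult_distrib)
  finally show ?thesis unfolding pE by (simp add: power2_eq_square power3_eq_cube mult.assoc)
qed

text \<open>Summing over the edges gives at most \<open>card E * t\<close> crossing pairs, and one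
  factor \<open>card E\<close> cancels in the crossing lemma. The assumption
  \<open>1 \<le> t\<close> serves the sparse case, to which the crossing lemma does not
  apply.\<close>

lemma few_edges_if_few_crossings:
  fixes t :: real
  assumes g: "geometric_graph V E" and "1 \<le> t" and few: "\<And>e. e \<in> E \<Longrightarrow> real (card {f \<in> E. crossing e f}) \<le> t"
  shows "real (card E) \<le> 12 * card V * sqrt t"
proof (cases "8 * card V < card E")
  case False
  then have "real (card E) \<le> 8 * real (card V) * 1" by simp
  also have "\<dots> \<le> 12 * card V * sqrt t" using assms(2) by (intro mult_mono) auto
  finally show ?thesis .
next
  case True
  have fE: "finite E" using g by (rule geometric_graph_finite)
  have "crossing_pairs E = Sigma E (\<lambda>e. {f \<in> E. crossing e f})" by (auto simp: crossing_pairs_def)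
  then have "real (card (crossing_pairs E)) = (\<Sum>e\<in>E. real (card {f \<in> E. crossing e f}))" using fE by simp
  also have "\<dots> \<le> card E * t" using few sum_bounded_above[of E "\<lambda>e. real (card {f \<in> E. crossing e f})" t] by simp
  finally have "real (card E) ^ 3 \<le> 128 * real (card V) ^ 2 * (card E * t)"
    using crossing_lemma[OF g True] by (meson mult_left_mono order_trans zero_le_mult_iff zero_le_numeral zero_le_power2)
  then have "card E * (real (card E))\<^sup>2 \<le> card E * (128 * real (card V) ^ 2 * t)"
    by (simp add: power2_eq_square power3_eq_cube mult_ac)
  then have "(real (card E))\<^sup>2 \<le> 128 * real (card V) ^ 2 * t" using True by simp
  \<comment> \<open>The constant 128 is rounded up to a square.\<close>
  also have "\<dots> \<le> 144 * real (card V) ^ 2 * t" using assms(2) by (intro mult_right_mono) auto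
  also have "\<dots> = (12 * card V * sqrt t)\<^sup>2" using assms(2) by (simp add: power_mult_distrib)
  finally show ?thesis by (rule power2_le_imp_le) (use assms(2) in simp)
qed

section \<open>Segments between consecutive lines through a point\<close>

definition incident :: "real \<times> real \<Rightarrow> real \<times> real \<Rightarrow> bool" where
  "incident l p \<longleftrightarrow> snd p = fst l * fst p + snd l"

text \<open>Besides the slope of the line through \<open>p\<close> and \<open>q\<close>, this is the
  abscissa at which their dual lines meet.\<close>

definition slope :: "real \<times> real \<Rightarrow> real \<times> real \<Rightarrow> real" where
  "slope p q = (snd q - snd p) / (fst q - fst p)"

text \<open>The next line is taken among all lines of \<open>R\<close> through \<open>p\<close>, whether or not they are recorded in \<open>H\<close>:
  then no vertex lies in the interior of a segment.\<close>

definition next_line :: "(real \<times> real) set \<Rightarrow> real \<times> real \<Rightarrow> real \<times> real \<Rightarrow> real \<times> real" where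
  "next_line R l p = (SOME k. k \<in> R \<and> incident k p \<and> fst l < fst k \<and>
     (\<forall>j\<in>R. incident j p \<longrightarrow> fst l < fst j \<longrightarrow> fst k \<le> fst j))"

text \<open>The last line of \<open>R\<close> through a point starts no segment. Leaving its
  incidence out of \<open>H\<close> makes \<open>next_line\<close> a genuine line on all of
  \<open>H\<close>.\<close>

definition extendable :: "(real \<times> real) set \<Rightarrow> ((real \<times> real) \<times> (real \<times> real)) set \<Rightarrow> bool" where
  "extendable R H \<longleftrightarrow> finite R \<and> finite H \<and>
     (\<forall>(l, p)\<in>H. l \<in> R \<and> incident l p \<and> (\<exists>k\<in>R. incident k p \<and> fst l < fst k))"

definition line_edge :: "(real \<times> real) set \<Rightarrow> (real \<times> real) \<times> (real \<times> real) \<Rightarrow> (real \<times> real) \<times> (real \<times> real)" where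
  "line_edge R = (\<lambda>(l, p). (l, next_line R l p))"

lemma incident_unique:
  "incident l p \<Longrightarrow> incident k p \<Longrightarrow> fst l = fst k \<Longrightarrow> l = k"
  by (simp add: incident_def prod_eq_iff)

lemma incident_two_points:
  assumes "incident l p" "incident l q" "incident k p" "incident k q" "p \<noteq> q"
  shows "l = k"
proof -
  have "fst p \<noteq> fst q" using assms by (auto simp: incident_def prod_eq_iff)
  moreover have "(fst l - fst k) * (fst p - fst q) = 0" using assms(1-4) by (simp add: incident_def algebra_simps)
  ultimately show ?thesis using incident_unique assms by simp
qed

context
  fixes R H assumes ext: "extendable R H"
begin

lemma next_line:
  assumes "(l, p) \<in> H"
  shows "next_line R l p \<in> R" "incident (next_line R l p) p" "fst l < fst (next_line R l p)"
    "\<And>j. j \<in> R \<Longrightarrow> incident j p \<Longrightarrow> fst l < fst j \<Longrightarrow> fst (next_line R l p) \<le> fst j"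
proof -
  let ?S = "{k \<in> R. incident k p \<and> fst l < fst k}"
  have "finite R" "\<exists>k\<in>R. incident k p \<and> fst l < fst k" using ext assms unfolding extendable_def by blast+
  then have S: "finite ?S" "?S \<noteq> {}" by (simp, blast)
  then have "Min (fst ` ?S) \<in> fst ` ?S" "\<And>j. j \<in> ?S \<Longrightarrow> Min (fst ` ?S) \<le> fst j" by auto
  then have "\<exists>k. k \<in> R \<and> incident k p \<and> fst l < fst k \<and> (\<forall>j\<in>R. incident j p \<longrightarrow> fst l < fst j \<longrightarrow> fst k \<le> fst j)"
    by fastforce
  from someI_ex[OF this] show "next_line R l p \<in> R" "incident (next_line R l p) p" "fst l < fst (next_line R l p)"
    "\<And>j. j \<in> R \<Longrightarrow> incident j p \<Longrightarrow> fst l < fst j \<Longrightarrow> fst (next_line R l p) \<le> fst j"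
    unfolding next_line_def by blast+
qed

lemma mem_H: assumes "(l, p) \<in> H" shows "l \<in> R" "incident l p"
  using ext assms by (auto simp: extendable_def)

text \<open>The segment lies on the dual line of \<open>p\<close>; the two lines through
  \<open>p\<close> only determine where it starts and stops.\<close>

lemma height_edge:
  assumes "(l, p) \<in> H"
  shows "height (line_edge R (l, p)) a = snd p - a * fst p"
proof -
  let ?k = "next_line R l p"
  have "snd l = snd p - fst l * fst p" "snd ?k = snd p - fst ?k * fst p"
    using mem_H(2)[OF assms] next_line(2)[OF assms] by (auto simp: incident_def)
  moreover from this have "(snd ?k - snd l) / (fst ?k - fst l) = - fst p"
    using next_line(3)[OF assms] by (simp add: divide_eq_eq algebra_simps)
  ultimately show ?thesis by (simp add: height_def line_edge_def algebra_simps)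
qed

text \<open>Segments on one dual line have disjoint interiors, as each stops at the next line of
  \<open>R\<close>. So a point and an abscissa determine the segment.\<close>

lemma edge_unique:
  assumes "(l, p) \<in> H" "(l', p) \<in> H" "fst l < a" "a < fst (next_line R l p)" "fst l' < a" "a < fst (next_line R l' p)"
  shows "l = l'"
proof -
  have "\<not> fst l < fst l'" using next_line(4)[OF assms(1), of l'] mem_H[OF assms(2)] assms by auto
  moreover have "\<not> fst l' < fst l" using next_line(4)[OF assms(2), of l] mem_H[OF assms(1)] assms by auto
  ultimately show ?thesis using incident_unique mem_H assms(1,2) by (metis linorder_neqE)
qed

text \<open>Segments of the same point do not cross, and dual lines of points on a common vertical
  are parallel. In all other cases the dual lines meet only at \<open>slope p q\<close>, so a
  crossing places this slope inside both segments.\<close>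

lemma crossing_edgeD:
  assumes H: "(l, p) \<in> H" "(k, q) \<in> H" and c: "crossing (line_edge R (l, p)) (line_edge R (k, q))"
  shows "fst p \<noteq> fst q" "fst l < slope p q" "slope p q < fst (next_line R l p)"
    "fst k < slope p q" "slope p q < fst (next_line R k q)"
proof -
  obtain a where a: "fst l < a" "a < fst (next_line R l p)" "fst k < a" "a < fst (next_line R k q)"
    "snd p - a * fst p = snd q - a * fst q"
    using c unfolding crossing_def height_edge[OF H(1)] height_edge[OF H(2)] by (auto simp: line_edge_def)
  have "p \<noteq> q"
  proof
    assume "p = q"
    then have "l = k" using edge_unique[of l p k a] H a by simp
    then show False using c \<open>p = q\<close> by (simp add: crossing_def)
  qed
  show 1: "fst p \<noteq> fst q"
  proof
    assume "fst p = fst q"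
    then show False using a(5) \<open>p \<noteq> q\<close> by (simp add: prod_eq_iff)
  qed
  have "slope p q = a" using 1 a(5) by (simp add: slope_def divide_eq_eq algebra_simps)
  then show "fst l < slope p q" "slope p q < fst (next_line R l p)"
    "fst k < slope p q" "slope p q < fst (next_line R k q)" using a by auto
qed

lemma geometric_graph_edges: "geometric_graph R (line_edge R ` H)"
  unfolding geometric_graph_def
proof (intro conjI ballI impI)
  show "finite R" using ext by (simp add: extendable_def)
  show "line_edge R ` H \<subseteq> R \<times> R" using next_line(1) mem_H(1) by (auto simp: line_edge_def)
  fix e assume "e \<in> line_edge R ` H"
  then obtain l p where e: "e = line_edge R (l, p)" and H: "(l, p) \<in> H" by auto
  show "fst (fst e) < fst (snd e)" using next_line(3)[OF H] by (simp add: e line_edge_def)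
  fix z assume z: "z \<in> R" "fst (fst e) < fst z" "fst z < fst (snd e)"
  show "snd z \<noteq> height e (fst z)"
  proof
    assume "snd z = height e (fst z)"
    then have "incident z p" by (simp add: e height_edge[OF H] incident_def)
    then have "fst (next_line R l p) \<le> fst z" using next_line(4)[OF H z(1)] z(2) by (simp add: e line_edge_def)
    then show False using z(3) by (simp add: e line_edge_def)
  qed
qed

text \<open>The ends of the segment are two distinct lines, which meet only in
  \<open>p\<close>.\<close>

lemma inj_on_line_edge: "inj_on (line_edge R) H"
proof (rule inj_onI)
  fix x y assume "x \<in> H" "y \<in> H" "line_edge R x = line_edge R y"
  moreover obtain l p k q where xy: "x = (l, p)" "y = (k, q)" by (cases x, cases y)
  ultimately have H: "(l, p) \<in> H" "(k, q) \<in> H" "l = k" "next_line R l p = next_line R k q" by (auto simp: line_edge_def)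
  have "p = q"
    using incident_two_points[of l p q "next_line R l p"] mem_H(2)[OF H(1)] mem_H(2)[OF H(2)] next_line(2,3)[OF H(1)]
      next_line(2)[OF H(2)] H(3,4) by (metis less_irrefl)
  then show "x = y" using H xy by simp
qed

text \<open>Points are collected rather than segments, since a structured set consists of
  points.\<close>

definition crossers :: "(real \<times> real) \<times> (real \<times> real) \<Rightarrow> (real \<times> real) set" where
  "crossers x = {q. \<exists>k. (k, q) \<in> H \<and> crossing (line_edge R x) (line_edge R (k, q))}"

text \<open>Nothing is lost by counting points: all segments of \<open>q\<close> that cross the one
  of \<open>x\<close> do so at the same abscissa, so \<open>edge_unique\<close> leaves only
  one.\<close>

lemma card_crossing_le_crossers:
  assumes x: "x \<in> H" and B: "B \<subseteq> H"
  shows "card {f \<in> line_edge R ` B. crossing (line_edge R x) f} \<le> card (crossers x)"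
proof -
  obtain l p where lp: "x = (l, p)" by (cases x)
  have "crossers x \<subseteq> snd ` H" by (force simp: crossers_def)
  then have fin: "finite (crossers x)" using ext by (auto simp: extendable_def intro: finite_subset)
  have "\<forall>q\<in>crossers x. \<exists>k. (k, q) \<in> H \<and> crossing (line_edge R x) (line_edge R (k, q))" by (simp add: crossers_def)
  from bchoice[OF this] obtain g where g: "\<And>q. q \<in> crossers x \<Longrightarrow> (g q, q) \<in> H \<and> crossing (line_edge R x) (line_edge R (g q, q))"
    by blast
  have "{f \<in> line_edge R ` B. crossing (line_edge R x) f} \<subseteq> (\<lambda>q. line_edge R (g q, q)) ` crossers x"
  proof
    fix f assume "f \<in> {f \<in> line_edge R ` B. crossing (line_edge R x) f}"
    then obtain k q where f: "f = line_edge R (k, q)" "(k, q) \<in> H" "crossing (line_edge R x) (line_edge R (k, q))" using B by auto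
    then have q: "q \<in> crossers x" unfolding crossers_def by blast
    have "k = g q"
      using edge_unique[of k q "g q" "slope p q"] f(2) g[OF q] crossing_edgeD[of l p k q] crossing_edgeD[of l p "g q" q] x f(3) lp by simp
    then show "f \<in> (\<lambda>q. line_edge R (g q, q)) ` crossers x" using f q by auto
  qed
  then show ?thesis using fin by (meson card_image_le card_mono finite_imageI order_trans)
qed

text \<open>The crossing bound is applied to the graph formed by the poor segments alone, in which
  each of them still has at most \<open>t\<close> crossings.\<close>

lemma card_few_crossers:
  fixes t :: real assumes t: "1 \<le> t"
  shows "real (card {x \<in> H. real (card (crossers x)) \<le> t}) \<le> 12 * real (card R) * sqrt t"
proof -
  let ?B = "{x \<in> H. real (card (crossers x)) \<le> t}"
  have "inj_on (line_edge R) ?B" by (rule inj_on_subset[OF inj_on_line_edge]) auto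
  then have "card ?B = card (line_edge R ` ?B)" by (simp add: card_image)
  also have "real \<dots> \<le> 12 * real (card R) * sqrt t"
  proof (rule few_edges_if_few_crossings[OF _ t, of R, simplified of_nat_mult of_nat_numeral])
    show "geometric_graph R (line_edge R ` ?B)"
      using geometric_graph_edges by (rule geometric_graph_subset) (use geometric_graph_edges in \<open>auto simp: geometric_graph_def\<close>)
    fix e assume "e \<in> line_edge R ` ?B"
    then obtain x where x: "e = line_edge R x" "x \<in> H" "real (card (crossers x)) \<le> t" by auto
    have "card {f \<in> line_edge R ` ?B. crossing e f} \<le> card (crossers x)"
      unfolding x(1) by (rule card_crossing_le_crossers[OF x(2)]) auto
    then show "real (card {f \<in> line_edge R ` ?B. crossing e f}) \<le> t" using x(3) by simp
  qed
  finally show ?thesis .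
qed

lemma crossers_two_lines:
  assumes "(l, p) \<in> H" "q \<in> crossers (l, p)"
  shows "q \<in> snd ` H" "fst p \<noteq> fst q" "fst l < slope p q" "slope p q < fst (next_line R l p)"
    "\<exists>r\<in>R. \<exists>r'\<in>R. r \<noteq> r' \<and> incident r q \<and> incident r' q"
proof -
  obtain k where k: "(k, q) \<in> H" "crossing (line_edge R (l, p)) (line_edge R (k, q))" using assms by (auto simp: crossers_def)
  show "q \<in> snd ` H" using k by force
  show "fst p \<noteq> fst q" "fst l < slope p q" "slope p q < fst (next_line R l p)" using crossing_edgeD[OF assms(1) k] by auto
  have "k \<noteq> next_line R k q" using next_line(3)[OF k(1)] by auto
  then show "\<exists>r\<in>R. \<exists>r'\<in>R. r \<noteq> r' \<and> incident r q \<and> incident r' q"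
    using mem_H[OF k(1)] next_line(1,2)[OF k(1)] by blast
qed

text \<open>The Szemeredi-Trotter bound by the crossing lemma: two dual lines meet at most once, so
  ordered crossing pairs inject into ordered pairs of points.\<close>

lemma card_extendable_cube:
  assumes big: "8 * card R < card H" 
  shows "real (card H) ^ 3 \<le> 128 * real (card R) ^ 2 * real (card (snd ` H)) ^ 2"
proof -
  let ?E = "line_edge R ` H"
  have fin: "finite H" using ext by (simp add: extendable_def)
  have cE: "card ?E = card H" by (rule card_image[OF inj_on_line_edge])
  have "\<forall>e\<in>?E. \<exists>x. x \<in> H \<and> line_edge R x = e" by blast
  from bchoice[OF this] obtain g where g: "\<And>e. e \<in> ?E \<Longrightarrow> g e \<in> H \<and> line_edge R (g e) = e" by blast
  have "card (crossing_pairs ?E) \<le> card (snd ` H \<times> snd ` H)"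
  proof (rule card_inj_on_le)
    show "inj_on (\<lambda>(e, f). (snd (g e), snd (g f))) (crossing_pairs ?E)"
    proof (rule inj_onI)
      fix x y assume x: "x \<in> crossing_pairs ?E" and y: "y \<in> crossing_pairs ?E"
        and eq: "(\<lambda>(e, f). (snd (g e), snd (g f))) x = (\<lambda>(e, f). (snd (g e), snd (g f))) y"
      obtain e f e' f' where xy: "x = (e, f)" "y = (e', f')" by (cases x, cases y)
      have E: "e \<in> ?E" "f \<in> ?E" "e' \<in> ?E" "f' \<in> ?E" "crossing e f" "crossing e' f'"
        using x y by (auto simp: xy crossing_pairs_def)
      obtain l p where lp: "g e = (l, p)" by (cases "g e")
      obtain k q where kq: "g f = (k, q)" by (cases "g f")
      obtain l' where lp': "g e' = (l', p)" using eq lp by (cases "g e'") (simp add: xy)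
      obtain k' where kq': "g f' = (k', q)" using eq kq by (cases "g f'") (simp add: xy)
      have H: "(l, p) \<in> H" "(k, q) \<in> H" "(l', p) \<in> H" "(k', q) \<in> H"
        and c: "crossing (line_edge R (l, p)) (line_edge R (k, q))" "crossing (line_edge R (l', p)) (line_edge R (k', q))"
        using g[OF E(1)] g[OF E(2)] g[OF E(3)] g[OF E(4)] E(5,6) by (simp_all add: lp kq lp' kq')
      have "l = l'" using edge_unique[OF H(1,3)] crossing_edgeD[OF H(1,2) c(1)] crossing_edgeD[OF H(3,4) c(2)] by blast
      moreover have "k = k'" using edge_unique[OF H(2,4)] crossing_edgeD[OF H(1,2) c(1)] crossing_edgeD[OF H(3,4) c(2)] by blast
      ultimately have "g e = g e'" "g f = g f'" using lp lp' kq kq' by simp_all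
      then have "e = e'" "f = f'" using g E by metis+
      then show "x = y" using xy by simp
    qed
    show "(\<lambda>(e, f). (snd (g e), snd (g f))) ` crossing_pairs ?E \<subseteq> snd ` H \<times> snd ` H"
    proof
      fix z assume "z \<in> (\<lambda>(e, f). (snd (g e), snd (g f))) ` crossing_pairs ?E"
      then obtain x where x: "x \<in> crossing_pairs ?E" "z = (snd (g (fst x)), snd (g (snd x)))" by (auto simp: case_prod_beta)
      then have "fst x \<in> ?E" "snd x \<in> ?E" unfolding crossing_pairs_def case_prod_beta by blast+
      then show "z \<in> snd ` H \<times> snd ` H" using g x(2) by blast
    qed
    show "finite (snd ` H \<times> snd ` H)" using fin by simp
  qed
  then have "real (card (crossing_pairs ?E)) \<le> real (card (snd ` H)) ^ 2"
    by (simp add: card_cartesian_product power2_eq_square flip: of_nat_mult)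
  then have "128 * real (card R) ^ 2 * real (card (crossing_pairs ?E)) \<le> 128 * real (card R) ^ 2 * real (card (snd ` H)) ^ 2"
    by (intro mult_left_mono) auto
  moreover have "real (card ?E) ^ 3 \<le> 128 * real (card R) ^ 2 * card (crossing_pairs ?E)"
    by (rule crossing_lemma[OF geometric_graph_edges]) (simp add: cE big)
  ultimately show ?thesis using cE by simp
qed

end

section \<open>Ranks of the points in a direction\<close>

text \<open>For \<open>r \<le> r'\<close>, an offset \<open>j\<close> that separates the two ranks
  has a multiple of \<open>K\<close> between \<open>r + j\<close> and \<open>r' + j\<close>.
  Subtracting \<open>j\<close> sends it into \<open>{r<..r'}\<close>, and different offsets below
  \<open>K\<close> give different residues, hence different values.\<close>

lemma card_offset_change:
  fixes K r r' :: nat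
  shows "int (card {j. j < K \<and> (r + j) div K \<noteq> (r' + j) div K}) \<le> \<bar>int r' - int r\<bar>"
proof -
  have *: "card {j. j < K \<and> (r + j) div K \<noteq> (r' + j) div K} \<le> r' - r" if "r \<le> r'" for r r' :: nat
  proof -
    define g where "g j = K * ((r' + j) div K) - j" for j
    have ge: "j \<le> K * ((r' + j) div K) \<and> r < g j \<and> g j \<le> r'" if "j < K" "(r + j) div K \<noteq> (r' + j) div K" for j
    proof -
      have "K > 0" using that by simp
      have "(r + j) div K < (r' + j) div K" using that \<open>r \<le> r'\<close> div_le_mono[of "r + j" "r' + j" K] by simp
      then have "r + j < K * ((r' + j) div K)" using \<open>K > 0\<close> by (metis div_less_iff_less_mult mult.commute)
      moreover have "K * ((r' + j) div K) \<le> r' + j" by simp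
      ultimately show ?thesis unfolding g_def by linarith
    qed
    have "card {j. j < K \<and> (r + j) div K \<noteq> (r' + j) div K} \<le> card {r<..r'}"
    proof (rule card_inj_on_le)
      have inj: "i = j" if "i \<le> j" "j < K" "i \<le> K * a" "j \<le> K * b" "K * a - i = K * b - j" for a b i j :: nat
      proof -
        have "j - i = K * b - K * a" using that by linarith
        also have "\<dots> = K * (b - a)" by (simp add: diff_mult_distrib2)
        finally have "K dvd j - i" by simp
        then show "i = j" using that nat_dvd_not_less[of "j - i" K] by (cases "i = j") auto
      qed
      show "inj_on g {j. j < K \<and> (r + j) div K \<noteq> (r' + j) div K}"
      proof (rule inj_onI)
        fix i j assume i: "i \<in> {j. j < K \<and> (r + j) div K \<noteq> (r' + j) div K}"
          and j: "j \<in> {j. j < K \<and> (r + j) div K \<noteq> (r' + j) div K}" and eq: "g i = g j"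
        show "i = j"
        proof (cases "i \<le> j")
          case True
          show ?thesis by (rule inj[OF True]) (use i j eq ge[of i] ge[of j] in \<open>auto simp: g_def\<close>)
        next
          case False
          then have "j \<le> i" by simp
          then have "j = i" by (rule inj) (use i j eq ge[of i] ge[of j] in \<open>auto simp: g_def\<close>)
          then show ?thesis by simp
        qed
      qed
    qed (use ge in auto)
    then show ?thesis by simp
  qed
  show ?thesis
  proof (cases "r \<le> r'")
    case True then show ?thesis using *[OF True] by simp
  next
    case False
    have "{j. j < K \<and> (r + j) div K \<noteq> (r' + j) div K} = {j. j < K \<and> (r' + j) div K \<noteq> (r + j) div K}" by auto
    then show ?thesis using *[of r' r] False by simp
  qed
qed

lemma card_jumps_le:
  fixes g :: "nat \<Rightarrow> nat"
  assumes "mono g"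
  shows "card {t. t < S \<and> g (Suc t) \<noteq> g t} \<le> g S"
proof (induction S)
  case (Suc S)
  show ?case
  proof (cases "g (Suc S) = g S")
    case True
    then have "{t. t < Suc S \<and> g (Suc t) \<noteq> g t} \<subseteq> {t. t < S \<and> g (Suc t) \<noteq> g t}"
      using less_Suc_eq by blast
    then have "card {t. t < Suc S \<and> g (Suc t) \<noteq> g t} \<le> card {t. t < S \<and> g (Suc t) \<noteq> g t}" by (intro card_mono) simp_all
    then show ?thesis using Suc.IH True by linarith
  next
    case False
    then have "g S < g (Suc S)" using assms by (simp add: mono_def le_neq_implies_less)
    have "{t. t < Suc S \<and> g (Suc t) \<noteq> g t} \<subseteq> insert S {t. t < S \<and> g (Suc t) \<noteq> g t}"
      using less_Suc_eq by blast
    then have "card {t. t < Suc S \<and> g (Suc t) \<noteq> g t} \<le> card (insert S {t. t < S \<and> g (Suc t) \<noteq> g t})" by (intro card_mono) simp_all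
    also have "\<dots> = Suc (card {t. t < S \<and> g (Suc t) \<noteq> g t})" by simp
    finally show ?thesis using Suc.IH \<open>g S < g (Suc S)\<close> by linarith
  qed
qed simp

text \<open>Send an unstable element \<open>a\<close> to the first change of \<open>s\<close> at or
  after \<open>a\<close>. It comes before the next element of \<open>A\<close>, so the assignment is
  injective. The summand 1 accounts for the last element, which has no successor.\<close>

lemma card_unstable_le:
  fixes s :: "nat \<Rightarrow> 'a"
  assumes A: "finite A" "\<And>a. a \<in> A \<Longrightarrow> a \<le> S"
  shows "card {a \<in> A. \<not> (\<exists>b\<in>A. a < b \<and> (\<forall>c\<in>{a..b}. s c = s a))} \<le> 1 + card {t. t < S \<and> s (Suc t) \<noteq> s t}"
proof (cases "A = {}")
  case False
  define change where "change t \<longleftrightarrow> s (Suc t) \<noteq> s t" for t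
  define unstable where "unstable a \<longleftrightarrow> \<not> (\<exists>b\<in>A. a < b \<and> (\<forall>c\<in>{a..b}. s c = s a))" for a
  define g where "g a = (LEAST t. a \<le> t \<and> change t)" for a
  have const: "s c = s a" if n: "\<And>t. a \<le> t \<Longrightarrow> t < b \<Longrightarrow> \<not> change t" and "a \<le> c" "c \<le> b" for a b c
    using that(2,3)
  proof (induction c rule: dec_induct)
    case (step c)
    then have "\<not> change c" using n by simp
    then show ?case using step unfolding change_def by simp
  qed (rule refl)
  have g: "a \<le> g a \<and> change (g a) \<and> g a < b" if "unstable a" "b \<in> A" "a < b" for a b
  proof -
    have "\<exists>t. a \<le> t \<and> t < b \<and> change t"
    proof (rule ccontr)
      assume n: "\<not> (\<exists>t. a \<le> t \<and> t < b \<and> change t)"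
      have "\<forall>c\<in>{a..b}. s c = s a"
      proof
        fix c assume "c \<in> {a..b}"
        then show "s c = s a" using n by (intro const[of a b]) auto
      qed
      then show False using that unfolding unstable_def by blast
    qed
    then obtain t where t: "a \<le> t" "t < b" "change t" by blast
    have "a \<le> g a \<and> change (g a)" unfolding g_def by (rule LeastI[of _ t]) (use t in simp)
    moreover have "g a \<le> t" unfolding g_def by (rule Least_le) (use t in simp)
    ultimately show ?thesis using t by simp
  qed
  have M: "Max A \<in> A" using A(1) False by (rule Max_in)
  let ?B = "{a \<in> A. unstable a}"
  have lt: "a < Max A" if "a \<in> ?B - {Max A}" for a
    using that Max_ge[OF A(1), of a] by auto
  have "card (?B - {Max A}) \<le> card {t. t < S \<and> change t}"
  proof (rule card_inj_on_le)
    show "inj_on g (?B - {Max A})"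
    proof (rule linorder_inj_onI')
      fix a b assume "a \<in> ?B - {Max A}" "b \<in> ?B - {Max A}" "a < b"
      then have "g a < b" "b \<le> g b" using g[of a b] g[of b "Max A"] lt[of b] M by auto
      then show "g a \<noteq> g b" by simp
    qed
    show "g ` (?B - {Max A}) \<subseteq> {t. t < S \<and> change t}"
    proof (rule image_subsetI)
      fix a assume a: "a \<in> ?B - {Max A}"
      then have "change (g a) \<and> g a < Max A" using g[OF _ M, of a] lt[OF a] by blast
      then show "g a \<in> {t. t < S \<and> change t}" using A(2)[OF M] by simp
    qed
  qed simp
  moreover have "card ?B \<le> 1 + card (?B - {Max A})"
    using diff_card_le_card_Diff[of "{Max A}" ?B] by simp
  ultimately have "card ?B \<le> 1 + card {t. t < S \<and> change t}" by linarith
  then show ?thesis unfolding unstable_def change_def .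
next
  case True
  then have "{a \<in> A. \<not> (\<exists>b\<in>A. a < b \<and> (\<forall>c\<in>{a..b}. s c = s a))} = {}" by blast
  then show ?thesis by (metis card.empty le0)
qed

lemma exists_small_summand:
  fixes f :: "nat \<Rightarrow> nat"
  assumes "K > 0" "(\<Sum>j<K. f j) \<le> B"
  shows "\<exists>j<K. K * f j \<le> B"
proof (rule ccontr)
  assume n: "\<not> (\<exists>j<K. K * f j \<le> B)"
  have "(\<Sum>j<K. B) < (\<Sum>j<K. K * f j)" using assms(1) n by (intro sum_strict_mono) (auto simp: not_le)
  also have "\<dots> = K * (\<Sum>j<K. f j)" by (simp add: sum_distrib_left)
  also have "\<dots> \<le> K * B" using assms(2) by simp
  finally show False by simp
qed

section \<open>The order of the points at a given slope\<close>

definition dual_value :: "real \<Rightarrow> real \<times> real \<Rightarrow> real" where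
  "dual_value m q = snd q - m * fst q"

text \<open>Points on a common line of slope \<open>m\<close> have equal dual values at
  \<open>m\<close>. Breaking ties by the first coordinate makes the ranks distinct and still lets
  each comparison change only once.\<close>

definition before :: "real \<Rightarrow> real \<times> real \<Rightarrow> real \<times> real \<Rightarrow> bool" where
  "before m p q \<longleftrightarrow> dual_value m p < dual_value m q \<or> (dual_value m p = dual_value m q \<and> fst p < fst q)"

definition point_rank :: "(real \<times> real) set \<Rightarrow> real \<Rightarrow> real \<times> real \<Rightarrow> nat" where
  "point_rank P m q = card {p \<in> P. before m p q}"

lemma before_trans: "before m p q \<Longrightarrow> before m q r \<Longrightarrow> before m p r"
  unfolding before_def by auto

lemma before_irrefl: "\<not> before m p p"
  unfolding before_def by auto

lemma before_total: "p \<noteq> q \<Longrightarrow> before m p q \<or> before m q p"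
  unfolding before_def dual_value_def by (cases "fst p = fst q") (auto simp: prod_eq_iff)

text \<open>The comparison of two points can change only once as the slope grows. This bounds the total
  variation of all ranks by the square of the number of points.\<close>

lemma before_monotone:
  "(\<forall>m m'. m \<le> m' \<longrightarrow> before m p q \<longrightarrow> before m' p q) \<or> (\<forall>m m'. m \<le> m' \<longrightarrow> before m' p q \<longrightarrow> before m p q)"
proof (cases "fst p < fst q")
  case True
  have "before m p q" if "m \<le> m'" "before m' p q" for m m'
  proof -
    have "m * (fst q - fst p) \<le> m' * (fst q - fst p)" using that True by (intro mult_right_mono) auto
    then show ?thesis using that True by (auto simp: before_def dual_value_def algebra_simps)
  qed
  then show ?thesis by blast
next
  case False
  have "before m' p q" if "m \<le> m'" "before m p q" for m m'
  proof -
    have "m * (fst p - fst q) \<le> m' * (fst p - fst q)" using that False by (intro mult_right_mono) auto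
    then show ?thesis using that False by (auto simp: before_def dual_value_def algebra_simps)
  qed
  then show ?thesis by blast
qed

lemma point_rank_less:
  assumes "finite P" "p \<in> P" "before m p q"
  shows "point_rank P m p < point_rank P m q"
proof -
  have "{r \<in> P. before m r p} \<subset> {r \<in> P. before m r q}"
    using assms before_trans before_irrefl by blast
  then show ?thesis unfolding point_rank_def using assms(1) by (intro psubset_card_mono) auto
qed

lemma before_if_rank_less:
  assumes "finite P" "q \<in> P" "point_rank P m p < point_rank P m q"
  shows "before m p q"
  using before_total[of p q m] point_rank_less[OF assms(1,2), of m p] assms(3) by (cases "p = q") auto

lemma point_rank_less_card: "finite P \<Longrightarrow> q \<in> P \<Longrightarrow> point_rank P m q < card P"
  unfolding point_rank_def using before_irrefl[of m q] by (intro psubset_card_mono) blast+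

lemma inj_on_point_rank: "finite P \<Longrightarrow> inj_on (point_rank P m) P"
proof (rule inj_onI)
  fix p q assume "finite P" "p \<in> P" "q \<in> P" "point_rank P m p = point_rank P m q"
  then show "p = q" using before_total[of p q m] point_rank_less[of P p m q] point_rank_less[of P q m p] by auto
qed

lemma point_rank_image: 
  assumes "finite P" shows "point_rank P m ` P = {..<card P}"
proof (rule card_subset_eq)
  show "point_rank P m ` P \<subseteq> {..<card P}" using point_rank_less_card[OF assms] by auto
  show "card (point_rank P m ` P) = card {..<card P}" using card_image[OF inj_on_point_rank[OF assms]] by simp
qed simp

lemma total_variation_of_bool:
  assumes "(\<forall>t<S. x t \<longrightarrow> x (Suc t)) \<or> (\<forall>t<S. x (Suc t) \<longrightarrow> x t)"
  shows "(\<Sum>t<S. \<bar>of_bool (x (Suc t)) - of_bool (x t) :: int\<bar>) \<le> 1"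
  using assms
proof
  assume up: "\<forall>t<S. x t \<longrightarrow> x (Suc t)"
  have "(\<Sum>t<S. \<bar>of_bool (x (Suc t)) - of_bool (x t) :: int\<bar>) = (\<Sum>t<S. of_bool (x (Suc t)) - of_bool (x t))"
    using up by (intro sum.cong) auto
  also have "\<dots> = of_bool (x S) - of_bool (x 0)" by (rule sum_lessThan_telescope)
  finally show ?thesis by simp
next
  assume down: "\<forall>t<S. x (Suc t) \<longrightarrow> x t"
  have "(\<Sum>t<S. \<bar>of_bool (x (Suc t)) - of_bool (x t) :: int\<bar>) = (\<Sum>t<S. of_bool (x t) - of_bool (x (Suc t)))"
    using down by (intro sum.cong) auto
  also have "\<dots> = of_bool (x 0) - of_bool (x S)" by (rule sum_lessThan_telescope')
  finally show ?thesis by simp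
qed

text \<open>A rank is a sum of indicators, one per point, and each indicator has total variation at
  most 1.\<close>

lemma point_rank_variation:
  assumes P: "finite P" and mono: "\<And>t. t < S \<Longrightarrow> ms t \<le> ms (Suc t)"
  shows "(\<Sum>t<S. \<bar>int (point_rank P (ms (Suc t)) q) - int (point_rank P (ms t) q)\<bar>) \<le> card P"
proof -
  have r: "int (point_rank P m q) = (\<Sum>p\<in>P. of_bool (before m p q))" for m
    using P by (simp add: point_rank_def Int_def)
  have "(\<Sum>t<S. \<bar>int (point_rank P (ms (Suc t)) q) - int (point_rank P (ms t) q)\<bar>)
      \<le> (\<Sum>t<S. \<Sum>p\<in>P. \<bar>of_bool (before (ms (Suc t)) p q) - of_bool (before (ms t) p q)\<bar>)"
    unfolding r sum_subtractf[symmetric] by (intro sum_mono sum_abs)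
  also have "\<dots> = (\<Sum>p\<in>P. \<Sum>t<S. \<bar>of_bool (before (ms (Suc t)) p q) - of_bool (before (ms t) p q)\<bar>)"
    by (rule sum.swap)
  also have "\<dots> \<le> (\<Sum>p\<in>P. 1)"
    by (intro sum_mono total_variation_of_bool) (use before_monotone mono in blast)
  finally show ?thesis by simp
qed

text \<open>Averaging over the offsets: all of them together see at most as many band changes as the
  total variation of the ranks.\<close>

lemma exists_offset:
  assumes P: "finite P" and mono: "\<And>t. t < S \<Longrightarrow> ms t \<le> ms (Suc t)" and K: "K > 0"
  shows "\<exists>j<K. K * card {(t, q). t < S \<and> q \<in> P \<and> (point_rank P (ms (Suc t)) q + j) div K \<noteq> (point_rank P (ms t) q + j) div K} \<le> (card P)\<^sup>2"
proof (rule exists_small_summand[OF K])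
  let ?r = "\<lambda>t q. point_rank P (ms t) q"
  have "int (\<Sum>j<K. card {(t, q). t < S \<and> q \<in> P \<and> (?r (Suc t) q + j) div K \<noteq> (?r t q + j) div K})
     = (\<Sum>j<K. \<Sum>t<S. \<Sum>q\<in>P. of_bool ((?r (Suc t) q + j) div K \<noteq> (?r t q + j) div K))"
  proof -
    have "{(t, q). t < S \<and> q \<in> P \<and> (?r (Suc t) q + j) div K \<noteq> (?r t q + j) div K}
       = Sigma {..<S} (\<lambda>t. {q \<in> P. (?r (Suc t) q + j) div K \<noteq> (?r t q + j) div K})" for j by auto
    then show ?thesis using P by (simp add: Int_def)
  qed
  also have "\<dots> = (\<Sum>t<S. \<Sum>q\<in>P. \<Sum>j<K. of_bool ((?r (Suc t) q + j) div K \<noteq> (?r t q + j) div K))"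
    by (subst sum.swap, rule sum.cong[OF refl], rule sum.swap)
  also have "\<dots> \<le> (\<Sum>t<S. \<Sum>q\<in>P. \<bar>int (?r (Suc t) q) - int (?r t q)\<bar>)"
  proof (intro sum_mono)
    fix t q
    have "(\<Sum>j<K. of_bool ((?r (Suc t) q + j) div K \<noteq> (?r t q + j) div K)) = int (card {j. j < K \<and> (?r t q + j) div K \<noteq> (?r (Suc t) q + j) div K})"
      by (simp add: Int_def eq_commute)
    also have "\<dots> \<le> \<bar>int (?r (Suc t) q) - int (?r t q)\<bar>" by (rule card_offset_change)
    finally show "(\<Sum>j<K. of_bool ((?r (Suc t) q + j) div K \<noteq> (?r t q + j) div K)) \<le> \<bar>int (?r (Suc t) q) - int (?r t q)\<bar>" .
  qed
  also have "\<dots> = (\<Sum>q\<in>P. \<Sum>t<S. \<bar>int (?r (Suc t) q) - int (?r t q)\<bar>)" by (rule sum.swap)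
  also have "\<dots> \<le> (\<Sum>q\<in>P. int (card P))" using mono by (intro sum_mono point_rank_variation[OF P]) auto
  also have "\<dots> = int ((card P)\<^sup>2)" by (simp add: power2_eq_square)
  finally show "(\<Sum>j<K. card {(t, q). t < S \<and> q \<in> P \<and> (?r (Suc t) q + j) div K \<noteq> (?r t q + j) div K}) \<le> (card P)\<^sup>2"
    by linarith
qed

section \<open>Partition of the lines by bands\<close>

context
  fixes P :: "(real \<times> real) set" and line :: "nat \<Rightarrow> real \<times> real" and T K v j :: nat
  assumes finite_P: "finite P" and sorted: "\<And>s t. s \<le> t \<Longrightarrow> t < T \<Longrightarrow> fst (line s) \<le> fst (line t)"
    and inj_line: "inj_on line {..<T}" and K: "K > 0" and v: "v > 0"
begin

definition band :: "nat \<Rightarrow> real \<times> real \<Rightarrow> nat" where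
  "band t q = (point_rank P (fst (line t)) q + j) div K"

definition visits :: "nat \<Rightarrow> nat \<Rightarrow> bool" where
  "visits i t \<longleftrightarrow> (\<exists>q\<in>P. incident (line t) q \<and> band t q = i)"

definition visit_count :: "nat \<Rightarrow> nat \<Rightarrow> nat" where
  "visit_count i t = card {s. s < t \<and> visits i s}"

definition block :: "nat \<Rightarrow> nat \<Rightarrow> nat" where
  "block i t = visit_count i t div v"

text \<open>The state of a point is followed through all lines in slope order, not only through
  those incident to it. A line of index \<open>t\<close> through \<open>q\<close> belongs to the
  piece \<open>state t q\<close>, so a state that stays constant from one such line to another puts
  both in the same piece.\<close>

definition state :: "nat \<Rightarrow> real \<times> real \<Rightarrow> nat \<times> nat" where
  "state t q = (band t q, block (band t q) t)"

definition piece :: "nat \<times> nat \<Rightarrow> (real \<times> real) set" where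
  "piece d = line ` {t. t < T \<and> visits (fst d) t \<and> block (fst d) t = snd d}"

definition bands :: "nat set" where
  "bands = (\<lambda>(t, q). band t q) ` ({..<T} \<times> P)"

lemma finite_bands: "finite bands"
  using finite_P by (simp add: bands_def)

lemma band_mem: "t < T \<Longrightarrow> q \<in> P \<Longrightarrow> band t q \<in> bands"
  unfolding bands_def by force

lemma visits_mem: "t < T \<Longrightarrow> visits i t \<Longrightarrow> i \<in> bands"
  unfolding visits_def using band_mem by blast

lemma mono_visit_count: "mono (visit_count i)"
  unfolding visit_count_def by (intro monoI card_mono) auto

lemma visit_count_less:
  assumes "visits i s" "s < t" shows "visit_count i s < visit_count i t"
proof -
  have "{r. r < s \<and> visits i r} \<subset> {r. r < t \<and> visits i r}" using assms by auto
  then show ?thesis unfolding visit_count_def by (intro psubset_card_mono) auto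
qed

lemma visit_count_le: "visit_count i t \<le> t"
proof -
  have "visit_count i t \<le> card {..<t}" unfolding visit_count_def by (intro card_mono) auto
  then show ?thesis by simp
qed

lemma block_le: "t \<le> T \<Longrightarrow> block i t \<le> T"
  unfolding block_def using visit_count_le[of i t] div_le_dividend[of "visit_count i t" v] by linarith

lemma finite_piece: "finite (piece d)"
  by (simp add: piece_def)

lemma card_piece: "card (piece d) \<le> v"
proof -
  obtain i a where d: "d = (i, a)" by (cases d)
  let ?I = "{t. t < T \<and> visits i t \<and> block i t = a}"
  have "card ?I \<le> card {a * v..<a * v + v}"
  proof (rule card_inj_on_le)
    show "inj_on (visit_count i) ?I"
      by (rule linorder_inj_onI') (use visit_count_less in fastforce)
    show "visit_count i ` ?I \<subseteq> {a * v..<a * v + v}"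
    proof (rule image_subsetI)
      fix t assume "t \<in> ?I"
      then have "visit_count i t div v = a" by (simp add: block_def)
      then show "visit_count i t \<in> {a * v..<a * v + v}"
        using div_mult_mod_eq[of "visit_count i t" v] mod_less_divisor[OF v, of "visit_count i t"]
        by (metis add_less_cancel_left atLeastLessThan_iff le_add1)
    qed
  qed simp
  then have "card ?I \<le> v" by simp
  moreover have "card (piece d) \<le> card ?I" unfolding piece_def d by (simp add: card_image_le)
  ultimately show ?thesis by linarith
qed

lemma sum_card_piece: "(\<Sum>d\<in>bands \<times> {..T}. card (piece d)) \<le> (\<Sum>i\<in>bands. visit_count i T)"
proof -
  have "(\<Sum>d\<in>bands \<times> {..T}. card (piece d)) = (\<Sum>i\<in>bands. \<Sum>a\<le>T. card (piece (i, a)))"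
    by (simp add: sum.cartesian_product)
  also have "\<dots> \<le> (\<Sum>i\<in>bands. visit_count i T)"
  proof (rule sum_mono)
    fix i
    let ?A = "{t. t < T \<and> visits i t}"
    have "(\<Sum>a\<le>T. card (piece (i, a))) \<le> (\<Sum>a\<le>T. \<Sum>t\<in>{t. t \<in> ?A \<and> block i t = a}. 1)"
    proof (rule sum_mono)
      fix a
      have "card (piece (i, a)) \<le> card {t. t < T \<and> visits i t \<and> block i t = a}"
        unfolding piece_def by (simp add: card_image_le)
      then show "card (piece (i, a)) \<le> (\<Sum>t\<in>{t. t \<in> ?A \<and> block i t = a}. 1)" by (simp add: conj_assoc)
    qed
    also have "\<dots> = (\<Sum>t\<in>?A. 1)"
      by (rule sum.group) (use block_le in \<open>auto simp: less_imp_le\<close>)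
    finally show "(\<Sum>a\<le>T. card (piece (i, a))) \<le> visit_count i T" by (simp add: visit_count_def)
  qed
  finally show ?thesis .
qed

text \<open>At the slope of a line, its points share one dual value and therefore have consecutive
  ranks. They fill all bands in between except possibly the two extreme ones, whence the term
  \<open>2 * K\<close>.\<close>

lemma card_bands_of_line:
  "K * card {i. visits i t} \<le> card {q \<in> P. incident (line t) q} + 2 * K"
proof -
  let ?D = "{q \<in> P. incident (line t) q}" and ?r = "point_rank P (fst (line t))"
  have fD: "finite ?D" using finite_P by simp
  have v: "{i. visits i t} = band t ` ?D" by (auto simp: visits_def)
  show ?thesis
  proof (cases "?D = {}")
    case True
    show ?thesis unfolding v True by simp
  next
    case False
    define r0 where "r0 = Min (?r ` ?D)"
    define r1 where "r1 = Max (?r ` ?D)"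
    have "r0 \<in> ?r ` ?D" "r1 \<in> ?r ` ?D" using fD False by (simp_all add: r0_def r1_def)
    then obtain q0 q1 where q: "q0 \<in> ?D" "?r q0 = r0" "q1 \<in> ?D" "?r q1 = r1" by blast
    have between: "r0 \<le> ?r q" "?r q \<le> r1" if "q \<in> ?D" for q using that fD by (simp_all add: r0_def r1_def)
    have dv: "incident (line t) q \<longleftrightarrow> dual_value (fst (line t)) q = snd (line t)" for q
      by (auto simp: incident_def dual_value_def)
    have "{r0..r1} \<subseteq> ?r ` ?D"
    proof
      fix r assume r: "r \<in> {r0..r1}"
      have "r1 < card P" using q(3,4) point_rank_less_card[OF finite_P, of q1 "fst (line t)"] by simp
      then have "r \<in> ?r ` P" using point_rank_image[OF finite_P] r by auto
      then obtain p where p: "p \<in> P" "?r p = r" by blast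
      have "dual_value (fst (line t)) q0 \<le> dual_value (fst (line t)) p"
      proof (cases "r0 = r")
        case True
        then have "p = q0" using inj_onD[OF inj_on_point_rank[OF finite_P, of "fst (line t)"], of p q0] p q by simp
        then show ?thesis by simp
      next
        case False
        then have "before (fst (line t)) q0 p" using before_if_rank_less[OF finite_P p(1)] p q r by simp
        then show ?thesis by (auto simp: before_def)
      qed
      moreover have "dual_value (fst (line t)) p \<le> dual_value (fst (line t)) q1"
      proof (cases "r1 = r")
        case True
        then have "p = q1" using inj_onD[OF inj_on_point_rank[OF finite_P, of "fst (line t)"], of p q1] p q by simp
        then show ?thesis by simp
      next
        case False
        then have "before (fst (line t)) p q1" using before_if_rank_less[OF finite_P, of q1] p q r by simp
        then show ?thesis by (auto simp: before_def)
      qed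
      ultimately have "p \<in> ?D" using q p by (auto simp: dv)
      then show "r \<in> ?r ` ?D" using p by blast
    qed
    then have "card {r0..r1} \<le> card ?D"
      using fD by (meson card_image_le card_mono finite_imageI order_trans)
    then have len: "r1 + 1 - r0 \<le> card ?D" by simp
    have "band t ` ?D \<subseteq> {(r0 + j) div K..(r1 + j) div K}"
      using between by (auto simp: band_def intro!: div_le_mono)
    then have "card (band t ` ?D) \<le> (r1 + j) div K + 1 - (r0 + j) div K"
      using card_mono[of "{(r0 + j) div K..(r1 + j) div K}" "band t ` ?D"] by simp
    then have "K * card (band t ` ?D) \<le> K * ((r1 + j) div K + 1 - (r0 + j) div K)" by (rule mult_le_mono2)
    also have "\<dots> = K * ((r1 + j) div K) + K - K * ((r0 + j) div K)" by (simp add: diff_mult_distrib2)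
    also have "\<dots> \<le> r1 + j + K - (r0 + j - K)"
    proof -
      have "K * ((r1 + j) div K) \<le> r1 + j" by simp
      moreover have "r0 + j - K \<le> K * ((r0 + j) div K)"
        using mult_div_mod_eq[of K "r0 + j"] mod_less_divisor[OF K, of "r0 + j"] by linarith
      ultimately show ?thesis by linarith
    qed
    also have "\<dots> \<le> r1 - r0 + 2 * K" by linarith
    also have "\<dots> \<le> card ?D + 2 * K" using len by linarith
    finally show ?thesis unfolding v .
  qed
qed

text \<open>Two points determine a line, so at most \<open>(card P)\<^sup>2\<close> ordered pairs of
  distinct points lie on common lines. This elementary bound suffices, since the number of visits is
  the number of incidences divided by about \<open>K\<close>.\<close>

lemma sum_incidences:
  "K * (\<Sum>t<T. card {q \<in> P. incident (line t) q}) \<le> K\<^sup>2 * T + (card P)\<^sup>2"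
proof -
  let ?D = "\<lambda>t. {q \<in> P. incident (line t) q}"
  have fD: "finite (?D t)" for t using finite_P by simp
  have "(\<Sum>t<T. card (?D t) * (card (?D t) - 1)) = card (Sigma {..<T} (\<lambda>t. Sigma (?D t) (\<lambda>q. ?D t - {q})))"
    using fD by simp
  also have "\<dots> \<le> card (P \<times> P)"
  proof (rule card_inj_on_le)
    show "inj_on snd (Sigma {..<T} (\<lambda>t. Sigma (?D t) (\<lambda>q. ?D t - {q})))"
    proof (rule inj_onI)
      fix x y assume x: "x \<in> Sigma {..<T} (\<lambda>t. Sigma (?D t) (\<lambda>q. ?D t - {q}))"
        and y: "y \<in> Sigma {..<T} (\<lambda>t. Sigma (?D t) (\<lambda>q. ?D t - {q}))" and eq: "snd x = snd y"
      obtain s t p q where xy: "x = (s, p, q)" "y = (t, p, q)" using eq by (cases x, cases y) auto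
      have "line s = line t" by (rule incident_two_points[of _ p q]) (use x y xy in auto)
      then have "s = t" using inj_onD[OF inj_line] x y xy by auto
      then show "x = y" using xy by simp
    qed
  qed (use finite_P in auto)
  finally have pairs: "(\<Sum>t<T. card (?D t) * (card (?D t) - 1)) \<le> (card P)\<^sup>2"
    by (simp add: card_cartesian_product power2_eq_square)
  \<comment> \<open>A line with at most \<open>K\<close> points costs at most
    \<open>K\<^sup>2\<close>; on a richer line, \<open>K\<close> is at most
    \<open>d - 1\<close>.\<close>
  have "K * d \<le> K\<^sup>2 + d * (d - 1)" for d
  proof (cases "d \<le> K")
    case True
    then have "K * d \<le> K * K" by (rule mult_le_mono2)
    then show ?thesis unfolding power2_eq_square by (rule trans_le_add1)
  next
    case False
    then have "K * d \<le> (d - 1) * d" by (intro mult_le_mono1) simp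
    also have "\<dots> = d * (d - 1)" by (rule mult.commute)
    finally show ?thesis by (rule trans_le_add2)
  qed
  then have "(\<Sum>t<T. K * card (?D t)) \<le> (\<Sum>t<T. K\<^sup>2 + card (?D t) * (card (?D t) - 1))" by (intro sum_mono)
  also have "\<dots> \<le> K\<^sup>2 * T + (card P)\<^sup>2" using pairs by (simp add: sum.distrib mult.commute)
  finally show ?thesis by (simp add: sum_distrib_left)
qed

text \<open>A line visits about two bands plus one for every \<open>K\<close> of its points. After
  division by \<open>K\<^sup>2\<close> the bound is linear in the number of lines as soon as
  \<open>(card P)\<^sup>2\<close> is at most of order \<open>K\<^sup>2 * T\<close>.\<close>

lemma sum_visit_count:
  "K\<^sup>2 * (\<Sum>i\<in>bands. visit_count i T) \<le> 3 * K\<^sup>2 * T + (card P)\<^sup>2"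
proof -
  have "(\<Sum>i\<in>bands. visit_count i T) = (\<Sum>i\<in>bands. \<Sum>t<T. of_bool (visits i t))"
    by (simp add: visit_count_def Int_def)
  also have "\<dots> = (\<Sum>t<T. \<Sum>i\<in>bands. of_bool (visits i t))" by (rule sum.swap)
  also have "\<dots> = (\<Sum>t<T. card {i. visits i t})"
  proof (rule sum.cong)
    fix t assume "t \<in> {..<T}"
    then have "{i. i \<in> bands \<and> visits i t} = {i. visits i t}" using visits_mem by auto
    then show "(\<Sum>i\<in>bands. of_bool (visits i t)) = card {i. visits i t}"
      using finite_bands by (simp add: Int_def)
  qed simp
  finally have "K\<^sup>2 * (\<Sum>i\<in>bands. visit_count i T) = K * (\<Sum>t<T. K * card {i. visits i t})"
    by (simp add: power2_eq_square sum_distrib_left mult.assoc)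
  also have "\<dots> \<le> K * (\<Sum>t<T. card {q \<in> P. incident (line t) q} + 2 * K)"
    by (intro mult_le_mono2 sum_mono card_bands_of_line)
  also have "\<dots> = K * (\<Sum>t<T. card {q \<in> P. incident (line t) q}) + 2 * K\<^sup>2 * T"
    by (simp add: sum.distrib distrib_left power2_eq_square)
  also have "\<dots> \<le> K\<^sup>2 * T + (card P)\<^sup>2 + 2 * K\<^sup>2 * T" using sum_incidences by (rule add_right_mono)
  also have "\<dots> = 3 * K\<^sup>2 * T + (card P)\<^sup>2" by (simp add: algebra_simps)
  finally show ?thesis .
qed

lemma band_occupancy: "card {q \<in> P. band t q = i} \<le> K"
proof -
  let ?r = "\<lambda>q. point_rank P (fst (line t)) q + j"
  have "card {q \<in> P. band t q = i} \<le> card {i * K..<i * K + K}"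
  proof (rule card_inj_on_le)
    have "inj_on ?r P" using inj_on_point_rank[OF finite_P] by (simp add: inj_on_def)
    then show "inj_on ?r {q \<in> P. band t q = i}" by (rule inj_on_subset) auto
    show "?r ` {q \<in> P. band t q = i} \<subseteq> {i * K..<i * K + K}"
    proof (rule image_subsetI)
      fix q assume "q \<in> {q \<in> P. band t q = i}"
      then have "?r q div K = i" by (simp add: band_def)
      then show "?r q \<in> {i * K..<i * K + K}"
        using div_mult_mod_eq[of "?r q" K] mod_less_divisor[OF K, of "?r q"]
        by (metis add_less_cancel_left atLeastLessThan_iff le_add1)
    qed
  qed simp
  then show ?thesis by simp
qed

definition band_changes :: "(nat \<times> (real \<times> real)) set" where
  "band_changes = {(t, q). t < T - 1 \<and> q \<in> P \<and> band (Suc t) q \<noteq> band t q}"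

definition state_changes :: "(nat \<times> (real \<times> real)) set" where
  "state_changes = {(t, q). t < T - 1 \<and> q \<in> P \<and> state (Suc t) q \<noteq> state t q}"

text \<open>A state changes because the point leaves its band or because its band starts a new
  block. The second event affects at most the \<open>K\<close> points in the band and happens at
  most once per \<open>v\<close> visits.\<close>

lemma card_state_changes:
  "v * card state_changes \<le> v * card band_changes + K * (\<Sum>i\<in>bands. visit_count i T)"
proof -
  let ?jumps = "\<lambda>i. {t. t < T - 1 \<and> block i (Suc t) \<noteq> block i t}"
  let ?B = "\<Union>i\<in>bands. Sigma (?jumps i) (\<lambda>t. {q \<in> P. band t q = i})"
  have fb: "finite band_changes" using finite_P by (rule_tac finite_subset[of _ "{..<T} \<times> P"]) (auto simp: band_changes_def)
  have fB: "finite ?B" using finite_P finite_bands by auto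
  have "state_changes \<subseteq> band_changes \<union> ?B"
    by (auto simp: state_changes_def band_changes_def state_def intro!: band_mem)
  then have "card state_changes \<le> card (band_changes \<union> ?B)" using fb fB by (intro card_mono) auto
  also have "\<dots> \<le> card band_changes + card ?B" by (rule card_Un_le)
  finally have 1: "card state_changes \<le> card band_changes + card ?B" .
  have jumps: "v * card (?jumps i) \<le> visit_count i T" for i
  proof -
    have "mono (block i)" unfolding block_def using mono_visit_count by (auto simp: mono_def intro: div_le_mono)
    then have "card (?jumps i) \<le> block i (T - 1)" by (rule card_jumps_le)
    then have "v * card (?jumps i) \<le> v * (visit_count i (T - 1) div v)" by (simp add: block_def)
    also have "\<dots> \<le> visit_count i (T - 1)" by simp
    also have "\<dots> \<le> visit_count i T" using mono_visit_count by (simp add: mono_def)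
    finally show ?thesis .
  qed
  have "card ?B \<le> (\<Sum>i\<in>bands. card (Sigma (?jumps i) (\<lambda>t. {q \<in> P. band t q = i})))"
    by (rule card_UN_le[OF finite_bands])
  also have "\<dots> \<le> (\<Sum>i\<in>bands. K * card (?jumps i))"
  proof (rule sum_mono)
    fix i
    have "card (Sigma (?jumps i) (\<lambda>t. {q \<in> P. band t q = i})) = (\<Sum>t\<in>?jumps i. card {q \<in> P. band t q = i})"
      using finite_P by simp
    also have "\<dots> \<le> (\<Sum>t\<in>?jumps i. K)" by (intro sum_mono band_occupancy)
    finally show "card (Sigma (?jumps i) (\<lambda>t. {q \<in> P. band t q = i})) \<le> K * card (?jumps i)" by (simp add: mult.commute)
  qed
  finally have "v * card ?B \<le> v * (\<Sum>i\<in>bands. K * card (?jumps i))" by (rule mult_le_mono2)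
  also have "\<dots> = K * (\<Sum>i\<in>bands. v * card (?jumps i))" by (simp add: sum_distrib_left mult_ac)
  also have "\<dots> \<le> K * (\<Sum>i\<in>bands. visit_count i T)" by (intro mult_le_mono2 sum_mono jumps)
  finally have "v * card ?B \<le> K * (\<Sum>i\<in>bands. visit_count i T)" .
  moreover have "v * card state_changes \<le> v * card band_changes + v * card ?B"
    using mult_le_mono2[OF 1, of v] by (simp add: distrib_left)
  ultimately show ?thesis by linarith
qed

section \<open>Incidences whose state survives until a later line\<close>

context
  fixes J :: "((real \<times> real) \<times> (real \<times> real)) set"
  assumes J: "\<And>l p. (l, p) \<in> J \<Longrightarrow> l \<in> line ` {..<T} \<and> p \<in> P \<and> incident l p"
begin

definition stable :: "nat \<Rightarrow> real \<times> real \<Rightarrow> nat \<Rightarrow> bool" where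
  "stable t p s \<longleftrightarrow> t < s \<and> s < T \<and> (line s, p) \<in> J \<and> (\<forall>c\<in>{t..s}. state c p = state t p)"

definition piece_incidences :: "nat \<times> nat \<Rightarrow> ((real \<times> real) \<times> (real \<times> real)) set" where
  "piece_incidences d = {(line t, p) | t p. t < T \<and> (line t, p) \<in> J \<and> state t p = d \<and> (\<exists>s. stable t p s)}"

lemma piece_incidencesI:
  "t < T \<Longrightarrow> (line t, p) \<in> J \<Longrightarrow> stable t p s \<Longrightarrow> (line t, p) \<in> piece_incidences (state t p)"
  unfolding piece_incidences_def by blast

lemma piece_incidencesE:
  assumes "(l, p) \<in> piece_incidences d"
  obtains t s where "l = line t" "t < T" "(line t, p) \<in> J" "state t p = d" "stable t p s"
  using assms unfolding piece_incidences_def by auto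

lemma finite_J: "finite J"
  by (rule finite_subset[of _ "line ` {..<T} \<times> P"]) (use J finite_P in auto)

lemma piece_incidences_subset: "piece_incidences d \<subseteq> J"
  by (auto simp: piece_incidences_def)

lemma mem_piece:
  assumes "t < T" "(line t, p) \<in> J" "state t p = d" shows "line t \<in> piece d"
proof -
  have "visits (fst d) t" "block (fst d) t = snd d"
    using J[OF assms(2)] assms(3) by (auto simp: visits_def state_def)
  then show ?thesis using assms(1) by (auto simp: piece_def)
qed

lemma slope_less:
  assumes "(line s, p) \<in> J" "(line t, p) \<in> J" "s < t" "t < T"
  shows "fst (line s) < fst (line t)"
proof -
  have "line s \<noteq> line t" using inj_onD[OF inj_line, of s t] assms by auto
  then have "fst (line s) \<noteq> fst (line t)" using incident_unique J assms by blast
  then show ?thesis using sorted[of s t] assms by simp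
qed

text \<open>If \<open>k\<close> comes no later than the line \<open>s\<close> witnessing stability,
  the state is still the same at \<open>k\<close>, so \<open>k\<close> itself is in the piece;
  otherwise \<open>s\<close> serves. Thus the segment inside the piece never extends beyond the next
  line of \<open>J\<close> through \<open>p\<close>.\<close>

lemma piece_successor:
  assumes "(l, p) \<in> piece_incidences d" "(k, p) \<in> J" "fst l < fst k"
  shows "\<exists>k'\<in>piece d. incident k' p \<and> fst l < fst k' \<and> fst k' \<le> fst k"
proof -
  obtain t s where t: "l = line t" "t < T" "(line t, p) \<in> J" "state t p = d" "stable t p s"
    using assms(1) by (rule piece_incidencesE)
  obtain r where r: "k = line r" "r < T" using J[OF assms(2)] by auto
  have "t < r"
  proof (rule ccontr)
    assume "\<not> t < r"
    then have "fst (line r) \<le> fst (line t)" using sorted t by simp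
    then show False using assms t r by simp
  qed
  have s: "t < s" "s < T" "(line s, p) \<in> J" "state c p = d" if "t \<le> c" "c \<le> s" for c
    using t(4,5) that by (auto simp: stable_def)
  have *: ?thesis if c: "t < c" "c \<le> s" "c \<le> r" "(line c, p) \<in> J" for c
  proof (rule bexI)
    have "c < T" using c r by simp
    then show "line c \<in> piece d" using c s(4)[of c] by (intro mem_piece[of _ p]) auto
    show "incident (line c) p \<and> fst l < fst (line c) \<and> fst (line c) \<le> fst k"
      using J[OF c(4)] slope_less[OF t(3) c(4)] c \<open>c < T\<close> t r sorted[of c r] by auto
  qed
  show ?thesis
  proof (cases "r \<le> s")
    case True
    then show ?thesis using *[of r] \<open>t < r\<close> assms(2) r by simp
  next
    case False
    then show ?thesis using *[of s] t(5) by (simp add: stable_def)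
  qed
qed

lemma extendable_piece: "extendable (piece d) (piece_incidences d)"
  unfolding extendable_def
proof (intro conjI ballI)
  show "finite (piece d)" by (rule finite_piece)
  show "finite (piece_incidences d)" using finite_J piece_incidences_subset by (rule rev_finite_subset)
  fix x assume x: "x \<in> piece_incidences d"
  obtain l p where lp: "x = (l, p)" by (cases x)
  obtain t s where t: "l = line t" "t < T" "(line t, p) \<in> J" "state t p = d" "stable t p s"
    using x unfolding lp by (rule piece_incidencesE)
  have "l \<in> piece d" "incident l p" using mem_piece t J by auto
  moreover have "\<exists>k\<in>piece d. incident k p \<and> fst l < fst k"
    using piece_successor[of l p d "line s"] x lp t slope_less[of t p s] by (auto simp: stable_def)
  ultimately show "case x of (l, p) \<Rightarrow> l \<in> piece d \<and> incident l p \<and> (\<exists>k\<in>piece d. incident k p \<and> fst l < fst k)"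
    using lp by simp
qed

text \<open>At each point, \<open>card_unstable_le\<close> bounds the lost incidences by one plus
  the number of state changes; the ones add up to \<open>card P\<close>.\<close>

lemma card_le_piece_incidences:
  "card J \<le> card (\<Union>d\<in>bands \<times> {..T}. piece_incidences d) + card P + card state_changes"
proof -
  let ?A = "\<lambda>p. {t. t < T \<and> (line t, p) \<in> J}"
  let ?U = "\<lambda>p. {a \<in> ?A p. \<not> (\<exists>b\<in>?A p. a < b \<and> (\<forall>c\<in>{a..b}. state c p = state a p))}"
  let ?G = "\<Union>d\<in>bands \<times> {..T}. piece_incidences d"
  let ?W = "(\<lambda>(p, t). (line t, p)) ` Sigma P ?U"
  have fW: "finite ?W" using finite_P by auto
  have "J \<subseteq> ?G \<union> ?W"
  proof
    fix x assume x: "x \<in> J"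
    obtain l p where lp: "x = (l, p)" by (cases x)
    then obtain t where t: "l = line t" "t < T" "p \<in> P" using J x by blast
    show "x \<in> ?G \<union> ?W"
    proof (cases "t \<in> ?U p")
      case True
      then have "(p, t) \<in> Sigma P ?U" using t(3) by (rule_tac SigmaI)
      then have "(line t, p) \<in> ?W" by (rule rev_image_eqI) simp
      then show ?thesis using lp t(1) by simp
    next
      case False
      then obtain s where "stable t p s" using t x lp by (auto simp: stable_def)
      then have "x \<in> piece_incidences (state t p)" using t x lp piece_incidencesI by simp
      moreover have "state t p \<in> bands \<times> {..T}" using band_mem t block_le by (auto simp: state_def)
      ultimately show ?thesis by (intro UnI1 UN_I)
    qed
  qed
  moreover have "finite ?G" by (rule finite_subset[OF _ finite_J]) (use piece_incidences_subset in blast)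
  ultimately have "card J \<le> card (?G \<union> ?W)" using fW by (intro card_mono) auto
  also have "\<dots> \<le> card ?G + card ?W" by (rule card_Un_le)
  finally have 1: "card J \<le> card ?G + card ?W" .
  have "card ?W \<le> card (Sigma P ?U)" using finite_P by (intro card_image_le) auto
  also have "\<dots> = (\<Sum>p\<in>P. card (?U p))" using finite_P by simp
  also have "\<dots> \<le> (\<Sum>p\<in>P. 1 + card {t. t < T - 1 \<and> state (Suc t) p \<noteq> state t p})"
  proof (rule sum_mono)
    fix p
    have "t \<le> T - 1" if "t \<in> ?A p" for t using that by auto
    then show "card (?U p) \<le> 1 + card {t. t < T - 1 \<and> state (Suc t) p \<noteq> state t p}"
      by (intro card_unstable_le[where s = "\<lambda>t. state t p"]) simp_all
  qed
  also have "\<dots> = card P + (\<Sum>p\<in>P. card {t. t < T - 1 \<and> state (Suc t) p \<noteq> state t p})" by (subst sum.distrib) simp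
  also have "(\<Sum>p\<in>P. card {t. t < T - 1 \<and> state (Suc t) p \<noteq> state t p})
      = card (Sigma P (\<lambda>p. {t. t < T - 1 \<and> state (Suc t) p \<noteq> state t p}))" using finite_P by simp
  also have "\<dots> = card state_changes"
  proof (rule bij_betw_same_card)
    show "bij_betw prod.swap (Sigma P (\<lambda>p. {t. t < T - 1 \<and> state (Suc t) p \<noteq> state t p})) state_changes"
      unfolding bij_betw_def by (intro conjI inj_onI) (auto simp: state_changes_def image_iff)
  qed
  finally show ?thesis using 1 by linarith
qed

lemma partition_exists:
  assumes offset: "K * card {(t, q). t < T - 1 \<and> q \<in> P \<and>
      (point_rank P (fst (line (Suc t))) q + j) div K \<noteq> (point_rank P (fst (line t)) q + j) div K} \<le> (card P)\<^sup>2"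
  shows "\<exists>(D :: (nat \<times> nat) set) R H (U :: real). finite D \<and>
    (\<forall>d\<in>D. R d \<subseteq> line ` {..<T} \<and> card (R d) \<le> v \<and> H d \<subseteq> J \<and> extendable (R d) (H d) \<and>
      (\<forall>l p k. (l, p) \<in> H d \<longrightarrow> (k, p) \<in> J \<longrightarrow> fst l < fst k \<longrightarrow>
        (\<exists>k'\<in>R d. incident k' p \<and> fst l < fst k' \<and> fst k' \<le> fst k))) \<and>
    (\<Sum>d\<in>D. real (card (R d))) \<le> U \<and> U \<le> 3 * T + (card P)\<^sup>2 / K\<^sup>2 \<and>
    real (card J) \<le> real (card (\<Union>d\<in>D. H d)) + card P + (card P)\<^sup>2 / K + K * U / v"
proof -
  \<comment> \<open>The total number of visits is the witness for \<open>U\<close>: it bounds both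
    the total size of the pieces and the interruptions caused by new blocks.\<close>
  define V where "V = (\<Sum>i\<in>bands. visit_count i T)"
  have KV: "real K * real V / v = real (K * V) / v" by simp
  have "v * card state_changes \<le> v * card band_changes + K * V" unfolding V_def by (rule card_state_changes)
  then have "real (v * card state_changes) \<le> real (v * card band_changes + K * V)" by (rule of_nat_mono)
  then have 1: "real (card state_changes) \<le> real (card band_changes) + K * V / v" using v by (simp add: field_simps)
  have "real (K * card band_changes) \<le> real ((card P)\<^sup>2)"
    using offset unfolding band_changes_def band_def by (rule of_nat_mono)
  then have 2: "real (card band_changes) \<le> (card P)\<^sup>2 / K" using K by (simp add: field_simps)
  have "real (K\<^sup>2 * V) \<le> real (3 * K\<^sup>2 * T + (card P)\<^sup>2)" unfolding V_def using sum_visit_count by (rule of_nat_mono)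
  then have 3: "real V \<le> 3 * T + (card P)\<^sup>2 / K\<^sup>2" using K by (simp add: field_simps)
  have 4: "(\<Sum>d\<in>bands \<times> {..T}. real (card (piece d))) \<le> V"
    using of_nat_mono[OF sum_card_piece, where 'a = real] by (simp add: V_def)
  have 5: "real (card J) \<le> real (card (\<Union>d\<in>bands \<times> {..T}. piece_incidences d)) + card P + card state_changes"
    using of_nat_mono[OF card_le_piece_incidences, where 'a = real] by simp
  show ?thesis
  proof (intro exI conjI ballI allI impI)
    show "finite (bands \<times> {..T})" using finite_bands by simp
    show "(\<Sum>d\<in>bands \<times> {..T}. real (card (piece d))) \<le> real V" by (rule 4)
    show "real V \<le> 3 * T + (card P)\<^sup>2 / K\<^sup>2" by (rule 3)
    show "real (card J) \<le> real (card (\<Union>d\<in>bands \<times> {..T}. piece_incidences d)) + card P + (card P)\<^sup>2 / K + K * real V / v"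
      using 1 2 5 KV by linarith
    fix d
    show "piece d \<subseteq> line ` {..<T}" by (auto simp: piece_def)
    show "card (piece d) \<le> v" by (rule card_piece)
    show "piece_incidences d \<subseteq> J" by (rule piece_incidences_subset)
    show "extendable (piece d) (piece_incidences d)" by (rule extendable_piece)
    show "\<exists>k'\<in>piece d. incident k' p \<and> fst l < fst k' \<and> fst k' \<le> fst k"
      if "(l, p) \<in> piece_incidences d" "(k, p) \<in> J" "fst l < fst k" for l p k
      using that by (rule piece_successor)
  qed
qed

end
end

theorem slope_partition:
  fixes L P :: "(real \<times> real) set" and K v :: nat
  assumes "finite L" and P: "finite P" and J_sub: "J \<subseteq> {(l, p). l \<in> L \<and> p \<in> P \<and> incident l p}"
    and K: "K > 0" and v: "v > 0"
  shows "\<exists>(D :: (nat \<times> nat) set) R H (U :: real). finite D \<and>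
    (\<forall>d\<in>D. R d \<subseteq> L \<and> card (R d) \<le> v \<and> H d \<subseteq> J \<and> extendable (R d) (H d) \<and>
      (\<forall>l p k. (l, p) \<in> H d \<longrightarrow> (k, p) \<in> J \<longrightarrow> fst l < fst k \<longrightarrow>
        (\<exists>k'\<in>R d. incident k' p \<and> fst l < fst k' \<and> fst k' \<le> fst k))) \<and>
    (\<Sum>d\<in>D. real (card (R d))) \<le> U \<and> U \<le> 3 * card L + (card P)\<^sup>2 / K\<^sup>2 \<and>
    real (card J) \<le> real (card (\<Union>d\<in>D. H d)) + card P + (card P)\<^sup>2 / K + K * U / v"
proof -
  have J: "l \<in> L \<and> p \<in> P \<and> incident l p" if "(l, p) \<in> J" for l p using J_sub that by auto
  obtain xs where "set xs = L" "distinct xs" using finite_distinct_list[OF assms(1)] by blast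
  \<comment> \<open>Lines of equal slope may come in any order: distinct parallel lines have no
    point in common, so at each point the slopes still increase strictly.\<close>
  then obtain ls where ls: "set ls = L" "distinct ls" "List.sorted (map fst ls)"
    by (metis distinct_sort set_sort sorted_sort_key)
  define T where "T = length ls"
  have T: "card L = T" using ls by (metis T_def distinct_card)
  have im: "(!) ls ` {..<T} = L" using ls(1) by (auto simp: T_def set_conv_nth)
  have srt: "fst (ls ! s) \<le> fst (ls ! t)" if "s \<le> t" "t < T" for s t
    using sorted_nth_mono[OF ls(3) that(1)] that by (simp add: T_def)
  have inj: "inj_on ((!) ls) {..<T}" using ls(2) by (simp add: T_def inj_on_def nth_eq_iff_index_eq)
  obtain j where "K * card {(t, q). t < T - 1 \<and> q \<in> P \<and>
      (point_rank P (fst (ls ! Suc t)) q + j) div K \<noteq> (point_rank P (fst (ls ! t)) q + j) div K} \<le> (card P)\<^sup>2"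
    using exists_offset[OF P, of "T - 1" "\<lambda>t. fst (ls ! t)" K] srt K by auto
  from partition_exists[where line = "(!) ls" and J = J, OF P srt inj K v _ this] J
  show ?thesis unfolding im T by blast
qed

section \<open>Wedges with many points\<close>

text \<open>The double wedge at \<open>p\<close> between the slopes \<open>m\<close> and
  \<open>s\<close> in the upward order of slopes, hence free of the vertical direction. The
  condition on first coordinates rules out the default value that division by zero would give to
  \<open>slope\<close>.\<close>

definition rich_wedge :: "(real \<times> real) set \<Rightarrow> (real \<times> real) set \<Rightarrow> real \<Rightarrow> real \<Rightarrow> real \<times> real \<Rightarrow> real \<Rightarrow> real \<Rightarrow> bool" where
  "rich_wedge L P v t p m s \<longleftrightarrow> (\<exists>Q R. Q \<subseteq> P \<and> R \<subseteq> L \<and> real (card R) \<le> v \<and> t < real (card Q) \<and>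
     (\<forall>q\<in>Q. fst p \<noteq> fst q \<and> m < slope p q \<and> slope p q < s \<and>
       (\<exists>r\<in>R. \<exists>r'\<in>R. r \<noteq> r' \<and> incident r q \<and> incident r' q)))"

text \<open>In every piece the incidences whose segments have at most \<open>t\<close> crossers are
  discarded, at a cost of \<open>12 * U * sqrt t\<close> in total. The slope \<open>s\<close>
  belongs to the next line within the piece; that line need not come from \<open>J\<close>, but it
  is not steeper than the next one that does.\<close>

lemma many_rich_wedges:
  fixes L P :: "(real \<times> real) set" and K v :: nat and t :: real
  assumes L: "finite L" and P: "finite P" and J_sub: "J \<subseteq> {(l, p). l \<in> L \<and> p \<in> P \<and> incident l p}"
    and K: "K > 0" and v: "v > 0" and t: "1 \<le> t"
  shows "\<exists>G (U :: real). G \<subseteq> J \<and> U \<le> 3 * card L + (card P)\<^sup>2 / K\<^sup>2 \<and>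
    real (card J) \<le> card G + card P + (card P)\<^sup>2 / K + K * U / v + 12 * U * sqrt t \<and>
    (\<forall>l p. (l, p) \<in> G \<longrightarrow> (\<exists>s. fst l < s \<and> (\<forall>k. (k, p) \<in> J \<longrightarrow> fst l < fst k \<longrightarrow> s \<le> fst k) \<and>
       rich_wedge L P v t p (fst l) s))"
proof -
  have J: "l \<in> L \<and> p \<in> P \<and> incident l p" if "(l, p) \<in> J" for l p using J_sub that by auto
  obtain D :: "(nat \<times> nat) set" and R H and U :: real where fD: "finite D"
    and D: "\<And>d. d \<in> D \<Longrightarrow> R d \<subseteq> L \<and> card (R d) \<le> v \<and> H d \<subseteq> J \<and> extendable (R d) (H d)"
    and succ: "\<And>d l p k. d \<in> D \<Longrightarrow> (l, p) \<in> H d \<Longrightarrow> (k, p) \<in> J \<Longrightarrow> fst l < fst k \<Longrightarrow>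
        \<exists>k'\<in>R d. incident k' p \<and> fst l < fst k' \<and> fst k' \<le> fst k"
    and U: "(\<Sum>d\<in>D. real (card (R d))) \<le> U" "U \<le> 3 * card L + (card P)\<^sup>2 / K\<^sup>2"
    and cJ: "real (card J) \<le> real (card (\<Union>d\<in>D. H d)) + card P + (card P)\<^sup>2 / K + K * U / v"
    using slope_partition[OF L P J_sub K v] by (elim exE conjE) metis
  define bad where "bad d = {x \<in> H d. real (card (crossers (R d) (H d) x)) \<le> t}" for d
  define G where "G = (\<Union>d\<in>D. H d - bad d)"
  have fJ: "finite J" by (rule finite_subset[of _ "L \<times> P"]) (use J L P in auto)
  have GJ: "G \<subseteq> J" using D unfolding G_def by blast
  have "(\<Union>d\<in>D. H d) \<subseteq> G \<union> (\<Union>d\<in>D. bad d)" by (auto simp: G_def)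
  moreover have "finite (G \<union> (\<Union>d\<in>D. bad d))"
    by (rule finite_subset[OF _ fJ]) (use GJ D in \<open>auto simp: bad_def\<close>)
  ultimately have "card (\<Union>d\<in>D. H d) \<le> card (G \<union> (\<Union>d\<in>D. bad d))" by (intro card_mono)
  also have "\<dots> \<le> card G + card (\<Union>d\<in>D. bad d)" by (rule card_Un_le)
  also have "\<dots> \<le> card G + (\<Sum>d\<in>D. card (bad d))" using card_UN_le[OF fD] by simp
  finally have "real (card (\<Union>d\<in>D. H d)) \<le> card G + (\<Sum>d\<in>D. real (card (bad d)))" 
    by (simp flip: of_nat_sum of_nat_add)
  also have "(\<Sum>d\<in>D. real (card (bad d))) \<le> (\<Sum>d\<in>D. 12 * real (card (R d)) * sqrt t)"
    unfolding bad_def by (intro sum_mono card_few_crossers) (use D t in auto)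
  also have "\<dots> = 12 * (\<Sum>d\<in>D. real (card (R d))) * sqrt t" by (simp add: sum_distrib_left sum_distrib_right)
  also have "\<dots> \<le> 12 * U * sqrt t" using U(1) t by (intro mult_right_mono) auto
  finally have c: "real (card (\<Union>d\<in>D. H d)) \<le> card G + 12 * U * sqrt t" by simp
  have "\<exists>s. fst l < s \<and> (\<forall>k. (k, p) \<in> J \<longrightarrow> fst l < fst k \<longrightarrow> s \<le> fst k) \<and> rich_wedge L P v t p (fst l) s"
    if "(l, p) \<in> G" for l p
  proof -
    obtain d where d: "d \<in> D" "(l, p) \<in> H d" "(l, p) \<notin> bad d" using \<open>(l, p) \<in> G\<close> by (auto simp: G_def)
    note e = D[OF d(1)]
    have ext: "extendable (R d) (H d)" using e by simp
    let ?k = "next_line (R d) l p" and ?Q = "crossers (R d) (H d) (l, p)"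
    show ?thesis
    proof (intro exI conjI allI impI)
      show "fst l < fst ?k" by (rule next_line(3)[OF ext d(2)])
      show "fst ?k \<le> fst k" if "(k, p) \<in> J" "fst l < fst k" for k
        using succ[OF d(1,2) that] next_line(4)[OF ext d(2)] by force
      show "rich_wedge L P v t p (fst l) (fst ?k)"
        unfolding rich_wedge_def
      proof (intro exI conjI)
        show "?Q \<subseteq> P"
        proof
          fix q assume "q \<in> ?Q"
          then have "q \<in> snd ` H d" by (rule crossers_two_lines(1)[OF ext d(2)])
          then show "q \<in> P" using e J by force
        qed
        show "R d \<subseteq> L" "real (card (R d)) \<le> v" using e by auto
        show "t < real (card ?Q)" using d by (simp add: bad_def)
        show "\<forall>q\<in>?Q. fst p \<noteq> fst q \<and> fst l < slope p q \<and> slope p q < fst ?k \<and>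
          (\<exists>r\<in>R d. \<exists>r'\<in>R d. r \<noteq> r' \<and> incident r q \<and> incident r' q)"
          using crossers_two_lines(2-5)[OF ext d(2)] by blast
      qed
    qed
  qed
  moreover have "real (card J) \<le> card G + card P + (card P)\<^sup>2 / K + K * U / v + 12 * U * sqrt t"
    using cJ c by simp
  ultimately show ?thesis using GJ U(2) by (intro exI[of _ G] exI[of _ U] conjI) blast+
qed

text \<open>The parameters balance the losses: with \<open>K\<close> of order \<open>N\<^sup>2 / A\<close>, \<open>v\<close> of order \<open>N\<^sup>3 / A\<^sup>2\<close> and \<open>t\<close> of
  order \<open>A\<^sup>2 / N\<^sup>2\<close>, each loss is at most a small fraction of \<open>A\<close>.\<close>

lemma many_points_with_rich_wedges:
  fixes L P :: "(real \<times> real) set" and N A :: real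
  assumes L: "finite L" "card L \<le> N" and P: "finite P" "card P \<le> N"
    and J_sub: "J \<subseteq> {(l, p). l \<in> L \<and> p \<in> P \<and> incident l p}"
    and A: "A \<le> card J" "640 * N \<le> A" "A\<^sup>2 \<le> N ^ 3" and N: "1 \<le> N"
  shows "\<exists>P'\<subseteq>P. real (card J) \<le> 4 * card {(l, p) \<in> J. p \<in> P'} \<and>
    (\<forall>p\<in>P'. \<exists>M. (\<forall>l\<in>M. (l, p) \<in> J) \<and> A \<le> 4 * N * card M \<and>
      (\<forall>l\<in>M. \<exists>s > fst l. (\<forall>k\<in>M. fst l < fst k \<longrightarrow> s \<le> fst k) \<and>
        rich_wedge L P (1024 * N ^ 3 / A\<^sup>2) (A\<^sup>2 / (640 * N)\<^sup>2) p (fst l) s))"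
proof -
  have J: "l \<in> L \<and> p \<in> P \<and> incident l p" if "(l, p) \<in> J" for l p using J_sub that by auto
  have N0: "N > 0" and A0: "A > 0" using N A by auto
  define K where "K = nat \<lceil>8 * N\<^sup>2 / A\<rceil>"
  define v where "v = nat \<lceil>32 * N * K / A\<rceil>"
  define t where "t = A\<^sup>2 / (640 * N)\<^sup>2"
  have K1: "8 * N\<^sup>2 / A \<le> K" by (simp add: K_def real_nat_ceiling_ge)
  have "0 < 8 * N\<^sup>2 / A" using N0 A0 by simp
  then have K0: "0 < K" using K1 by linarith
  have AN2: "A \<le> N\<^sup>2"
  proof -
    have "A\<^sup>2 \<le> N ^ 3" by (rule A)
    also have "\<dots> \<le> N ^ 4" using N by (intro power_increasing) auto
    also have "\<dots> = (N\<^sup>2)\<^sup>2" by simp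
    finally show ?thesis by (rule power2_le_imp_le) simp
  qed
  \<comment> \<open>Rounding up a number that is at least 1 at most doubles it; the same happens for
    \<open>v\<close>, so 1024 is 64 times 16.\<close>
  have K2: "K \<le> 16 * N\<^sup>2 / A"
  proof -
    have "real K \<le> 8 * N\<^sup>2 / A + 1" unfolding K_def using \<open>0 < 8 * N\<^sup>2 / A\<close> by linarith
    moreover have "1 \<le> 8 * N\<^sup>2 / A" using A0 AN2 N0 by (simp add: le_divide_eq)
    ultimately show ?thesis by simp
  qed
  have v1: "32 * N * K / A \<le> v" by (simp add: v_def real_nat_ceiling_ge)
  have KN: "8 * N\<^sup>2 \<le> K * A" using K1 A0 by (simp add: divide_le_eq)
  have vb: "1 \<le> 32 * N * K / A"
  proof -
    have "A * A \<le> 1 * N ^ 3" using A(3) by (simp add: power2_eq_square)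
    also have "\<dots> \<le> 8 * N ^ 3" using N0 by (intro mult_right_mono) auto
    also have "\<dots> = N * (8 * N\<^sup>2)" by (simp add: power2_eq_square power3_eq_cube)
    also have "\<dots> \<le> N * (K * A)" using KN N0 by simp
    finally have "A * A \<le> (N * K) * A" by simp
    then have "A \<le> N * K" using A0 by simp
    then show ?thesis using A0 N0 by (simp add: le_divide_eq)
  qed
  have v0: "0 < v" using v1 vb by linarith
  have v2: "v \<le> 1024 * N ^ 3 / A\<^sup>2"
  proof -
    have "v \<le> 32 * N * K / A + 1" unfolding v_def using vb by linarith
    also have "\<dots> \<le> 64 * N * K / A" using vb by simp
    also have "\<dots> \<le> 64 * N * (16 * N\<^sup>2 / A) / A" using K2 N0 A0 by (intro divide_right_mono mult_left_mono) auto
    finally show ?thesis by (simp add: power2_eq_square power3_eq_cube)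
  qed
  have st: "sqrt t = A / (640 * N)"
    by (rule real_sqrt_unique) (use N0 A0 in \<open>simp_all add: t_def power_divide\<close>)
  have t1: "1 \<le> t"
  proof -
    have "1 \<le> A / (640 * N)" using A N0 by simp
    then have "1\<^sup>2 \<le> (A / (640 * N))\<^sup>2" by (intro power_mono) auto
    then show ?thesis by (simp add: t_def power_divide)
  qed
  obtain G and U :: real where G: "G \<subseteq> J" and U: "U \<le> 3 * card L + (card P)\<^sup>2 / K\<^sup>2"
    and cJ: "real (card J) \<le> card G + card P + (card P)\<^sup>2 / K + K * U / v + 12 * U * sqrt t"
    and wedge: "\<And>l p. (l, p) \<in> G \<Longrightarrow> \<exists>s. fst l < s \<and> (\<forall>k. (k, p) \<in> J \<longrightarrow> fst l < fst k \<longrightarrow> s \<le> fst k) \<and>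
       rich_wedge L P v t p (fst l) s"
    using many_rich_wedges[OF L(1) P(1) J_sub K0 v0 t1] by (elim exE conjE) metis
  have P2: "real ((card P)\<^sup>2) \<le> N\<^sup>2" using P(2) by (simp add: power_mono)
  have U4: "U \<le> 4 * N"
  proof -
    have "N\<^sup>2 * (A * A) \<le> N\<^sup>2 * (N * N\<^sup>2)" using A(3) by (intro mult_left_mono) (simp_all add: power2_eq_square power3_eq_cube)
    also have "\<dots> \<le> N * (8 * N\<^sup>2)\<^sup>2" using N0 by (simp add: power2_eq_square)
    also have "\<dots> \<le> N * (K * A)\<^sup>2" using KN N0 by (intro mult_left_mono power_mono) auto
    finally have "N\<^sup>2 * (A * A) \<le> (N * (real K)\<^sup>2) * (A * A)" by (simp add: power2_eq_square mult_ac)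
    then have "N\<^sup>2 \<le> N * (real K)\<^sup>2" using A0 by simp
    then have "(card P)\<^sup>2 / K\<^sup>2 \<le> N" using P2 K0 by (simp add: divide_le_eq)
    then show ?thesis using U L(2) by linarith
  qed
  have l1: "(card P)\<^sup>2 / K \<le> A / 8"
  proof -
    have "(card P)\<^sup>2 / K \<le> N\<^sup>2 / K" using P2 by (simp add: divide_right_mono)
    also have "\<dots> \<le> A / 8" using KN K0 by (simp add: divide_le_eq mult.commute)
    finally show ?thesis .
  qed
  have l2: "K * U / v \<le> A / 8"
  proof -
    have "K * U / v \<le> K * (4 * N) / v" using U4 by (intro divide_right_mono mult_left_mono) auto
    also have "\<dots> \<le> A / 8" using v1 v0 A0 by (simp add: divide_le_eq mult_ac)
    finally show ?thesis .
  qed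
  have l3: "12 * U * sqrt t \<le> A / 8"
  proof -
    have "12 * U * sqrt t \<le> 12 * (4 * N) * (A / (640 * N))" unfolding st using U4 A0 N0 by (intro mult_right_mono) auto
    also have "\<dots> \<le> A / 8" using N0 A0 by simp
    finally show ?thesis .
  qed
  \<comment> \<open>The losses are \<open>A / 640\<close> for the points and three times
    \<open>A / 8\<close>, together at most \<open>A / 2\<close>.\<close>
  have GJ: "card J / 2 \<le> card G" using cJ l1 l2 l3 P(2) A by linarith
  define M where "M p = {l. (l, p) \<in> G}" for p
  \<comment> \<open>The discarded points carry at most \<open>A / 4\<close> incidences of
    \<open>G\<close>, which is at most half of \<open>G\<close>.\<close>
  define P' where "P' = {p \<in> P. A \<le> 4 * N * card (M p)}"
  have fJ: "finite J" by (rule finite_subset[of _ "L \<times> P"]) (use J L P in auto)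
  have fG: "finite G" using G fJ by (rule finite_subset)
  have "G \<subseteq> {(l, p) \<in> G. p \<in> P'} \<union> (\<lambda>(p, l). (l, p)) ` (Sigma (P - P') M)"
    using G J by (auto simp: M_def image_iff)
  moreover have fM: "finite (M p)" for p
    unfolding M_def using finite_imageI[OF fG, of fst] by (rule rev_finite_subset) force
  moreover have f2: "finite (Sigma (P - P') M)" using P fM by auto
  moreover have f1: "finite {(l, p) \<in> G. p \<in> P'}" using fG by (rule rev_finite_subset) auto
  ultimately have "card G \<le> card ({(l, p) \<in> G. p \<in> P'} \<union> (\<lambda>(p, l). (l, p)) ` (Sigma (P - P') M))" by (intro card_mono) auto
  also have "\<dots> \<le> card {(l, p) \<in> G. p \<in> P'} + card ((\<lambda>(p, l). (l, p)) ` (Sigma (P - P') M))" by (rule card_Un_le)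
  also have "\<dots> \<le> card {(l, p) \<in> G. p \<in> P'} + card (Sigma (P - P') M)" using card_image_le[OF f2] by simp
  also have "card (Sigma (P - P') M) = (\<Sum>p\<in>P - P'. card (M p))" using P fM by simp
  finally have "card G \<le> card {(l, p) \<in> G. p \<in> P'} + (\<Sum>p\<in>P - P'. real (card (M p)))"
    by (simp flip: of_nat_sum of_nat_add)
  also have "(\<Sum>p\<in>P - P'. real (card (M p))) \<le> (\<Sum>p\<in>P - P'. A / (4 * N))"
  proof (rule sum_mono)
    fix p assume "p \<in> P - P'"
    then have "4 * N * card (M p) \<le> A" by (auto simp: P'_def)
    then show "real (card (M p)) \<le> A / (4 * N)" using N0 by (simp add: le_divide_eq mult_ac)
  qed
  also have "\<dots> = card (P - P') * (A / (4 * N))" by simp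
  also have "\<dots> \<le> N * (A / (4 * N))"
  proof (rule mult_right_mono)
    have "card (P - P') \<le> card P" using P(1) by (intro card_mono) auto
    then show "real (card (P - P')) \<le> N" using P(2) by linarith
  qed (use A0 N0 in auto)
  also have "\<dots> = A / 4" using N0 by simp
  finally have "card J / 4 \<le> card {(l, p) \<in> G. p \<in> P'}" using GJ A by linarith
  also have "card {(l, p) \<in> G. p \<in> P'} \<le> card {(l, p) \<in> J. p \<in> P'}"
    using G by (intro card_mono finite_subset[OF _ fJ]) auto
  finally have c: "real (card J) \<le> 4 * card {(l, p) \<in> J. p \<in> P'}" by simp
  have rw: "rich_wedge L P (1024 * N ^ 3 / A\<^sup>2) (A\<^sup>2 / (640 * N)\<^sup>2) p m s" if "rich_wedge L P v t p m s" for p m s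
    using that v2 unfolding rich_wedge_def t_def by (meson order_trans)
  show ?thesis
  proof (rule exI[of _ P'], intro conjI ballI)
    show "P' \<subseteq> P" by (auto simp: P'_def)
    show "real (card J) \<le> 4 * card {(l, p) \<in> J. p \<in> P'}" by (rule c)
    fix p assume p: "p \<in> P'"
    show "\<exists>M. (\<forall>l\<in>M. (l, p) \<in> J) \<and> A \<le> 4 * N * card M \<and>
      (\<forall>l\<in>M. \<exists>s > fst l. (\<forall>k\<in>M. fst l < fst k \<longrightarrow> s \<le> fst k) \<and>
        rich_wedge L P (1024 * N ^ 3 / A\<^sup>2) (A\<^sup>2 / (640 * N)\<^sup>2) p (fst l) s)"
    proof (rule exI[of _ "M p"], intro conjI ballI)
      show "A \<le> 4 * N * card (M p)" using p by (simp add: P'_def)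
      fix l assume "l \<in> M p"
      then show "(l, p) \<in> J" using G by (auto simp: M_def)
      from \<open>l \<in> M p\<close> obtain s where "fst l < s" "\<forall>k. (k, p) \<in> J \<longrightarrow> fst l < fst k \<longrightarrow> s \<le> fst k" "rich_wedge L P v t p (fst l) s"
        using wedge[of l p] unfolding M_def by blast
      then show "\<exists>s > fst l. (\<forall>k\<in>M p. fst l < fst k \<longrightarrow> s \<le> fst k) \<and>
          rich_wedge L P (1024 * N ^ 3 / A\<^sup>2) (A\<^sup>2 / (640 * N)\<^sup>2) p (fst l) s"
        using rw G unfolding M_def by blast
    qed
  qed
qed

text \<open>Only the steepest line of \<open>L\<close> through a point starts no segment. Dropping
  these costs at most one incidence per point, and \<open>card_extendable_cube\<close> applies to
  the rest.\<close>

lemma incidence_bound: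
  assumes L: "finite L" and P: "finite P" and J_sub: "J \<subseteq> {(l, p). l \<in> L \<and> p \<in> P \<and> incident l p}"
    and big: "8 * card L + card P < card J"
  shows "(real (card J) - card P) ^ 3 \<le> 128 * (card L)\<^sup>2 * (card P)\<^sup>2"
proof -
  have J: "l \<in> L \<and> p \<in> P \<and> incident l p" if "(l, p) \<in> J" for l p using J_sub that by auto
  define H where "H = {(l, p) \<in> J. \<exists>k\<in>L. incident k p \<and> fst l < fst k}"
  have fJ: "finite J" by (rule finite_subset[of _ "L \<times> P"]) (use J L P in auto)
  have fH: "finite H" using fJ by (rule rev_finite_subset) (auto simp: H_def)
  have ext: "extendable L H" unfolding extendable_def using L fH J by (auto simp: H_def)
  have "card (J - H) \<le> card P"
  proof (rule card_inj_on_le)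
    show "inj_on snd (J - H)"
    proof (rule inj_onI)
      fix x y assume x: "x \<in> J - H" and y: "y \<in> J - H" and eq: "snd x = snd y"
      obtain l k p where xy: "x = (l, p)" "y = (k, p)" using eq by (cases x, cases y) auto
      have l: "l \<in> L" "incident l p" "k \<in> L" "incident k p" using J[of l p] J[of k p] x y xy by auto
      have "\<not> fst l < fst k" "\<not> fst k < fst l" using x y l unfolding H_def xy by blast+
      then show "x = y" using incident_unique[OF l(2,4)] xy by simp
    qed
    show "snd ` (J - H) \<subseteq> P" using J by force
  qed (rule P)
  moreover have "card J \<le> card H + card (J - H)"
    using diff_card_le_card_Diff[OF fH, of J] by linarith
  ultimately have JH: "card J \<le> card H + card P" by linarith
  then have "(real (card J) - card P) ^ 3 \<le> real (card H) ^ 3" using big by (intro power_mono) auto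
  also have "\<dots> \<le> 128 * real (card L) ^ 2 * real (card (snd ` H)) ^ 2"
    by (rule card_extendable_cube[OF ext]) (use JH big in linarith)
  also have "\<dots> \<le> 128 * real (card L) ^ 2 * real (card P) ^ 2"
  proof (intro mult_left_mono power_mono)
    have "card (snd ` H) \<le> card P" using J by (intro card_mono P) (auto simp: H_def)
    then show "real (card (snd ` H)) \<le> real (card P)" by simp
  qed auto
  finally show ?thesis by simp
qed

section \<open>Lines and sectors in the plane\<close>

definition coord :: "real^2 \<Rightarrow> real \<times> real" where
  "coord x = (x $ 1, x $ 2)"

definition line_of :: "real \<times> real \<Rightarrow> (real^2) set" where
  "line_of k = {x. incident k (coord x)}"

lemma coord_eq_iff: "coord x = coord y \<longleftrightarrow> x = y"
  by (simp add: coord_def vec_eq_iff forall_2)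

lemma inj_coord: "inj coord"
  by (simp add: inj_def coord_eq_iff)

lemma inj_line_of: "inj line_of"
proof (rule injI)
  fix k l assume eq: "line_of k = line_of l"
  have "incident l (x, fst k * x + snd k)" for x
  proof -
    have "(vector [x, fst k * x + snd k] :: real^2) \<in> line_of k" by (simp add: line_of_def coord_def incident_def)
    then show ?thesis unfolding eq by (simp add: line_of_def coord_def)
  qed
  from this[of 0] this[of 1] show "k = l" by (simp add: incident_def prod_eq_iff)
qed

lemma is_line_cases:
  fixes l :: "(real^2) set"
  assumes "is_line l"
  obtains k where "l = line_of k" | a where "l = {x. x $ 1 = a}"
proof -
  have l: "affine l" "aff_dim l = 1" using assms by (auto simp: is_line_def)
  have "\<not> l \<subseteq> {a}" for a
  proof
    assume "l \<subseteq> {a}"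
    then have "aff_dim l \<le> aff_dim {a}" by (rule aff_dim_subset)
    then show False using l(2) by simp
  qed
  then obtain a b where ab: "a \<in> l" "b \<in> l" "a \<noteq> b" by blast
  have "affine hull {a, b} = l"
    by (rule affine_dim_equal) (use l ab in \<open>auto simp: aff_dim_2 hull_minimal\<close>)
  then have le: "x \<in> l \<longleftrightarrow> (\<exists>u v. x = u *\<^sub>R a + v *\<^sub>R b \<and> u + v = 1)" for x
    by (auto simp: affine_hull_2)
  show ?thesis
  proof (cases "a $ 1 = b $ 1")
    case True
    then have d: "b $ 2 \<noteq> a $ 2" using ab(3) by (auto simp: vec_eq_iff forall_2)
    have "l = {x. x $ 1 = a $ 1}"
    proof (intro set_eqI iffI)
      fix x assume "x \<in> l"
      then obtain u v where "x = u *\<^sub>R a + v *\<^sub>R b" "u + v = 1" using le by blast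
      then show "x \<in> {x. x $ 1 = a $ 1}" using True by (simp flip: distrib_right)
    next
      fix x :: "real^2" assume x: "x \<in> {x. x $ 1 = a $ 1}"
      define v where "v = (x $ 2 - a $ 2) / (b $ 2 - a $ 2)"
      have "v * (b $ 2 - a $ 2) = x $ 2 - a $ 2" using d by (simp add: v_def)
      then have "x = (1 - v) *\<^sub>R a + v *\<^sub>R b" using x True by (simp add: vec_eq_iff forall_2 algebra_simps)
      then show "x \<in> l" using le by (metis diff_add_cancel)
    qed
    then show ?thesis using that by blast
  next
    case False
    define m where "m = (b $ 2 - a $ 2) / (b $ 1 - a $ 1)"
    have m: "b $ 2 - a $ 2 = m * (b $ 1 - a $ 1)" using False by (simp add: m_def)
    have "l = line_of (m, a $ 2 - m * a $ 1)"
    proof (intro set_eqI iffI)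
      fix x assume "x \<in> l"
      then obtain u v where x: "x = u *\<^sub>R a + v *\<^sub>R b" "u = 1 - v" using le by (metis add_diff_cancel_right')
      have "x $ 1 - a $ 1 = v * (b $ 1 - a $ 1)" "x $ 2 - a $ 2 = v * (b $ 2 - a $ 2)" by (simp_all add: x algebra_simps)
      then have "x $ 2 - a $ 2 = m * (x $ 1 - a $ 1)" using m by simp
      then show "x \<in> line_of (m, a $ 2 - m * a $ 1)" by (simp add: line_of_def incident_def coord_def algebra_simps)
    next
      fix x assume "x \<in> line_of (m, a $ 2 - m * a $ 1)"
      then have x2: "x $ 2 - a $ 2 = m * (x $ 1 - a $ 1)" by (simp add: line_of_def incident_def coord_def algebra_simps)
      define v where "v = (x $ 1 - a $ 1) / (b $ 1 - a $ 1)"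
      have v1: "v * (b $ 1 - a $ 1) = x $ 1 - a $ 1" using False by (simp add: v_def)
      then have "v * (b $ 2 - a $ 2) = x $ 2 - a $ 2" using m x2 by (metis mult.left_commute)
      then have "x = (1 - v) *\<^sub>R a + v *\<^sub>R b" using v1 by (simp add: vec_eq_iff forall_2 algebra_simps)
      then show "x \<in> l" using le by (metis diff_add_cancel)
    qed
    then show ?thesis using that by blast
  qed
qed

text \<open>Angles start at the horizontal, so nonnegative slopes come first and negative slopes
  follow after the vertical direction: the order by angle is a cyclic shift of the order by
  slope.\<close>

definition angle :: "real \<Rightarrow> real" where
  "angle m = (if 0 \<le> m then arctan m else pi + arctan m)"

lemma angle_bounds: "0 \<le> angle m" "angle m < pi"
  using arctan_lbound[of m] arctan_ubound[of m] pi_gt_zero by (auto simp: angle_def)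

lemma angle_less_iff: "angle a < angle b \<longleftrightarrow> (0 \<le> a \<and> b < 0) \<or> (a < b \<and> (0 \<le> a \<longleftrightarrow> 0 \<le> b))"
  using arctan_lbound[of a] arctan_ubound[of a] arctan_lbound[of b] arctan_ubound[of b]
  by (auto simp: angle_def arctan_less_iff)

lemma inj_angle: "inj angle"
proof (rule injI)
  fix a b assume "angle a = angle b"
  then have "\<not> angle a < angle b" "\<not> angle b < angle a" by auto
  then show "a = b" unfolding angle_less_iff by linarith
qed

lemma angle_sin_cos: "cos (angle m) \<noteq> 0" "sin (angle m) = m * cos (angle m)"
proof -
  have "sin (arctan m) = m * cos (arctan m)" by (simp add: sin_arctan cos_arctan)
  then show "cos (angle m) \<noteq> 0" "sin (angle m) = m * cos (angle m)"
    by (auto simp: angle_def sin_add cos_add)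
qed

lemma line_at_angle:
  assumes "incident k (coord p)"
  shows "line_at p (angle (fst k)) = line_of k"
proof (intro set_eqI iffI)
  fix x assume "x \<in> line_at p (angle (fst k))"
  then obtain t where "x = p + t *\<^sub>R vector [cos (angle (fst k)), sin (angle (fst k))]" by (auto simp: line_at_def)
  then show "x \<in> line_of k" using assms by (simp add: line_of_def incident_def coord_def angle_sin_cos(2) algebra_simps)
next
  fix x assume "x \<in> line_of k"
  then have x: "x $ 2 - p $ 2 = fst k * (x $ 1 - p $ 1)" using assms by (simp add: line_of_def incident_def coord_def algebra_simps)
  define t where "t = (x $ 1 - p $ 1) / cos (angle (fst k))"
  have "t * cos (angle (fst k)) = x $ 1 - p $ 1" using angle_sin_cos(1) by (simp add: t_def)
  moreover from this have "t * sin (angle (fst k)) = x $ 2 - p $ 2" unfolding angle_sin_cos(2) x by (metis mult.left_commute)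
  ultimately have "x = p + t *\<^sub>R vector [cos (angle (fst k)), sin (angle (fst k))]"
    by (simp add: vec_eq_iff forall_2)
  then show "x \<in> line_at p (angle (fst k))" by (auto simp: line_at_def)
qed

lemma mem_sector:
  assumes "fst (coord p) \<noteq> fst (coord q)" "a < angle (slope (coord p) (coord q))" "angle (slope (coord p) (coord q)) < b"
  shows "q \<in> sector p a b"
proof -
  let ?m = "slope (coord p) (coord q)"
  let ?k = "(?m, p $ 2 - ?m * p $ 1)"
  have "q $ 2 - p $ 2 = ?m * (q $ 1 - p $ 1)" using assms(1) by (simp add: slope_def coord_def)
  then have "q \<in> line_of ?k" by (simp add: line_of_def incident_def coord_def algebra_simps)
  moreover have "incident ?k (coord p)" by (simp add: incident_def coord_def)
  ultimately have "q \<in> line_at p (angle ?m) - {p}" using line_at_angle[of ?k p] assms(1) by auto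
  then show ?thesis unfolding sector_def using assms by auto
qed

text \<open>If the sector from \<open>a\<close> to \<open>b\<close> passes the vertical direction,
  then \<open>0 \<le> a\<close> and \<open>b < 0\<close>, and every slope above \<open>a\<close>
  lies in it. Only otherwise is the bound \<open>s \<le> b\<close> needed.\<close>

lemma angle_between:
  assumes "angle a < angle b" "a < b \<longrightarrow> s \<le> b" "a < m" "m < s"
  shows "angle a < angle m" "angle m < angle b"
  using assms unfolding angle_less_iff by auto

definition fan :: "(real^2) set set \<Rightarrow> (real^2) set \<Rightarrow> ((real^2) set \<times> (real^2)) set \<Rightarrow> real \<Rightarrow> real \<Rightarrow> real \<Rightarrow> real^2 \<Rightarrow> bool" where
  "fan L P J v t a p \<longleftrightarrow> (\<exists>(M::nat) (l :: nat \<Rightarrow> (real^2) set) (\<theta> :: nat \<Rightarrow> real). a \<le> real M \<and>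
     (\<forall>j\<in>{1..M}. l j \<in> L \<and> (l j, p) \<in> J \<and> 0 \<le> \<theta> j \<and> \<theta> j < pi \<and> l j = line_at p (\<theta> j)) \<and>
     (\<forall>j\<in>{1..<M}. \<theta> j < \<theta> (j + 1) \<and> (\<exists>Q R. Q \<subseteq> P \<and> Q \<subseteq> sector p (\<theta> j) (\<theta> (j + 1)) \<and>
        t \<le> real (card Q) \<and> R \<subseteq> L \<and> real (card R) \<le> v \<and>
        (\<forall>q\<in>Q. \<exists>r\<in>R. \<exists>r'\<in>R. r \<noteq> r' \<and> q \<in> r \<and> q \<in> r'))))"

lemma fan_mono:
  assumes "fan L P J v t a p" "\<And>l. (l, p) \<in> J \<Longrightarrow> (l, p) \<in> J'" "v \<le> v'" "t' \<le> t" "a' \<le> a"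
  shows "fan L P J' v' t' a' p"
proof -
  obtain M and l :: "nat \<Rightarrow> (real^2) set" and \<theta> :: "nat \<Rightarrow> real" where 1: "a \<le> real M"
    and 2: "\<And>j. j \<in> {1..M} \<Longrightarrow> l j \<in> L \<and> (l j, p) \<in> J \<and> 0 \<le> \<theta> j \<and> \<theta> j < pi \<and> l j = line_at p (\<theta> j)"
    and 3: "\<And>j. j \<in> {1..<M} \<Longrightarrow> \<theta> j < \<theta> (j + 1) \<and> (\<exists>Q R. Q \<subseteq> P \<and> Q \<subseteq> sector p (\<theta> j) (\<theta> (j + 1)) \<and>
        t \<le> real (card Q) \<and> R \<subseteq> L \<and> real (card R) \<le> v \<and>
        (\<forall>q\<in>Q. \<exists>r\<in>R. \<exists>r'\<in>R. r \<noteq> r' \<and> q \<in> r \<and> q \<in> r'))"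
    using assms(1) unfolding fan_def by blast
  show ?thesis unfolding fan_def
  proof (rule exI[of _ M], rule exI[of _ l], rule exI[of _ \<theta>], intro conjI ballI)
    show "a' \<le> real M" using 1 assms(5) by linarith
    fix j assume j: "j \<in> {1..M}"
    show "l j \<in> L" "(l j, p) \<in> J'" "0 \<le> \<theta> j" "\<theta> j < pi" "l j = line_at p (\<theta> j)" using 2[OF j] assms(2) by blast+
  next
    fix j assume j: "j \<in> {1..<M}"
    then show "\<theta> j < \<theta> (j + 1)" using 3 by blast
    from 3[OF j] obtain Q R where QR: "Q \<subseteq> P" "Q \<subseteq> sector p (\<theta> j) (\<theta> (j + 1))"
        "t \<le> real (card Q)" "R \<subseteq> L" "real (card R) \<le> v"
        "\<forall>q\<in>Q. \<exists>r\<in>R. \<exists>r'\<in>R. r \<noteq> r' \<and> q \<in> r \<and> q \<in> r'" by blast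
    then have "t' \<le> real (card Q)" "real (card R) \<le> v'" using assms(3,4) by linarith+
    then show "\<exists>Q R. Q \<subseteq> P \<and> Q \<subseteq> sector p (\<theta> j) (\<theta> (j + 1)) \<and>
        t' \<le> real (card Q) \<and> R \<subseteq> L \<and> real (card R) \<le> v' \<and>
        (\<forall>q\<in>Q. \<exists>r\<in>R. \<exists>r'\<in>R. r \<noteq> r' \<and> q \<in> r \<and> q \<in> r')" using QR by blast
  qed
qed

lemma card_coord_vimage: "card (coord -` Q \<inter> P) = card Q" if "Q \<subseteq> coord ` P"
proof -
  have "coord ` (coord -` Q \<inter> P) = Q" using that by auto
  then show ?thesis using card_image[OF inj_on_subset[OF inj_coord subset_UNIV]] by metis
qed

text \<open>The wedges come from the order by slope, the sectors from the order by angle. The two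
  orders disagree only at the vertical direction, and there the wedge still lies in the sector by
  \<open>angle_between\<close>.\<close>

lemma fan_if_rich_wedges:
  assumes M: "finite M"
    and mem: "\<And>k. k \<in> M \<Longrightarrow> incident k (coord p) \<and> line_of k \<in> L \<and> (line_of k, p) \<in> J"
    and wedge: "\<And>k. k \<in> M \<Longrightarrow> \<exists>s > fst k. (\<forall>j\<in>M. fst k < fst j \<longrightarrow> s \<le> fst j) \<and>
      rich_wedge (line_of -` L) (coord ` P) v t (coord p) (fst k) s"
  shows "fan L P J v t (card M) p"
proof -
  define xs where "xs = sorted_list_of_set ((\<lambda>k. angle (fst k)) ` M)"
  have "inj_on (\<lambda>k. angle (fst k)) M"
    by (intro inj_onI) (meson incident_unique injD[OF inj_angle] mem)
  then have len: "length xs = card M" by (simp add: xs_def card_image)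
  have set: "set xs = (\<lambda>k. angle (fst k)) ` M" using M by (simp add: xs_def)
  have less: "xs ! i < xs ! j" if "i < j" "j < length xs" for i j
    using that by (simp add: xs_def sorted_wrt_nth_less)
  have ex: "\<exists>k\<in>M. xs ! i = angle (fst k)" if "i < length xs" for i
    using nth_mem[OF that] unfolding set by auto
  show ?thesis unfolding fan_def
  \<comment> \<open>The lines of a fan are numbered from 1, the entries of the list from 0.\<close>
  proof (rule exI[of _ "card M"], rule exI[of _ "\<lambda>j. line_at p (xs ! (j - 1))"], rule exI[of _ "\<lambda>j. xs ! (j - 1)"], intro conjI ballI)
    fix j assume "j \<in> {1..card M}"
    then have "j - 1 < length xs" using len by auto
    from ex[OF this] obtain k where k: "k \<in> M" "xs ! (j - 1) = angle (fst k)" by blast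
    have "line_at p (xs ! (j - 1)) = line_of k" unfolding k(2) using mem[OF k(1)] by (intro line_at_angle) simp
    then show "line_at p (xs ! (j - 1)) \<in> L" "(line_at p (xs ! (j - 1)), p) \<in> J" using mem[OF k(1)] by simp_all
    show "0 \<le> xs ! (j - 1)" "xs ! (j - 1) < pi" unfolding k(2) by (rule angle_bounds)+
  next
    fix j assume j: "j \<in> {1..<card M}"
    then show lt: "xs ! (j - 1) < xs ! (j + 1 - 1)" using len by (intro less) auto
    have "j - 1 < length xs" "j + 1 - 1 < length xs" using j len by auto
    then obtain k k' where k: "k \<in> M" "xs ! (j - 1) = angle (fst k)" and k': "k' \<in> M" "xs ! (j + 1 - 1) = angle (fst k')"
      using ex by metis
    obtain s where s: "fst k < s" "\<And>j. j \<in> M \<Longrightarrow> fst k < fst j \<Longrightarrow> s \<le> fst j"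
      "rich_wedge (line_of -` L) (coord ` P) v t (coord p) (fst k) s" using wedge[OF k(1)] by blast
    then obtain Q R where Q: "Q \<subseteq> coord ` P" and R: "R \<subseteq> line_of -` L" "real (card R) \<le> v" "t < real (card Q)"
      and q: "\<And>q. q \<in> Q \<Longrightarrow> fst (coord p) \<noteq> fst q \<and> fst k < slope (coord p) q \<and> slope (coord p) q < s \<and>
       (\<exists>r\<in>R. \<exists>r'\<in>R. r \<noteq> r' \<and> incident r q \<and> incident r' q)" unfolding rich_wedge_def by blast
    show "\<exists>Q R. Q \<subseteq> P \<and> Q \<subseteq> sector p (xs ! (j - 1)) (xs ! (j + 1 - 1)) \<and>
        t \<le> real (card Q) \<and> R \<subseteq> L \<and> real (card R) \<le> v \<and>
        (\<forall>q\<in>Q. \<exists>r\<in>R. \<exists>r'\<in>R. r \<noteq> r' \<and> q \<in> r \<and> q \<in> r')"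
    proof (rule exI[of _ "coord -` Q \<inter> P"], rule exI[of _ "line_of ` R"], intro conjI ballI)
      show "coord -` Q \<inter> P \<subseteq> P" by simp
      show "coord -` Q \<inter> P \<subseteq> sector p (xs ! (j - 1)) (xs ! (j + 1 - 1))"
      proof
        fix x assume "x \<in> coord -` Q \<inter> P"
        then have x: "coord x \<in> Q" by simp
        have lt': "angle (fst k) < angle (fst k')" using lt k k' by simp
        show "x \<in> sector p (xs ! (j - 1)) (xs ! (j + 1 - 1))" unfolding k(2) k'(2)
          using q[OF x] s(2)[OF k'(1)] by (intro mem_sector angle_between[OF lt', of s]) auto
      qed
      show "t \<le> real (card (coord -` Q \<inter> P))" using card_coord_vimage[OF Q] R(3) by simp
      show "line_of ` R \<subseteq> L" using R by auto
      show "real (card (line_of ` R)) \<le> v" using R(2) card_image[OF inj_on_subset[OF inj_line_of subset_UNIV]] by metis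
      fix x assume "x \<in> coord -` Q \<inter> P"
      then have x: "coord x \<in> Q" by simp
      then obtain r r' where r: "r \<in> R" "r' \<in> R" "r \<noteq> r'" "incident r (coord x)" "incident r' (coord x)" using q by blast
      show "\<exists>r\<in>line_of ` R. \<exists>r'\<in>line_of ` R. r \<noteq> r' \<and> x \<in> r \<and> x \<in> r'"
      proof (intro bexI conjI)
        show "line_of r \<noteq> line_of r'" using r(3) injD[OF inj_line_of] by blast
        show "x \<in> line_of r" "x \<in> line_of r'" using r by (auto simp: line_of_def)
      qed (use r in auto)
    qed
  qed simp_all
qed

section \<open>Transfer of incidences to coordinates\<close>

definition pull :: "((real^2) set \<times> (real^2)) set \<Rightarrow> ((real \<times> real) \<times> (real \<times> real)) set" where
  "pull J = {(k, q). \<exists>p. q = coord p \<and> (line_of k, p) \<in> J}"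

lemma finite_line_of_vimage: "finite L \<Longrightarrow> finite (line_of -` L)"
  by (rule finite_vimageI[OF _ inj_line_of])

lemma card_line_of_vimage: "finite L \<Longrightarrow> card (line_of -` L) \<le> card L"
  using card_vimage_inj_on_le[OF inj_line_of, of L] by simp

lemma card_pull:
  assumes "\<And>l p. (l, p) \<in> J \<Longrightarrow> l \<in> range line_of"
  shows "card (pull J) = card J"
proof (rule bij_betw_same_card)
  show "bij_betw (\<lambda>(k, q). (line_of k, inv coord q)) (pull J) J"
  proof (rule bij_betw_imageI)
    show "inj_on (\<lambda>(k, q). (line_of k, inv coord q)) (pull J)"
    proof (rule inj_onI)
      fix x y assume x: "x \<in> pull J" and y: "y \<in> pull J"
        and eq: "(\<lambda>(k, q). (line_of k, inv coord q)) x = (\<lambda>(k, q). (line_of k, inv coord q)) y"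
      obtain k p k' p' where "x = (k, coord p)" "y = (k', coord p')" using x y unfolding pull_def by blast
      then show "x = y" using eq by (simp add: inv_f_f[OF inj_coord] inj_eq[OF inj_line_of])
    qed
    show "(\<lambda>(k, q). (line_of k, inv coord q)) ` pull J = J"
    proof (intro equalityI subsetI)
      fix x assume "x \<in> (\<lambda>(k, q). (line_of k, inv coord q)) ` pull J"
      then show "x \<in> J" by (auto simp: pull_def inv_f_f[OF inj_coord])
    next
      fix x assume x: "x \<in> J"
      obtain l p where lp: "x = (l, p)" by (cases x)
      then obtain k where "l = line_of k" using assms x by blast
      then have "(k, coord p) \<in> pull J" "x = (\<lambda>(k, q). (line_of k, inv coord q)) (k, coord p)"
        using x lp by (auto simp: pull_def inv_f_f[OF inj_coord])
      then show "x \<in> (\<lambda>(k, q). (line_of k, inv coord q)) ` pull J" by blast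
    qed
  qed
qed

lemma pull_subset:
  assumes "J \<subseteq> {(l, p). l \<in> L \<and> p \<in> P \<and> p \<in> l}"
  shows "pull J \<subseteq> {(k, q). k \<in> line_of -` L \<and> q \<in> coord ` P \<and> incident k q}"
  using assms by (fastforce simp: pull_def line_of_def)

lemma many_fans:
  fixes N A :: real
  assumes L: "finite L" "card L \<le> N" and P: "finite P" "card P \<le> N"
    and J: "J \<subseteq> {(l, p). l \<in> L \<and> p \<in> P \<and> p \<in> l}" and nv_sub: "fst ` J \<subseteq> range line_of"
    and A: "A \<le> card J" "640 * N \<le> A" "A\<^sup>2 \<le> N ^ 3" and N: "1 \<le> N"
  shows "\<exists>P'\<subseteq>P. real (card J) \<le> 4 * card {(l, p) \<in> J. p \<in> P'} \<and>
    (\<forall>p\<in>P'. fan L P J (1024 * N ^ 3 / A\<^sup>2) (A\<^sup>2 / (640 * N)\<^sup>2) (A / (4 * N)) p)"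
proof -
  have nv: "l \<in> range line_of" if "(l, p) \<in> J" for l p using nv_sub that by force
  have "card (coord ` P) \<le> card P" using P by (intro card_image_le)
  then have cP: "card (coord ` P) \<le> N" using P(2) by linarith
  have cL: "card (line_of -` L) \<le> N" using card_line_of_vimage[OF L(1)] L(2) by linarith
  have cJ: "card (pull J) = card J" by (rule card_pull[OF nv])
  obtain Q where Q: "Q \<subseteq> coord ` P" and c: "real (card (pull J)) \<le> 4 * card {(l, p) \<in> pull J. p \<in> Q}"
    and fans: "\<And>q. q \<in> Q \<Longrightarrow> \<exists>M. (\<forall>k\<in>M. (k, q) \<in> pull J) \<and> A \<le> 4 * N * card M \<and>
      (\<forall>l\<in>M. \<exists>s > fst l. (\<forall>k\<in>M. fst l < fst k \<longrightarrow> s \<le> fst k) \<and>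
        rich_wedge (line_of -` L) (coord ` P) (1024 * N ^ 3 / A\<^sup>2) (A\<^sup>2 / (640 * N)\<^sup>2) q (fst l) s)"
    using many_points_with_rich_wedges[OF finite_line_of_vimage[OF L(1)] cL finite_imageI[OF P(1)] cP pull_subset[OF J] _ A(2,3) N]
      A(1) cJ by auto
  show ?thesis
  proof (rule exI[of _ "coord -` Q \<inter> P"], intro conjI ballI)
    have "{(l, p) \<in> pull J. p \<in> Q} = pull {(l, p) \<in> J. p \<in> coord -` Q \<inter> P}"
      using J by (auto simp: pull_def)
    moreover have "card (pull {(l, p) \<in> J. p \<in> coord -` Q \<inter> P}) = card {(l, p) \<in> J. p \<in> coord -` Q \<inter> P}"
      by (rule card_pull) (use nv in auto)
    ultimately show "real (card J) \<le> 4 * card {(l, p) \<in> J. p \<in> coord -` Q \<inter> P}" using c cJ by simp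
    fix p assume p: "p \<in> coord -` Q \<inter> P"
    then obtain M where M: "\<And>k. k \<in> M \<Longrightarrow> (k, coord p) \<in> pull J" "A \<le> 4 * N * card M"
      and w: "\<And>k. k \<in> M \<Longrightarrow> \<exists>s > fst k. (\<forall>j\<in>M. fst k < fst j \<longrightarrow> s \<le> fst j) \<and>
        rich_wedge (line_of -` L) (coord ` P) (1024 * N ^ 3 / A\<^sup>2) (A\<^sup>2 / (640 * N)\<^sup>2) (coord p) (fst k) s"
      using fans[of "coord p"] by auto
    have mem: "incident k (coord p) \<and> line_of k \<in> L \<and> (line_of k, p) \<in> J" if "k \<in> M" for k
      using M(1)[OF that] J by (auto simp: pull_def coord_eq_iff line_of_def)
    have "finite M" by (rule finite_subset[OF _ finite_line_of_vimage[OF L(1)]]) (use mem in auto)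
    then have "fan L P J (1024 * N ^ 3 / A\<^sup>2) (A\<^sup>2 / (640 * N)\<^sup>2) (card M) p"
      by (rule fan_if_rich_wedges[OF _ mem w])
    then show "fan L P J (1024 * N ^ 3 / A\<^sup>2) (A\<^sup>2 / (640 * N)\<^sup>2) (A / (4 * N)) p"
      by (rule fan_mono) (use M(2) N in \<open>auto simp: divide_le_eq mult_ac\<close>)
  qed simp
qed

text \<open>The incidence bound read backwards: few points cannot carry many incidences, so a set of
  points carrying a positive fraction of \<open>J\<close> must be large.\<close>

lemma card_points_bound:
  fixes N A :: real
  assumes L: "finite L" "card L \<le> N" and P: "finite P"
    and J: "J \<subseteq> {(l, p). l \<in> L \<and> p \<in> P \<and> p \<in> l}" and nv_sub: "fst ` J \<subseteq> range line_of"
    and A: "2 * A \<le> card J" "8 * N < A" "card P \<le> A"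
  shows "A ^ 3 \<le> 128 * N\<^sup>2 * (card P)\<^sup>2"
proof -
  have nv: "l \<in> range line_of" if "(l, p) \<in> J" for l p using nv_sub that by force
  have cP: "card (coord ` P) = card P" by (rule card_image[OF inj_on_subset[OF inj_coord subset_UNIV]])
  have cL: "card (line_of -` L) \<le> N" using card_line_of_vimage[OF L(1)] L(2) by linarith
  have cJ: "card (pull J) = card J" by (rule card_pull[OF nv])
  have "real (8 * card (line_of -` L) + card (coord ` P)) < real (card (pull J))" using cP cL cJ A by simp
  then have "8 * card (line_of -` L) + card (coord ` P) < card (pull J)" by (simp only: of_nat_less_iff)
  from incidence_bound[OF finite_line_of_vimage[OF L(1)] finite_imageI[OF P] pull_subset[OF J] this]
  have "(real (card J) - card P) ^ 3 \<le> 128 * (real (card (line_of -` L)))\<^sup>2 * (real (card P))\<^sup>2" by (simp add: cP cJ)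
  moreover have "A ^ 3 \<le> (real (card J) - card P) ^ 3"
    using A cL by (intro power_mono) linarith+
  moreover have "128 * (real (card (line_of -` L)))\<^sup>2 * (real (card P))\<^sup>2 \<le> 128 * N\<^sup>2 * (real (card P))\<^sup>2"
    using cL by (intro mult_right_mono mult_left_mono power_mono) auto
  ultimately show ?thesis by simp
qed

text \<open>A line outside the range of \<open>line_of\<close> is vertical and hence determined by
  any of its points.\<close>

lemma card_vertical:
  assumes L: "finite L" "\<And>l. l \<in> L \<Longrightarrow> is_line l" and P: "finite P" and J: "J \<subseteq> {(l, p). l \<in> L \<and> p \<in> P \<and> p \<in> l}"
  shows "card {(l, p) \<in> J. l \<notin> range line_of} \<le> card P"
    and "card {l. (l, p) \<in> J \<and> l \<notin> range line_of} \<le> 1"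
proof -
  have vert: "l = {x. x $ 1 = p $ 1}" if "(l, p) \<in> J" "l \<notin> range line_of" for l p
  proof -
    have l: "is_line l" "p \<in> l" using that J L by auto
    show ?thesis using l(1)
      by (cases rule: is_line_cases) (use that l in auto)
  qed
  show "card {(l, p) \<in> J. l \<notin> range line_of} \<le> card P"
  proof (rule card_inj_on_le)
    show "inj_on snd {(l, p) \<in> J. l \<notin> range line_of}"
    proof (rule inj_onI)
      fix x y assume x: "x \<in> {(l, p) \<in> J. l \<notin> range line_of}" and y: "y \<in> {(l, p) \<in> J. l \<notin> range line_of}" and eq: "snd x = snd y"
      have "fst x = {z. z $ 1 = snd x $ 1}" "fst y = {z. z $ 1 = snd y $ 1}" using vert[of "fst x" "snd x"] vert[of "fst y" "snd y"] x y by (simp_all add: case_prod_beta)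
      then show "x = y" using eq by (simp add: prod_eq_iff)
    qed
  qed (use J P in auto)
  have "{l. (l, p) \<in> J \<and> l \<notin> range line_of} \<subseteq> {{x. x $ 1 = p $ 1}}" using vert by blast
  then have "card {l. (l, p) \<in> J \<and> l \<notin> range line_of} \<le> card {{x :: real^2. x $ 1 = p $ 1}}" by (intro card_mono) auto
  then show "card {l. (l, p) \<in> J \<and> l \<notin> range line_of} \<le> 1" by simp
qed

section \<open>Extremal configurations\<close>

lemma exists_powr_large:
  fixes B d :: real
  assumes "0 < d"
  shows "\<exists>N\<^sub>0\<ge>1. \<forall>N\<ge>N\<^sub>0. B \<le> N powr d"
proof (intro exI conjI allI impI)
  define B' where "B' = max 1 B"
  show "1 \<le> max 1 (B' powr (1 / d))" by simp
  fix N assume N: "max 1 (B' powr (1 / d)) \<le> N"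
  have "B \<le> (B' powr (1 / d)) powr d" using assms by (simp add: powr_powr B'_def)
  also have "\<dots> \<le> N powr d" using N assms by (intro powr_mono2) auto
  finally show "B \<le> N powr d" .
qed

lemma card_Sigma_swap: "card {(l, p). p \<in> A \<and> l \<in> S p} = card (Sigma A S)"
  by (rule bij_betw_same_card[of prod.swap]) (auto simp: bij_betw_def inj_on_def image_iff)

text \<open>For the first two conditions on the refinement the whole of \<open>J\<close> is used. For the comparison with
  the rich points, the argument is repeated with equally many incidences at each rich point.\<close>

lemma extremal_fans:
  fixes C C\<^sub>0 \<kappa> N :: real
  assumes cfg: "extremal_partial_configuration C \<kappa> N L P J" and C: "0 < C" "C \<le> C\<^sub>0" "1 \<le> C\<^sub>0"
    and \<kappa>: "0 < \<kappa>" "\<kappa> \<le> 1 / 30" and N: "1 \<le> N"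
    and c1_def: "c1 = 1 / (2 * C\<^sub>0)" and c2_def: "c2 = c1\<^sup>2 / 256" and A_def: "A = c1 * c2 * N powr (4/3 - 3 * \<kappa>)"
    and big1: "640 / (c1 * c2) \<le> N powr (1/6)" and big2: "4 * C\<^sub>0 \<le> N powr (1/6)"
  shows "\<exists>P'\<subseteq>P. real (card J) \<le> 8 * card (J \<inter> (L \<times> P')) \<and> c2 * N \<le> N powr (2 * \<kappa>) * card P' \<and>
    card (rich_points C \<kappa> N P J) \<le> 4 * card P' \<and>
    (\<forall>p\<in>P'. fan L P (J \<inter> (L \<times> P')) (1024 * N ^ 3 / A\<^sup>2) (A\<^sup>2 / (640 * N)\<^sup>2) (A / (4 * N)) p)"
proof -
  have fL: "finite L" and lines: "\<And>l. l \<in> L \<Longrightarrow> is_line l" and fP: "finite P" and cL: "card L \<le> N" and cP: "card P \<le> N"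
    and J: "J \<subseteq> {(l, p). l \<in> L \<and> p \<in> P \<and> p \<in> l}" and cJ: "N powr (4/3 - \<kappa>) \<le> C * real (card J)"
    using cfg by (auto simp: extremal_partial_configuration_def)
  have N0: "0 < N" using N by simp
  have c1: "0 < c1" "c1 \<le> 1" using C by (auto simp: c1_def divide_le_eq)
  have c2: "0 < c2" "c2 \<le> 1"
  proof -
    have "c1\<^sup>2 \<le> 1\<^sup>2" using c1 by (intro power_mono) auto
    then show "c2 \<le> 1" by (simp add: c2_def)
  qed (use c1 in \<open>simp add: c2_def\<close>)
  have c: "0 < c1 * c2" using c1 c2 by simp
  \<comment> \<open>\<open>A1\<close> is the size guaranteed for \<open>J\<close> itself. The
    smaller \<open>A\<close> is the size guaranteed when about
    \<open>c1 * N powr (1/3 - \<kappa>)\<close> incidences are taken at each of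
    \<open>c2 * N powr (1 - 2 * \<kappa>)\<close> points, as happens below for the rich
    points.\<close>
  define A1 where "A1 = c1 * N powr (4/3 - \<kappa>)"
  have fJ: "finite J" by (rule finite_subset[of _ "L \<times> P"]) (use J fL fP in auto)
  have AN: "640 * N \<le> A"
  proof -
    have "640 \<le> c1 * c2 * N powr (1/6)" using big1 c by (simp add: divide_le_eq mult.commute)
    also have "\<dots> \<le> c1 * c2 * N powr (1/3 - 3 * \<kappa>)" using c N \<kappa> by (intro mult_left_mono powr_mono) auto
    finally have "640 * N \<le> c1 * c2 * N powr (1/3 - 3 * \<kappa>) * N" using N0 by simp
    also have "\<dots> = c1 * c2 * (N powr (1/3 - 3 * \<kappa>) * N powr 1)" using N0 by simp
    also have "\<dots> = A" unfolding A_def powr_add[symmetric] by (simp add: algebra_simps)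
    finally show ?thesis .
  qed
  have A0: "0 < A" using AN N0 by linarith
  have AA1: "A \<le> A1"
  proof -
    have "A \<le> c1 * 1 * N powr (4/3 - \<kappa>)" unfolding A_def using c1 c2 N \<kappa>
      by (intro mult_mono powr_mono) auto
    then show ?thesis by (simp add: A1_def)
  qed
  have A1N: "A1\<^sup>2 \<le> N ^ 3"
  proof -
    have "A1 \<le> 1 * N powr (3/2)" unfolding A1_def using c1 N \<kappa> by (intro mult_mono powr_mono) auto
    then have "A1\<^sup>2 \<le> (N powr (3/2))\<^sup>2" using AA1 A0 by (intro power_mono) auto
    also have "\<dots> = N powr 3" by (simp add: power2_eq_square flip: powr_add)
    also have "\<dots> = N ^ 3" using N0 by simp
    finally show ?thesis .
  qed
  have A2N: "A\<^sup>2 \<le> N ^ 3" using A1N AA1 A0 power_mono[of A A1 2] by linarith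
  have JA1: "2 * A1 \<le> card J"
  proof -
    have "N powr (4/3 - \<kappa>) \<le> C\<^sub>0 * real (card J)" using cJ mult_right_mono[OF C(2), of "real (card J)"] by linarith
    then show ?thesis using C by (simp add: A1_def c1_def divide_le_eq mult.commute)
  qed
  define Jn where "Jn = {(l, p) \<in> J. l \<in> range line_of}"
  have Jn: "Jn \<subseteq> {(l, p). l \<in> L \<and> p \<in> P \<and> p \<in> l}" "fst ` Jn \<subseteq> range line_of" "Jn \<subseteq> J"
    using J by (auto simp: Jn_def)
  have "J \<subseteq> Jn \<union> {(l, p) \<in> J. l \<notin> range line_of}" by (auto simp: Jn_def)
  then have "card J \<le> card (Jn \<union> {(l, p) \<in> J. l \<notin> range line_of})"
    using fJ Jn(3) by (intro card_mono) (auto intro: finite_subset)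
  also have "\<dots> \<le> card Jn + card {(l, p) \<in> J. l \<notin> range line_of}" by (rule card_Un_le)
  also have "\<dots> \<le> card Jn + card P" using card_vertical(1)[OF fL lines fP J] by simp
  finally have cJn: "real (card J) \<le> card Jn + N" using cP by linarith
  have NA1: "640 * N \<le> A1" using AN AA1 by linarith
  have "A1 \<le> card Jn" using cJn JA1 NA1 N0 by linarith
  from many_fans[OF fL cL fP cP Jn(1,2) this NA1 A1N N]
  obtain P1 where P1: "P1 \<subseteq> P" "real (card Jn) \<le> 4 * card {(l, p) \<in> Jn. p \<in> P1}"
    and fan1: "\<And>p. p \<in> P1 \<Longrightarrow> fan L P Jn (1024 * N ^ 3 / A1\<^sup>2) (A1\<^sup>2 / (640 * N)\<^sup>2) (A1 / (4 * N)) p" by blast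
  have fP1: "finite P1" using P1(1) fP by (rule finite_subset)
  have cP1N: "card P1 \<le> N" using card_mono[OF fP P1(1)] cP by linarith
  have "(A1 / 8) ^ 3 \<le> 128 * N\<^sup>2 * (card P1)\<^sup>2"
  proof (rule card_points_bound[OF fL cL fP1])
    show "{(l, p) \<in> Jn. p \<in> P1} \<subseteq> {(l, p). l \<in> L \<and> p \<in> P1 \<and> p \<in> l}" using Jn(1) by auto
    show "fst ` {(l, p) \<in> Jn. p \<in> P1} \<subseteq> range line_of" using Jn(2) by auto
    show "2 * (A1 / 8) \<le> card {(l, p) \<in> Jn. p \<in> P1}" using P1(2) \<open>A1 \<le> card Jn\<close> by linarith
    show "8 * N < A1 / 8" using NA1 N0 by linarith
    show "card P1 \<le> A1 / 8" using cP1N NA1 N0 by linarith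
  qed
  then have P1sq: "A1 ^ 3 \<le> 65536 * N\<^sup>2 * (real (card P1))\<^sup>2" by (simp add: power_divide)
  \<comment> \<open>Taking roots in \<open>P1sq\<close> gives the factor c1^(3/2) / 256 and the
    exponent 1 - 3\<kappa>/2. As \<open>c1 \<le> 1 \<le> N\<close>, both may be weakened to
    \<open>c2\<close> and 1 - 2\<kappa>.\<close>
  have cP1: "c2 * N powr (1 - 2 * \<kappa>) \<le> card P1"
  proof (rule power2_le_imp_le)
    have "(c2 * N powr (1 - 2 * \<kappa>))\<^sup>2 = c1 ^ 4 * N powr (2 - 4 * \<kappa>) / 65536"
      by (simp add: c2_def power_mult_distrib power2_eq_square power4_eq_xxxx flip: powr_add)
    also have "\<dots> \<le> c1 ^ 3 * N powr (2 - 3 * \<kappa>) / 65536"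
      using c1 N \<kappa> by (intro divide_right_mono mult_mono power_decreasing powr_mono) auto
    also have "\<dots> = A1 ^ 3 / (65536 * N\<^sup>2)"
    proof -
      have "N powr (2 - 3 * \<kappa>) * N\<^sup>2 = N powr (2 - 3 * \<kappa>) * N powr 2" using N0 by simp
      also have "\<dots> = N powr (4/3 - \<kappa>) * N powr (4/3 - \<kappa>) * N powr (4/3 - \<kappa>)"
        unfolding powr_add[symmetric] by (simp add: algebra_simps)
      finally have "A1 ^ 3 = c1 ^ 3 * (N powr (2 - 3 * \<kappa>) * N\<^sup>2)" by (simp add: A1_def power_mult_distrib power3_eq_cube)
      then show ?thesis using N0 by simp
    qed
    also have "\<dots> \<le> (real (card P1))\<^sup>2" using P1sq N0 by (simp add: divide_le_eq mult_ac)
    finally show "(c2 * N powr (1 - 2 * \<kappa>))\<^sup>2 \<le> (real (card P1))\<^sup>2" .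
  qed simp
  let ?R = "rich_points C \<kappa> N P J"
  let ?fan = "\<lambda>J p. fan L P J (1024 * N ^ 3 / A\<^sup>2) (A\<^sup>2 / (640 * N)\<^sup>2) (A / (4 * N)) p"
  have fan1': "?fan Jn p" if "p \<in> P1" for p
    using fan1[OF that]
  proof (rule fan_mono)
    have sq: "A\<^sup>2 \<le> A1\<^sup>2" using AA1 A0 by (intro power_mono) auto
    have "0 < A1" using AA1 A0 by linarith
    then show "1024 * N ^ 3 / A1\<^sup>2 \<le> 1024 * N ^ 3 / A\<^sup>2" using sq A0 N0 by (intro divide_left_mono) auto
    show "A\<^sup>2 / (640 * N)\<^sup>2 \<le> A1\<^sup>2 / (640 * N)\<^sup>2" using sq by (intro divide_right_mono) auto
    show "A / (4 * N) \<le> A1 / (4 * N)" using AA1 N0 by (intro divide_right_mono) auto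
  qed
  have "\<exists>P2\<subseteq>P. card ?R \<le> 4 * card (P1 \<union> P2) \<and> (\<forall>p\<in>P2. ?fan J p)"
  proof (cases "card ?R \<le> card P1")
    case True
    then show ?thesis by (intro exI[of _ "{}"]) simp
  next
    case False
    define x where "x = N powr (1/3 - \<kappa>)"
    \<comment> \<open>About half of the incidences that a rich point must have. Since
      \<open>x / (2 * C\<^sub>0)\<close> is at least 2, the other half pays for rounding up and for
      a possible vertical line.\<close>
    define k where "k = nat \<lceil>x / (2 * C\<^sub>0)\<rceil>"
    have x: "4 * C\<^sub>0 \<le> x"
    proof -
      have "N powr (1/6) \<le> x" unfolding x_def using N \<kappa> by (intro powr_mono) auto
      then show ?thesis using big2 by linarith
    qed
    have k: "x / (2 * C\<^sub>0) \<le> k" by (simp add: k_def real_nat_ceiling_ge)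
    have k0: "0 < k" using k x C by (smt (verit) divide_pos_pos of_nat_0_less_iff)
    have "0 \<le> x / (2 * C\<^sub>0)" using x C by simp
    then have k1: "k \<le> x / (2 * C\<^sub>0) + 1" unfolding k_def by linarith
    have fin: "finite {l. (l, p) \<in> J}" for p by (rule finite_subset[OF _ fL]) (use J in auto)
    have "\<exists>S. S \<subseteq> {l. (l, p) \<in> Jn} \<and> card S = k" if p: "p \<in> ?R" for p
    proof -
      have "x \<le> C * real (card {l. (l, p) \<in> J})" using p by (simp add: rich_points_def x_def)
      also have "\<dots> \<le> C\<^sub>0 * real (card {l. (l, p) \<in> J})" using C by (intro mult_right_mono) auto
      finally have 1: "x / C\<^sub>0 \<le> card {l. (l, p) \<in> J}" using C by (simp add: divide_le_eq mult.commute)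
      have "{l. (l, p) \<in> J} \<subseteq> {l. (l, p) \<in> Jn} \<union> {l. (l, p) \<in> J \<and> l \<notin> range line_of}" by (auto simp: Jn_def)
      then have "card {l. (l, p) \<in> J} \<le> card ({l. (l, p) \<in> Jn} \<union> {l. (l, p) \<in> J \<and> l \<notin> range line_of})"
        using fin[of p] Jn(3) by (intro card_mono) (auto intro: rev_finite_subset)
      also have "\<dots> \<le> card {l. (l, p) \<in> Jn} + card {l. (l, p) \<in> J \<and> l \<notin> range line_of}" by (rule card_Un_le)
      also have "\<dots> \<le> card {l. (l, p) \<in> Jn} + 1" using card_vertical(2)[OF fL lines fP J] by simp
      finally have 2: "real (card {l. (l, p) \<in> J}) \<le> card {l. (l, p) \<in> Jn} + 1" by linarith
      have "2 \<le> x / (2 * C\<^sub>0)" "x / C\<^sub>0 = x / (2 * C\<^sub>0) + x / (2 * C\<^sub>0)" using x C by (simp_all add: le_divide_eq field_simps)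
      then have "k \<le> card {l. (l, p) \<in> Jn}" using 1 2 k1 by linarith
      then show ?thesis using obtain_subset_with_card_n by metis
    qed
    then have "\<forall>p\<in>?R. \<exists>S. S \<subseteq> {l. (l, p) \<in> Jn} \<and> card S = k" by blast
    from bchoice[OF this] obtain S where S: "\<And>p. p \<in> ?R \<Longrightarrow> S p \<subseteq> {l. (l, p) \<in> Jn}" "\<And>p. p \<in> ?R \<Longrightarrow> card (S p) = k"
      by blast
    have fS: "finite (S p)" if "p \<in> ?R" for p using S(2)[OF that] k0 by (simp add: card_ge_0_finite)
    have fR: "finite ?R" using fP by (simp add: rich_points_def)
    define J2 where "J2 = {(l, p). p \<in> ?R \<and> l \<in> S p}"
    have J2n: "J2 \<subseteq> Jn" using S(1) by (auto simp: J2_def)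
    have cJ2: "card J2 = k * card ?R" unfolding J2_def card_Sigma_swap using fR fS S(2) by simp
    have "A \<le> card J2"
    proof -
      have "A = c1 * c2 * (x * N powr (1 - 2 * \<kappa>))" unfolding A_def x_def powr_add[symmetric] by (simp add: algebra_simps)
      also have "\<dots> = (x / (2 * C\<^sub>0)) * (c2 * N powr (1 - 2 * \<kappa>))" by (simp add: c1_def)
      also have "\<dots> \<le> real k * real (card ?R)" using k cP1 False c2 by (intro mult_mono) auto
      finally show ?thesis using cJ2 by simp
    qed
    from many_fans[OF fL cL fP cP subset_trans[OF J2n Jn(1)] subset_trans[OF image_mono[OF J2n] Jn(2)] this AN A2N N]
    obtain P2 where P2: "P2 \<subseteq> P" "real (card J2) \<le> 4 * card {(l, p) \<in> J2. p \<in> P2}"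
      and fan2: "\<And>p. p \<in> P2 \<Longrightarrow> ?fan J2 p" by blast
    \<comment> \<open>Every rich point carries exactly \<open>k\<close> incidences of
      \<open>J2\<close>, so a quarter of these incidences means a quarter of the rich
      points.\<close>
    have "{(l, p) \<in> J2. p \<in> P2} = {(l, p). p \<in> P2 \<inter> ?R \<and> l \<in> S p}" by (auto simp: J2_def)
    then have "card {(l, p) \<in> J2. p \<in> P2} = k * card (P2 \<inter> ?R)"
      using card_Sigma_swap[of "P2 \<inter> ?R" S] fR fS S(2) by simp
    then have "real (k * card ?R) \<le> real (k * (4 * card (P2 \<inter> ?R)))" using P2(2) cJ2 by simp
    then have "card ?R \<le> 4 * card (P2 \<inter> ?R)" using k0 by (simp only: of_nat_le_iff) simp
    also have "\<dots> \<le> 4 * card (P1 \<union> P2)"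
      using fP P1(1) P2(1) by (intro mult_le_mono2 card_mono) (auto intro: finite_subset)
    finally have "card ?R \<le> 4 * card (P1 \<union> P2)" .
    moreover have "?fan J p" if "p \<in> P2" for p
      by (rule fan_mono[OF fan2[OF that]]) (use J2n Jn(3) in auto)
    ultimately show ?thesis using P2(1) by blast
  qed
  then obtain P2 where P2: "P2 \<subseteq> P" "card ?R \<le> 4 * card (P1 \<union> P2)" and fan2: "\<And>p. p \<in> P2 \<Longrightarrow> ?fan J p" by blast
  let ?P = "P1 \<union> P2"
  have fP': "finite ?P" using fP P1(1) P2(1) by (auto intro: finite_subset)
  show ?thesis
  proof (rule exI[of _ ?P], intro conjI ballI)
    show "?P \<subseteq> P" using P1 P2 by auto
    have "{(l, p) \<in> Jn. p \<in> P1} \<subseteq> J \<inter> (L \<times> ?P)" using Jn by auto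
    then have "card {(l, p) \<in> Jn. p \<in> P1} \<le> card (J \<inter> (L \<times> ?P))" using fJ by (intro card_mono) auto
    then show "real (card J) \<le> 8 * card (J \<inter> (L \<times> ?P))"
      using P1(2) cJn NA1 JA1 N0 by (simp add: of_nat_mono)
    have "c2 * N = c2 * (N powr (2 * \<kappa>) * N powr (1 - 2 * \<kappa>))" using N0 by (simp flip: powr_add)
    also have "\<dots> = N powr (2 * \<kappa>) * (c2 * N powr (1 - 2 * \<kappa>))" by simp
    also have "\<dots> \<le> N powr (2 * \<kappa>) * card P1" using cP1 by (intro mult_left_mono) auto
    also have "\<dots> \<le> N powr (2 * \<kappa>) * card ?P"
      using card_mono[OF fP', of P1] by (intro mult_left_mono) auto
    finally show "c2 * N \<le> N powr (2 * \<kappa>) * card ?P" .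
    show "card ?R \<le> 4 * card ?P" by (rule P2)
    fix p assume p: "p \<in> ?P"
    then have "?fan J p" using fan2 fan_mono[OF fan1'] Jn(3) by blast
    then show "?fan (J \<inter> (L \<times> ?P)) p"
      by (rule fan_mono) (use J p in auto)
  qed
qed

theorem theorem3p14:
  shows "\<forall>K>0. \<exists>K'>0. \<exists>\<epsilon>\<^sub>1>0. \<forall>\<epsilon>\<^sub>0::real. 0 < \<epsilon>\<^sub>0 \<and> \<epsilon>\<^sub>0 < \<epsilon>\<^sub>1 \<longrightarrow>
    (\<forall>C>0. \<exists>C'>0. \<exists>N\<^sub>0\<ge>1. \<forall>N\<ge>N\<^sub>0. \<forall>L P J.
      extremal_partial_configuration C (K * \<epsilon>\<^sub>0) N L P J \<longrightarrow>
      (\<exists>P' J'. refinement C (K * \<epsilon>\<^sub>0) C' (K' * \<epsilon>\<^sub>0) N L P J P' J' \<and>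
        (\<forall>p\<in>P'. \<exists>(M::nat) (l :: nat \<Rightarrow> (real^2) set) (\<theta> :: nat \<Rightarrow> real).
          N powr (1/3 - K' * \<epsilon>\<^sub>0) \<le> C' * real M \<and>
          (\<forall>j\<in>{1..M}. l j \<in> L \<and> (l j, p) \<in> J' \<and>
             0 \<le> \<theta> j \<and> \<theta> j < pi \<and> l j = line_at p (\<theta> j)) \<and>
          (\<forall>j\<in>{1..<M}. \<theta> j < \<theta> (j + 1) \<and>
             (\<exists>Q. Q \<subseteq> P \<and> Q \<subseteq> sector p (\<theta> j) (\<theta> (j + 1)) \<and>
                  structured (K' * \<epsilon>\<^sub>0) N Q \<and>
                  N powr (2/3 - K' * \<epsilon>\<^sub>0) \<le> C' * real (card Q))))))"
proof (intro allI impI)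
  fix K :: real assume K: "0 < K"
  show "\<exists>K'>0. \<exists>\<epsilon>\<^sub>1>0. \<forall>\<epsilon>\<^sub>0::real. 0 < \<epsilon>\<^sub>0 \<and> \<epsilon>\<^sub>0 < \<epsilon>\<^sub>1 \<longrightarrow>
    (\<forall>C>0. \<exists>C'>0. \<exists>N\<^sub>0\<ge>1. \<forall>N\<ge>N\<^sub>0. \<forall>L P J.
      extremal_partial_configuration C (K * \<epsilon>\<^sub>0) N L P J \<longrightarrow>
      (\<exists>P' J'. refinement C (K * \<epsilon>\<^sub>0) C' (K' * \<epsilon>\<^sub>0) N L P J P' J' \<and>
        (\<forall>p\<in>P'. \<exists>(M::nat) (l :: nat \<Rightarrow> (real^2) set) (\<theta> :: nat \<Rightarrow> real).
          N powr (1/3 - K' * \<epsilon>\<^sub>0) \<le> C' * real M \<and>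
          (\<forall>j\<in>{1..M}. l j \<in> L \<and> (l j, p) \<in> J' \<and>
             0 \<le> \<theta> j \<and> \<theta> j < pi \<and> l j = line_at p (\<theta> j)) \<and>
          (\<forall>j\<in>{1..<M}. \<theta> j < \<theta> (j + 1) \<and>
             (\<exists>Q. Q \<subseteq> P \<and> Q \<subseteq> sector p (\<theta> j) (\<theta> (j + 1)) \<and>
                  structured (K' * \<epsilon>\<^sub>0) N Q \<and>
                  N powr (2/3 - K' * \<epsilon>\<^sub>0) \<le> C' * real (card Q))))))"
  \<comment> \<open>As \<open>A\<close> has exponent 4/3 - 3\<kappa>, its square costs N^(6\<kappa>)
    in the number of lines and of points. \<open>structured\<close> admits no constant factor, so
    another N^(2\<kappa>) absorbs the constants; this gives 8. The bound \<kappa> \<le> 1/30 keeps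
    1/3 - 3\<kappa> above 1/6.\<close>
  proof (rule exI[of _ "8 * K"], intro conjI, use K in simp, rule exI[of _ "1 / (30 * K)"], intro conjI, use K in simp, intro allI impI)
    fix \<epsilon>\<^sub>0 C :: real assume \<epsilon>: "0 < \<epsilon>\<^sub>0 \<and> \<epsilon>\<^sub>0 < 1 / (30 * K)" and C: "0 < C"
    define \<kappa> where "\<kappa> = K * \<epsilon>\<^sub>0"
    have \<kappa>: "0 < \<kappa>" "\<kappa> \<le> 1 / 30" using \<epsilon> K by (auto simp: \<kappa>_def field_simps)
    have \<kappa>8: "8 * K * \<epsilon>\<^sub>0 = 8 * \<kappa>" by (simp add: \<kappa>_def)
    define C\<^sub>0 where "C\<^sub>0 = max 1 C"
    have C0: "0 < C" "C \<le> C\<^sub>0" "1 \<le> C\<^sub>0" using C by (auto simp: C\<^sub>0_def)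
    define c1 where "c1 = 1 / (2 * C\<^sub>0)"
    define c2 where "c2 = c1\<^sup>2 / 256"
    define c where "c = c1 * c2"
    have c: "0 < c1" "0 < c2" "0 < c" using C0 by (auto simp: c1_def c2_def c_def)
    \<comment> \<open>The summands serve the incidences, the number of points of the refinement, and
      the number of lines at a point.\<close>
    define C' where "C' = 8 + 1 / c2 + 4 / c"
    have C': "8 \<le> C'" "1 / c2 \<le> C'" "4 / c \<le> C'" using c by (auto simp: C'_def)
    obtain N1 where N1: "1 \<le> N1" "\<And>N. N1 \<le> N \<Longrightarrow> max (640 / c) (4 * C\<^sub>0) \<le> N powr (1/6)"
      using exists_powr_large[of "1/6" "max (640 / c) (4 * C\<^sub>0)"] by auto
    \<comment> \<open>409600 is the square of 640, from the number of points; it also covers the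
      1024 from the number of lines.\<close>
    obtain N2 where N2: "1 \<le> N2" "\<And>N. N2 \<le> N \<Longrightarrow> 409600 / c\<^sup>2 \<le> N powr (2 * \<kappa>)"
      using exists_powr_large[of "2 * \<kappa>" "409600 / c\<^sup>2"] \<kappa> by auto
    show "\<exists>C'>0. \<exists>N\<^sub>0\<ge>1. \<forall>N\<ge>N\<^sub>0. \<forall>L P J.
      extremal_partial_configuration C (K * \<epsilon>\<^sub>0) N L P J \<longrightarrow>
      (\<exists>P' J'. refinement C (K * \<epsilon>\<^sub>0) C' (8 * K * \<epsilon>\<^sub>0) N L P J P' J' \<and>
        (\<forall>p\<in>P'. \<exists>(M::nat) (l :: nat \<Rightarrow> (real^2) set) (\<theta> :: nat \<Rightarrow> real).
          N powr (1/3 - 8 * K * \<epsilon>\<^sub>0) \<le> C' * real M \<and>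
          (\<forall>j\<in>{1..M}. l j \<in> L \<and> (l j, p) \<in> J' \<and>
             0 \<le> \<theta> j \<and> \<theta> j < pi \<and> l j = line_at p (\<theta> j)) \<and>
          (\<forall>j\<in>{1..<M}. \<theta> j < \<theta> (j + 1) \<and>
             (\<exists>Q. Q \<subseteq> P \<and> Q \<subseteq> sector p (\<theta> j) (\<theta> (j + 1)) \<and>
                  structured (8 * K * \<epsilon>\<^sub>0) N Q \<and>
                  N powr (2/3 - 8 * K * \<epsilon>\<^sub>0) \<le> C' * real (card Q)))))"
      unfolding \<kappa>8 \<kappa>_def[symmetric]
    proof (rule exI[of _ C'], intro conjI, use C' in linarith, rule exI[of _ "max N1 N2"], intro conjI, use N1 in simp, intro allI impI)
      fix N L P J assume N12: "max N1 N2 \<le> N" and cfg: "extremal_partial_configuration C \<kappa> N L P J"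
      have N: "1 \<le> N" and b1: "640 / (c1 * c2) \<le> N powr (1/6)" and b2: "4 * C\<^sub>0 \<le> N powr (1/6)"
        and b3: "409600 / c\<^sup>2 \<le> N powr (2 * \<kappa>)"
        using N12 N1(1) N1(2)[of N] N2(2)[of N] by (auto simp: c_def)
      have N0: "0 < N" using N by simp
      define A where "A = c1 * c2 * N powr (4/3 - 3 * \<kappa>)"
      obtain P' where P': "P' \<subseteq> P" "real (card J) \<le> 8 * card (J \<inter> (L \<times> P'))"
        "c2 * N \<le> N powr (2 * \<kappa>) * card P'" "card (rich_points C \<kappa> N P J) \<le> 4 * card P'"
        and fans: "\<And>p. p \<in> P' \<Longrightarrow> fan L P (J \<inter> (L \<times> P')) (1024 * N ^ 3 / A\<^sup>2) (A\<^sup>2 / (640 * N)\<^sup>2) (A / (4 * N)) p"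
        using extremal_fans[OF cfg C0 \<kappa> N c1_def c2_def A_def b1 b2] by blast
      have fP: "finite P" and fL: "finite L" and lines: "\<And>l. l \<in> L \<Longrightarrow> is_line l" and cP: "card P \<le> N"
        using cfg by (auto simp: extremal_partial_configuration_def)
      have A2: "A\<^sup>2 = c\<^sup>2 * N powr (8/3 - 6 * \<kappa>)"
        by (simp add: A_def c_def power_mult_distrib power2_eq_square[of "N powr _"] flip: powr_add)
      have v: "1024 * N ^ 3 / A\<^sup>2 \<le> N powr (1/3 + 8 * \<kappa>)"
      proof -
        have "1024 / c\<^sup>2 \<le> 409600 / c\<^sup>2" using c by (intro divide_right_mono) auto
        then have "1024 \<le> c\<^sup>2 * N powr (2 * \<kappa>)" using b3 c by (simp add: divide_le_eq mult.commute)
        then have "1024 * N powr 3 \<le> c\<^sup>2 * N powr (2 * \<kappa>) * N powr 3" by (rule mult_right_mono) simp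
        also have "\<dots> = c\<^sup>2 * (N powr (2 * \<kappa>) * N powr 3)" by simp
        also have "\<dots> = c\<^sup>2 * (N powr (1/3 + 8 * \<kappa>) * N powr (8/3 - 6 * \<kappa>))"
          unfolding powr_add[symmetric] by (simp add: algebra_simps)
        also have "\<dots> = N powr (1/3 + 8 * \<kappa>) * A\<^sup>2" by (simp add: A2)
        finally have "1024 * N ^ 3 \<le> N powr (1/3 + 8 * \<kappa>) * A\<^sup>2" using N0 by simp
        moreover have "0 < A\<^sup>2" using c N0 by (simp add: A2)
        ultimately show ?thesis by (simp add: divide_le_eq)
      qed
      have t: "N powr (2/3 - 8 * \<kappa>) \<le> A\<^sup>2 / (640 * N)\<^sup>2"
      proof -
        have "409600 \<le> c\<^sup>2 * N powr (2 * \<kappa>)" using b3 c by (simp add: divide_le_eq mult.commute)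
        then have "409600 * N powr (8/3 - 8 * \<kappa>) \<le> c\<^sup>2 * N powr (2 * \<kappa>) * N powr (8/3 - 8 * \<kappa>)" by (rule mult_right_mono) simp
        also have "\<dots> = c\<^sup>2 * (N powr (2 * \<kappa>) * N powr (8/3 - 8 * \<kappa>))" by simp
        also have "\<dots> = A\<^sup>2" unfolding powr_add[symmetric] A2 by simp
        finally have "409600 * (N powr (2/3 - 8 * \<kappa>) * N powr 2) \<le> A\<^sup>2" unfolding powr_add[symmetric] by simp
        then have "N powr (2/3 - 8 * \<kappa>) * (640 * N)\<^sup>2 \<le> A\<^sup>2" using N0 by (simp add: power_mult_distrib)
        then show ?thesis using N0 by (simp add: le_divide_eq)
      qed
      have a: "N powr (1/3 - 8 * \<kappa>) \<le> C' * (A / (4 * N))"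
      proof -
        have "N powr (1/3 - 8 * \<kappa>) \<le> N powr (1/3 - 3 * \<kappa>)" using N \<kappa> by (intro powr_mono) auto
        also have "\<dots> = 4 / c * (A / (4 * N))"
        proof -
          have "N powr (1/3 - 3 * \<kappa>) * N powr 1 = N powr (4/3 - 3 * \<kappa>)" unfolding powr_add[symmetric] by simp
          then have "c * (N powr (1/3 - 3 * \<kappa>) * N) = A" using N0 by (simp add: A_def c_def)
          then show ?thesis using c N0 by (simp add: field_simps)
        qed
        also have "\<dots> \<le> C' * (A / (4 * N))" using C'(3) c N0 by (intro mult_right_mono) (auto simp: A_def c_def)
        finally show ?thesis .
      qed
      let ?J = "J \<inter> (L \<times> P')"
      have "refinement C \<kappa> C' (8 * \<kappa>) N L P J P' ?J"
        unfolding refinement_def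
      proof (intro conjI)
        show "P' \<subseteq> P" by (rule P')
        show "?J \<subseteq> J \<inter> (L \<times> P')" by simp
        have "8 * real (card ?J) \<le> C' * real (card ?J)" using C' by (intro mult_right_mono) auto
        then show "real (card J) \<le> C' * real (card ?J)" using P'(2) by linarith
        have "real (card P) \<le> N" by (rule cP)
        also have "N \<le> 1 / c2 * (N powr (2 * \<kappa>) * card P')" using P'(3) c by (simp add: le_divide_eq mult.commute)
        also have "\<dots> \<le> C' * (N powr (8 * \<kappa>) * card P')"
          using C' c N \<kappa> by (intro mult_mono powr_mono) auto
        finally show "real (card P) \<le> C' * N powr (8 * \<kappa>) * real (card P')" by (simp add: mult.assoc)
        have "4 * real (card P') \<le> C' * real (card P')" using C' by (intro mult_right_mono) auto
        then show "real (card (rich_points C \<kappa> N P J)) \<le> C' * real (card P')" using P'(4) by linarith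
      qed
      moreover have "\<exists>(M::nat) (l :: nat \<Rightarrow> (real^2) set) (\<theta> :: nat \<Rightarrow> real).
          N powr (1/3 - 8 * \<kappa>) \<le> C' * real M \<and>
          (\<forall>j\<in>{1..M}. l j \<in> L \<and> (l j, p) \<in> ?J \<and>
             0 \<le> \<theta> j \<and> \<theta> j < pi \<and> l j = line_at p (\<theta> j)) \<and>
          (\<forall>j\<in>{1..<M}. \<theta> j < \<theta> (j + 1) \<and>
             (\<exists>Q. Q \<subseteq> P \<and> Q \<subseteq> sector p (\<theta> j) (\<theta> (j + 1)) \<and>
                  structured (8 * \<kappa>) N Q \<and>
                  N powr (2/3 - 8 * \<kappa>) \<le> C' * real (card Q)))" if p: "p \<in> P'" for p
      proof -
        obtain M and l :: "nat \<Rightarrow> (real^2) set" and \<theta> :: "nat \<Rightarrow> real" where M: "A / (4 * N) \<le> real M"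
          and l: "\<forall>j\<in>{1..M}. l j \<in> L \<and> (l j, p) \<in> ?J \<and> 0 \<le> \<theta> j \<and> \<theta> j < pi \<and> l j = line_at p (\<theta> j)"
          and Q: "\<And>j. j \<in> {1..<M} \<Longrightarrow> \<theta> j < \<theta> (j + 1) \<and> (\<exists>Q R. Q \<subseteq> P \<and> Q \<subseteq> sector p (\<theta> j) (\<theta> (j + 1)) \<and>
            A\<^sup>2 / (640 * N)\<^sup>2 \<le> real (card Q) \<and> R \<subseteq> L \<and> real (card R) \<le> 1024 * N ^ 3 / A\<^sup>2 \<and>
            (\<forall>q\<in>Q. \<exists>r\<in>R. \<exists>r'\<in>R. r \<noteq> r' \<and> q \<in> r \<and> q \<in> r'))"
          using fans[OF p] unfolding fan_def by blast
        show ?thesis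
        proof (rule exI[of _ M], rule exI[of _ l], rule exI[of _ \<theta>], intro conjI ballI)
          have "C' * (A / (4 * N)) \<le> C' * real M" using M C' by (intro mult_left_mono) auto
          then show "N powr (1/3 - 8 * \<kappa>) \<le> C' * real M" using a by linarith
        next
          fix j assume j: "j \<in> {1..<M}"
          then show "\<theta> j < \<theta> (j + 1)" using Q by blast
          from Q[OF j] obtain Q R where QR: "Q \<subseteq> P" "Q \<subseteq> sector p (\<theta> j) (\<theta> (j + 1))"
            "A\<^sup>2 / (640 * N)\<^sup>2 \<le> real (card Q)" "R \<subseteq> L" "real (card R) \<le> 1024 * N ^ 3 / A\<^sup>2"
            "\<forall>q\<in>Q. \<exists>r\<in>R. \<exists>r'\<in>R. r \<noteq> r' \<and> q \<in> r \<and> q \<in> r'" by blast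
          have cQ: "N powr (2/3 - 8 * \<kappa>) \<le> real (card Q)" using t QR(3) by linarith
          have "structured (8 * \<kappa>) N Q"
            unfolding structured_def
          proof (intro conjI exI[of _ R] ballI)
            show "finite Q" using QR(1) fP by (rule finite_subset)
            show "finite R" using QR(4) fL by (rule finite_subset)
            show "is_line r" if "r \<in> R" for r using that QR(4) lines by blast
            show "real (card R) \<le> N powr (1/3 + 8 * \<kappa>)" using QR(5) v by linarith
          qed (use cQ QR(6) in auto)
          moreover have "1 * real (card Q) \<le> C' * real (card Q)" using C' by (intro mult_right_mono) auto
          ultimately show "\<exists>Q. Q \<subseteq> P \<and> Q \<subseteq> sector p (\<theta> j) (\<theta> (j + 1)) \<and>
                  structured (8 * \<kappa>) N Q \<and> N powr (2/3 - 8 * \<kappa>) \<le> C' * real (card Q)"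
            using QR(1,2) cQ by (intro exI[of _ Q]) auto
        qed (use l in blast)+
      qed
      ultimately show "\<exists>P' J'. refinement C \<kappa> C' (8 * \<kappa>) N L P J P' J' \<and>
        (\<forall>p\<in>P'. \<exists>(M::nat) (l :: nat \<Rightarrow> (real^2) set) (\<theta> :: nat \<Rightarrow> real).
          N powr (1/3 - 8 * \<kappa>) \<le> C' * real M \<and>
          (\<forall>j\<in>{1..M}. l j \<in> L \<and> (l j, p) \<in> J' \<and>
             0 \<le> \<theta> j \<and> \<theta> j < pi \<and> l j = line_at p (\<theta> j)) \<and>
          (\<forall>j\<in>{1..<M}. \<theta> j < \<theta> (j + 1) \<and>
             (\<exists>Q. Q \<subseteq> P \<and> Q \<subseteq> sector p (\<theta> j) (\<theta> (j + 1)) \<and>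
                  structured (8 * \<kappa>) N Q \<and>
                  N powr (2/3 - 8 * \<kappa>) \<le> C' * real (card Q))))"
        by blast
    qed
  qed
qed

end
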